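(* Let $\bar T=(T_1,\dots,T_d)$ be a pure $d$-contraction of finite rank acting on a Hilbert space $H$. Assume that $\bar T$ is graded, let $(D,R)$ be its Dirac operator, and let $D_+$ be the restriction of $D$ to the even subspace. Then both $\ker D_+$ and $\ker D_+^*$ are finite dimensional and $$(-1)^dK(\bar T)=\dim\ker D_+-\dim\ker D_+^*.$$
   Context: Hilbert spaces are complex; $\mathcal B(H)$ denotes the bounded operators on $H$; $\mathbb T$ is the unit circle. $d$-contraction: a commuting $d$-tuple $\bar T=(T_1,\dots,T_d)$ of bounded operators on $H$ with $T_1T_1^*+\dots+T_dT_d^*\le\mathbf 1$. Its defect operator is $\Delta=(\mathbf 1-T_1T_1^*-\dots-T_dT_d^* )^{1/2}$; its rank is the rank of $\Delta$ (finite rank: $\Delta$ is a finite rank operator). It is pure if $\phi^n(\mathbf 1)\to0$ strongly as $n\to\infty$, where $\phi(A)=\sum_kT_kAT_k^*$. Graded: there is a strongly continuous unitary representation $U:\mathbb T\to\mathcal B(H)$ such that $U_\lambda T_kU_\lambda^*=\lambda T_k$ for $k=1,\dots,d$ and $\lambda\in\mathbb T$. Curvature invariant of a finite rank $d$-contraction: for $z$ in the open unit ball of $\mathbb C^d$ put $T(z)=\bar z_1T_1+\dots+\bar z_dT_d$ and let $F(z)=\Delta(\mathbf 1-T(z)^* )^{-1}(\mathbf 1-T(z))^{-1}\Delta$, regarded as an operator on the finite-dimensional space $\Delta H$. For almost every $\zeta$ in the unit sphere $\partial B_d$ of $\mathbb C^d$ the limit $K_0(\zeta)=\lim_{r\uparrow1}(1-r^2)\,\mathrm{trace}\,F(r\zeta)$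 exists (a known fact), and $K(\bar T)=\int_{\partial B_d}K_0\,d\sigma$, where $\sigma$ is the rotation-invariant probability measure on $\partial B_d$. Dirac operator of $\bar T$: let $\Lambda\mathbb C^d=\bigoplus_{k=0}^d\Lambda^k\mathbb C^d$ be the exterior algebra with its natural inner product, $e_1,\dots,e_d$ the standard basis of $\mathbb C^d$, and $C_0(z)x=z\wedge x$ the creation operators on $\Lambda\mathbb C^d$. On $\tilde H=H\otimes\Lambda\mathbb C^d$ set $B=\sum_{k=1}^dT_k\otimes C_0(e_k)$, $D=B+B^*$, and $R(z)=\mathbf 1_H\otimes(C_0(z)+C_0(z)^* )$ for $z\in\mathbb C^d$; $(D,R)$ is the Dirac operator of $\bar T$. Let $\tilde H_+$ (resp. $\tilde H_-$) be the sum of the spaces $H\otimes\Lambda^k\mathbb C^d$ with $k$ even (resp. odd). Then $D$ maps $\tilde H_+$ into $\tilde H_-$ and $\tilde H_-$ into $\tilde H_+$; $D_+=D|_{\tilde H_+}\in\mathcal B(\tilde H_+,\tilde H_-)$, with adjoint $D_+^*=D|_{\tilde H_-}\in\mathcal B(\tilde H_-,\tilde H_+)$. *)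

theory Defs
  imports "HOL-Analysis.Analysis"
begin

section \<open>Complex Hilbert spaces\<close>

text \<open>
  The topology, norm and completeness are inherited from the underlying real Hilbert space; the
  last axiom ties the complex inner product (linear in its first argument) to the real one.
\<close>

class complex_hilbert_space = real_inner + complete_space +
  fixes scaleC :: "complex \<Rightarrow> 'a \<Rightarrow> 'a" (infixr \<open>*\<^sub>C\<close> 75)
    and cinner :: "'a \<Rightarrow> 'a \<Rightarrow> complex"
  assumes scaleR_scaleC: "r *\<^sub>R x = complex_of_real r *\<^sub>C x"
    and scaleC_add_right: "a *\<^sub>C (x + y) = a *\<^sub>C x + a *\<^sub>C y"
    and scaleC_add_left: "(a + b) *\<^sub>C x = a *\<^sub>C x + b *\<^sub>C x"
    and scaleC_scaleC: "a *\<^sub>C b *\<^sub>C x = (a * b) *\<^sub>C x"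
    and cinner_commute: "cinner x y = cnj (cinner y x)"
    and cinner_add_left: "cinner (x + y) z = cinner x z + cinner y z"
    and cinner_scaleC_left: "cinner (a *\<^sub>C x) y = a * cinner x y"
    and Re_cinner: "Re (cinner x y) = inner x y"

interpretation complex_vector: vector_space "scaleC :: complex \<Rightarrow> 'a \<Rightarrow> 'a::complex_hilbert_space"
proof
  show "1 *\<^sub>C x = x" for x :: 'a
    using scaleR_scaleC[of 1 x] by simp
qed (simp_all add: scaleC_add_right scaleC_add_left scaleC_scaleC)

instantiation complex :: complex_hilbert_space
begin

definition "a *\<^sub>C (x::complex) = a * x"
definition "cinner (x::complex) y = x * cnj y"

instance
  by standard
    (simp_all add: scaleC_complex_def cinner_complex_def algebra_simps scaleR_conv_of_real
      inner_complex_def)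

end

instantiation vec :: (complex_hilbert_space, finite) complex_hilbert_space
begin

definition "a *\<^sub>C (x::'a^'b) = (\<chi> i. a *\<^sub>C x $ i)"
definition "cinner (x::'a^'b) y = (\<Sum>i\<in>UNIV. cinner (x $ i) (y $ i))"

instance
proof
  fix r :: real and a b :: complex and x y z :: "'a^'b"
  show "r *\<^sub>R x = complex_of_real r *\<^sub>C x"
    by (simp add: vec_eq_iff scaleC_vec_def scaleR_scaleC)
  show "a *\<^sub>C (x + y) = a *\<^sub>C x + a *\<^sub>C y"
    by (simp add: vec_eq_iff scaleC_vec_def scaleC_add_right)
  show "(a + b) *\<^sub>C x = a *\<^sub>C x + b *\<^sub>C x"
    by (simp add: vec_eq_iff scaleC_vec_def scaleC_add_left)
  show "a *\<^sub>C b *\<^sub>C x = (a * b) *\<^sub>C x"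
    by (simp add: vec_eq_iff scaleC_vec_def scaleC_scaleC)
  show "cinner x y = cnj (cinner y x)"
    unfolding cinner_vec_def cnj_sum by (rule sum.cong) (auto intro: cinner_commute)
  show "cinner (x + y) z = cinner x z + cinner y z"
    by (simp add: cinner_vec_def cinner_add_left sum.distrib)
  show "cinner (a *\<^sub>C x) y = a * cinner x y"
    by (simp add: cinner_vec_def scaleC_vec_def cinner_scaleC_left sum_distrib_left)
  show "Re (cinner x y) = inner x y"
    by (simp add: cinner_vec_def inner_vec_def Re_cinner)
qed

end

definition finite_cdim :: "'a::complex_hilbert_space set \<Rightarrow> bool"
  where "finite_cdim V \<longleftrightarrow> (\<exists>B. finite B \<and> V \<subseteq> complex_vector.span B)"

text \<open>Meaningful for finite-dimensional \<open>V\<close> only; it is \<open>0\<close> otherwise.\<close>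

definition cdim :: "'a::complex_hilbert_space set \<Rightarrow> nat"
  where "cdim V = complex_vector.dim V"

section \<open>Bounded operators\<close>

definition bounded_clinear ::
    "('a::complex_hilbert_space \<Rightarrow> 'b::complex_hilbert_space) \<Rightarrow> bool"
  where "bounded_clinear A \<longleftrightarrow> bounded_linear A \<and> (\<forall>c x. A (c *\<^sub>C x) = c *\<^sub>C A x)"

text \<open>The adjoint exists and is unique whenever \<open>A\<close> is bounded and complex linear.\<close>

definition cadjoint ::
    "('a::complex_hilbert_space \<Rightarrow> 'b::complex_hilbert_space) \<Rightarrow> 'b \<Rightarrow> 'a"
  where "cadjoint A = (SOME B. \<forall>x y. cinner (A x) y = cinner x (B y))"

definition unitary_op :: "('a::complex_hilbert_space \<Rightarrow> 'a) \<Rightarrow> bool"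
  where "unitary_op U \<longleftrightarrow> bounded_clinear U \<and> cadjoint U \<circ> U = id \<and> U \<circ> cadjoint U = id"

definition positive_op :: "('a::complex_hilbert_space \<Rightarrow> 'a) \<Rightarrow> bool"
  where "positive_op A \<longleftrightarrow> bounded_clinear A \<and> (\<forall>x. cinner (A x) x \<in> \<real>\<^sub>\<ge>\<^sub>0)"

text \<open>The positive square root exists and is unique whenever \<open>A\<close> is positive.\<close>

definition sqrt_op :: "('a::complex_hilbert_space \<Rightarrow> 'a) \<Rightarrow> 'a \<Rightarrow> 'a"
  where "sqrt_op A = (THE S. positive_op S \<and> S \<circ> S = A)"

definition orthonormal_basis :: "'a::complex_hilbert_space set \<Rightarrow> 'a set \<Rightarrow> bool"
  where "orthonormal_basis V E \<longleftrightarrow> finite E \<and> complex_vector.span E = V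
    \<and> (\<forall>e\<in>E. \<forall>e'\<in>E. cinner e e' = (if e = e' then 1 else 0))"

text \<open>
  Trace of an operator on a finite-dimensional subspace \<open>V\<close>; the sum does not depend on the
  choice of the orthonormal basis.
\<close>

definition trace_on :: "'a::complex_hilbert_space set \<Rightarrow> ('a \<Rightarrow> 'a) \<Rightarrow> complex"
  where "trace_on V A = (\<Sum>e\<in>(SOME E. orthonormal_basis V E). cinner (A e) e)"

section \<open>Contractions of several variables\<close>

text \<open>A \<open>d\<close>-tuple of operators is a family indexed by a finite type with \<open>d\<close> elements.\<close>

definition d_contraction :: "('d::finite \<Rightarrow> 'h::complex_hilbert_space \<Rightarrow> 'h) \<Rightarrow> bool"
  where "d_contraction T \<longleftrightarrow> (\<forall>k. bounded_clinear (T k)) \<and> (\<forall>j k. T j \<circ> T k = T k \<circ> T j)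
    \<and> positive_op (\<lambda>x. x - (\<Sum>k\<in>UNIV. T k (cadjoint (T k) x)))"

definition defect_op :: "('d::finite \<Rightarrow> 'h::complex_hilbert_space \<Rightarrow> 'h) \<Rightarrow> 'h \<Rightarrow> 'h"
  where "defect_op T = sqrt_op (\<lambda>x. x - (\<Sum>k\<in>UNIV. T k (cadjoint (T k) x)))"

definition finite_rank :: "('d::finite \<Rightarrow> 'h::complex_hilbert_space \<Rightarrow> 'h) \<Rightarrow> bool"
  where "finite_rank T \<longleftrightarrow> finite_cdim (range (defect_op T))"

definition phi_map ::
    "('d::finite \<Rightarrow> 'h::complex_hilbert_space \<Rightarrow> 'h) \<Rightarrow> ('h \<Rightarrow> 'h) \<Rightarrow> 'h \<Rightarrow> 'h"
  where "phi_map T A = (\<lambda>x. \<Sum>k\<in>UNIV. T k (A (cadjoint (T k) x)))"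

definition pure :: "('d::finite \<Rightarrow> 'h::complex_hilbert_space \<Rightarrow> 'h) \<Rightarrow> bool"
  where "pure T \<longleftrightarrow> (\<forall>x. (\<lambda>n. (phi_map T ^^ n) id x) \<longlonglongrightarrow> 0)"

definition circle_rep :: "(complex \<Rightarrow> 'h::complex_hilbert_space \<Rightarrow> 'h) \<Rightarrow> bool"
  where "circle_rep U \<longleftrightarrow> (\<forall>a\<in>sphere 0 1. unitary_op (U a))
    \<and> (\<forall>a\<in>sphere 0 1. \<forall>b\<in>sphere 0 1. U (a * b) = U a \<circ> U b)
    \<and> (\<forall>x. continuous_on (sphere 0 1) (\<lambda>a. U a x))"

definition graded :: "('d::finite \<Rightarrow> 'h::complex_hilbert_space \<Rightarrow> 'h) \<Rightarrow> bool"
  where "graded T \<longleftrightarrow> (\<exists>U. circle_rep U \<and>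
    (\<forall>k. \<forall>a\<in>sphere 0 1. U a \<circ> T k \<circ> cadjoint (U a) = (\<lambda>x. a *\<^sub>C T k x)))"

section \<open>The rotation-invariant probability measure on the unit sphere\<close>

text \<open>
  It is realised as the image, under radial projection \<open>x \<mapsto> x / \<parallel>x\<parallel>\<close>, of normalised Lebesgue
  measure on the unit ball; see \<open>emeasure_sphere_prob_sphere\<close> and \<open>sphere_prob_invariant\<close> below.
\<close>

definition sphere_prob :: "'a::euclidean_space measure"
  where "sphere_prob =
    restrict_space (distr (uniform_measure lborel (ball 0 1)) borel sgn) (sphere 0 1)"

lemma space_sphere_prob: "space (sphere_prob :: 'a::euclidean_space measure) = sphere 0 1"
  by (simp add: sphere_prob_def space_restrict_space)

lemma sets_sphere_prob:
  "sets (sphere_prob :: 'a::euclidean_space measure) = sets (restrict_space borel (sphere 0 1))"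
  by (simp add: sphere_prob_def sets_restrict_space)

lemma borel_measurable_sgn_vec: "(sgn :: 'a::euclidean_space \<Rightarrow> 'a) \<in> borel_measurable borel"
  unfolding sgn_div_norm by measurable

lemma emeasure_sphere_prob:
  assumes "A \<in> sets (sphere_prob :: 'a::euclidean_space measure)"
  shows "emeasure sphere_prob A =
    emeasure lborel (ball 0 1 \<inter> sgn -` A) / emeasure lborel (ball (0::'a) 1)"
proof -
  have A: "A \<in> sets borel" "A \<subseteq> sphere 0 1"
    using assms by (auto simp: sets_sphere_prob sets_restrict_space)
  have 1: "sgn -` A \<in> sets borel"
    using measurable_sets[OF borel_measurable_sgn_vec A(1)] by simp
  have 2: "sgn \<in> measurable (uniform_measure lborel (ball (0::'a) 1)) borel"
    by (metis borel_measurable_sgn_vec measurable_cong_sets sets_lborel sets_uniform_measure)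
  show ?thesis
    unfolding sphere_prob_def using A 1 2
    by (subst emeasure_restrict_space) (auto simp: emeasure_distr)
qed

lemma emeasure_sphere_prob_sphere:
  "emeasure (sphere_prob :: 'a::euclidean_space measure) (sphere 0 1) = 1"
proof -
  let ?B = "ball (0::'a) 1"
  have sp: "?B \<inter> sgn -` sphere 0 1 = ?B - {0}"
    by (auto simp: norm_sgn)
  have 0: "emeasure lborel (?B - {0}) = emeasure lborel ?B"
    by (intro emeasure_Diff_null_set) auto
  have "emeasure lborel ?B \<noteq> 0"
    using open_not_negligible[of ?B] by (auto simp: negligible_iff_null_sets null_sets_def)
  moreover have "emeasure lborel ?B \<noteq> top"
    using emeasure_lborel_ball_finite[of "0::'a" 1] by simp
  moreover have "sphere 0 1 \<in> sets (sphere_prob :: 'a measure)"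
    by (metis sets.top space_sphere_prob)
  ultimately show ?thesis
    by (subst emeasure_sphere_prob) (auto simp: sp 0 ennreal_divide_self less_top[symmetric] zero_less_iff_neq_zero)
qed

lemma distr_lborel_Basis_bij:
  fixes g :: "'a::euclidean_space \<Rightarrow> 'b::euclidean_space"
  assumes g: "linear g" "bij g" "bij_betw g Basis Basis" and iso: "\<And>x y. g x \<bullet> g y = x \<bullet> y"
  shows "distr lborel borel g = lborel"
proof (rule lborel_eqI[symmetric])
  have meas: "g \<in> borel_measurable borel"
    using g(1) by (intro borel_measurable_continuous_onI linear_continuous_on linear_linear[THEN iffD2])
  fix l u :: 'b
  assume lu: "\<And>b. b \<in> Basis \<Longrightarrow> l \<bullet> b \<le> u \<bullet> b"
  obtain l' u' where l': "l = g l'" and u': "u = g u'"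
    using g(2) by (metis bij_pointE)
  have B: "b \<in> Basis \<Longrightarrow> g b \<in> Basis" for b
    using g(3) by (auto simp: bij_betw_def)
  have Bim: "g ` Basis = Basis"
    using g(3) by (auto simp: bij_betw_def)
  have le: "l' \<bullet> b \<le> u' \<bullet> b" if "b \<in> Basis" for b
    using lu[OF B[OF that]] by (simp add: l' u' iso)
  have box: "g -` box l u = box l' u'"
    by (auto simp: box_def Bim[symmetric] l' u' iso)
  have "emeasure (distr lborel borel g) (box l u) = emeasure lborel (box l' u')"
    using meas by (simp add: emeasure_distr box)
  also have "\<dots> = (\<Prod>b\<in>Basis. (u' - l') \<bullet> b)"
    using le by (rule emeasure_lborel_box)
  also have "(\<Prod>b\<in>Basis. (u' - l') \<bullet> b) = (\<Prod>b\<in>Basis. (u - l) \<bullet> b)"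
    using g(3) by (intro prod.reindex_bij_witness[where j = g and i = "the_inv_into Basis g"])
      (auto simp: l' u' iso inner_diff_left bij_betw_def the_inv_into_f_f f_the_inv_into_f
        intro: the_inv_into_into)
  finally show "emeasure (distr lborel borel g) (box l u) = (\<Prod>b\<in>Basis. (u - l) \<bullet> b)" .
qed simp

lemma distr_lborel_orthogonal_real:
  fixes h :: "real^('n::{finite,wellorder}) \<Rightarrow> real^('n::{finite,wellorder})"
  assumes h: "orthogonal_transformation h"
  shows "distr lborel borel h = lborel"
proof (rule lborel_eqI[symmetric])
  have meas: "h \<in> borel_measurable borel"
    using orthogonal_transformation_linear[OF h]
    by (intro borel_measurable_continuous_onI linear_continuous_on linear_linear[THEN iffD2])
  fix l u :: "real^('n::{finite,wellorder})"
  assume lu: "\<And>b. b \<in> Basis \<Longrightarrow> l \<bullet> b \<le> u \<bullet> b"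
  have oi: "orthogonal_transformation (inv h)"
    using h by (rule orthogonal_transformation_inv)
  have im: "h -` box l u = inv h ` box l u"
    using bij_vimage_eq_inv_image[OF orthogonal_transformation_bij[OF h]] .
  have lm: "inv h ` box l u \<in> lmeasurable" "measure lebesgue (inv h ` box l u) = measure lebesgue (box l u)"
    using measurable_orthogonal_image[OF oi, of "box l u"] measure_orthogonal_image[OF oi, of "box l u"]
    by auto
  have borel: "h -` box l u \<in> sets borel"
    using measurable_sets[OF meas, of "box l u"] by simp
  have "emeasure (distr lborel borel h) (box l u) = emeasure lebesgue (h -` box l u)"
    using meas borel by (simp add: emeasure_distr)
  also have "\<dots> = emeasure lebesgue (box l u)"
    unfolding im using lm emeasure_eq_measure2[OF lm(1)] emeasure_eq_measure2[OF lmeasurable_box, of l u]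
    by simp
  also have "\<dots> = (\<Prod>b\<in>Basis. (u - l) \<bullet> b)"
    using lu by (simp add: emeasure_lborel_box)
  finally show "emeasure (distr lborel borel h) (box l u) = (\<Prod>b\<in>Basis. (u - l) \<bullet> b)" .
qed simp

lemma distr_lborel_orthogonal_complex:
  fixes f :: "complex^'d \<Rightarrow> complex^'d"
  assumes f: "orthogonal_transformation f"
  shows "distr lborel borel f = lborel"
proof -
  have "card (UNIV :: ('d + 'd) set) = card (UNIV :: 'd bit0 set)"
    by simp
  then obtain p :: "'d + 'd \<Rightarrow> 'd bit0" where p: "bij p"
    using finite_same_card_bij[of "UNIV :: ('d + 'd) set" "UNIV :: 'd bit0 set"] by auto
  have p_inj: "p a = p b \<longleftrightarrow> a = b" for a b
    using p by (auto simp: bij_def inj_def)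
  have p_inv: "inv p (p a) = a" "p (inv p i) = i" for a i
    using p by (auto simp: bij_def surj_f_inv_f)
  define g :: "real^('d bit0) \<Rightarrow> complex^'d"
    where "g x = (\<chi> k. Complex (x $ p (Inl k)) (x $ p (Inr k)))" for x
  define g' :: "complex^'d \<Rightarrow> real^('d bit0)"
    where "g' z = (\<chi> i. case inv p i of Inl k \<Rightarrow> Re (z $ k) | Inr k \<Rightarrow> Im (z $ k))" for z
  have gg': "g (g' z) = z" for z
    by (simp add: g_def g'_def vec_eq_iff p_inv)
  have g'g: "g' (g x) = x" for x
    by (simp add: g_def g'_def vec_eq_iff split: sum.split) (metis p_inv(2))
  have lin: "linear g"
    by (rule linearI) (auto simp: g_def vec_eq_iff complex_eq_iff)
  have lin': "linear g'"
    by (rule linearI) (auto simp: g'_def vec_eq_iff split: sum.split)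
  have bij: "bij g"
    using gg' g'g by (metis bijI')
  have iso: "g x \<bullet> g y = x \<bullet> y" for x y
  proof -
    have "x \<bullet> y = (\<Sum>a\<in>UNIV. x $ p a * y $ p a)"
      using sum.reindex_bij_betw[OF p, of "\<lambda>i. x $ i * y $ i"] by (simp add: inner_vec_def)
    also have "\<dots> = (\<Sum>a\<in>range Inl. x $ p a * y $ p a) + (\<Sum>a\<in>range Inr. x $ p a * y $ p a)"
      unfolding UNIV_sum by (rule sum.union_disjoint) auto
    also have "\<dots> = (\<Sum>k\<in>UNIV. x $ p (Inl k) * y $ p (Inl k))
        + (\<Sum>k\<in>UNIV. x $ p (Inr k) * y $ p (Inr k))"
      by (simp add: sum.reindex inj_on_def)
    finally show ?thesis
      by (simp add: g_def inner_vec_def inner_complex_def sum.distrib)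
  qed
  have iso': "g' x \<bullet> g' y = x \<bullet> y" for x y
    by (metis iso gg')
  have gl: "g (axis (p (Inl k)) 1) = axis k 1" and gr: "g (axis (p (Inr k)) 1) = axis k \<i>" for k
    by (auto simp: g_def vec_eq_iff axis_def complex_eq_iff p_inj)
  have "g ` Basis = Basis"
  proof
    show "g ` Basis \<subseteq> Basis"
    proof
      fix y assume "y \<in> g ` Basis"
      then obtain a where "y = g (axis (p a) 1)"
        by (auto simp: Basis_vec_def) (metis p_inv(2))
      then show "y \<in> Basis"
        by (cases a) (auto simp: gl gr Basis_vec_def Basis_complex_def)
    qed
    show "Basis \<subseteq> g ` Basis"
    proof
      fix y :: "complex^'d" assume "y \<in> Basis"
      then obtain k where "y = axis k 1 \<or> y = axis k \<i>"
        by (auto simp: Basis_vec_def Basis_complex_def)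
      then show "y \<in> g ` Basis"
        by (metis gl gr image_eqI axis_in_Basis_iff Basis_real_def insertI1)
    qed
  qed
  then have bb: "bij_betw g Basis Basis"
    using bij by (auto simp: bij_betw_def intro: inj_on_subset)
  have g_lborel: "distr lborel borel g = lborel"
    using lin bij bb iso by (rule distr_lborel_Basis_bij)
  have lf: "linear f"
    using f by (rule orthogonal_transformation_linear)
  have h: "orthogonal_transformation (g' \<circ> f \<circ> g)"
    using f lin lin' iso iso' by (auto simp: orthogonal_transformation_def intro!: linear_compose)
  note h_lborel = distr_lborel_orthogonal_real[OF h]
  have m: "g \<in> borel_measurable borel" "f \<in> borel_measurable borel" "g' \<in> borel_measurable borel"
    using lin lf lin'
    by (auto intro!: borel_measurable_continuous_onI linear_continuous_on linear_linear[THEN iffD2])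
  have "distr lborel borel f = distr (distr lborel borel g) borel f"
    by (simp add: g_lborel)
  also have "\<dots> = distr lborel borel (f \<circ> g)"
    using m by (subst distr_distr) auto
  also have "f \<circ> g = g \<circ> (g' \<circ> f \<circ> g)"
    by (auto simp: gg')
  also have "distr lborel borel \<dots> = distr (distr lborel borel (g' \<circ> f \<circ> g)) borel g"
    using m by (subst distr_distr) (auto intro: measurable_comp)
  also have "\<dots> = lborel"
    by (simp only: h_lborel g_lborel)
  finally show ?thesis .
qed

theorem sphere_prob_invariant:
  fixes f :: "complex^'d \<Rightarrow> complex^'d"
  assumes f: "orthogonal_transformation f"
  shows "f \<in> measurable sphere_prob sphere_prob" "distr sphere_prob sphere_prob f = sphere_prob"
proof -
  let ?S = "sphere_prob :: (complex^'d) measure"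
  have lf: "linear f" and nf: "\<And>x. norm (f x) = norm x"
    using f by (auto simp: orthogonal_transformation)
  have mf: "f \<in> borel_measurable borel"
    using lf by (intro borel_measurable_continuous_onI linear_continuous_on linear_linear[THEN iffD2])
  have "f \<in> measurable (restrict_space borel (sphere 0 1)) (restrict_space borel (sphere 0 1))"
    using mf nf by (intro measurable_restrict_space3) auto
  then show meas: "f \<in> measurable ?S ?S"
    by (simp cong: measurable_cong_sets add: sets_sphere_prob)
  show "distr ?S ?S f = ?S"
  proof (rule measure_eqI)
    fix A assume "A \<in> sets (distr ?S ?S f)"
    then have A: "A \<in> sets ?S"
      by simp
    then have A': "A \<in> sets borel" "A \<subseteq> sphere 0 1"
      by (auto simp: sets_sphere_prob sets_restrict_space)
    have pre: "f -` A \<inter> space ?S \<in> sets ?S"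
      using meas A by (rule measurable_sets)
    have sgnf: "sgn (f x) = f (sgn x)" for x
      using lf by (simp add: sgn_div_norm nf linear_scale)
    have eq: "ball 0 1 \<inter> sgn -` (f -` A \<inter> space ?S) = f -` (ball 0 1 \<inter> sgn -` A)"
      using A'(2) by (auto simp: sgnf nf space_sphere_prob)
    have b: "ball 0 1 \<inter> sgn -` A \<in> sets borel"
      using measurable_sets[OF borel_measurable_sgn_vec A'(1)] by auto
    have "emeasure (distr ?S ?S f) A = emeasure ?S (f -` A \<inter> space ?S)"
      using meas A by (rule emeasure_distr)
    also have "\<dots> = emeasure lborel (f -` (ball 0 1 \<inter> sgn -` A)) / emeasure lborel (ball (0::complex^'d) 1)"
      using emeasure_sphere_prob[OF pre] eq by simp
    also have "emeasure lborel (f -` (ball 0 1 \<inter> sgn -` A)) = emeasure (distr lborel borel f) (ball 0 1 \<inter> sgn -` A)"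
      using mf b by (simp add: emeasure_distr)
    also have "\<dots> = emeasure lborel (ball 0 1 \<inter> sgn -` A)"
      by (simp add: distr_lborel_orthogonal_complex[OF f])
    finally show "emeasure (distr ?S ?S f) A = emeasure ?S A"
      using emeasure_sphere_prob[OF A] by simp
  qed simp
qed

section \<open>The curvature invariant\<close>

definition T_lin ::
    "('d::finite \<Rightarrow> 'h::complex_hilbert_space \<Rightarrow> 'h) \<Rightarrow> complex^'d \<Rightarrow> 'h \<Rightarrow> 'h"
  where "T_lin T z = (\<lambda>x. \<Sum>k\<in>UNIV. cnj (z $ k) *\<^sub>C T k x)"

definition F_op ::
    "('d::finite \<Rightarrow> 'h::complex_hilbert_space \<Rightarrow> 'h) \<Rightarrow> complex^'d \<Rightarrow> 'h \<Rightarrow> 'h"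
  where "F_op T z = defect_op T \<circ> inv (\<lambda>x. x - cadjoint (T_lin T z) x)
    \<circ> inv (\<lambda>x. x - T_lin T z x) \<circ> defect_op T"

text \<open>
  Where the limit fails to exist (a set of measure zero), the value of \<open>Lim\<close> is
  a fixed unspecified number.
\<close>

definition K0 :: "('d::finite \<Rightarrow> 'h::complex_hilbert_space \<Rightarrow> 'h) \<Rightarrow> complex^'d \<Rightarrow> complex"
  where "K0 T \<zeta> = Lim (at_left (1::real))
    (\<lambda>r. complex_of_real (1 - r\<^sup>2) * trace_on (range (defect_op T)) (F_op T (r *\<^sub>R \<zeta>)))"

definition curvature :: "('d::finite \<Rightarrow> 'h::complex_hilbert_space \<Rightarrow> 'h) \<Rightarrow> complex"
  where "curvature T = (LINT \<zeta>|sphere_prob. K0 T \<zeta>)"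

section \<open>The Dirac operator\<close>

text \<open>
  The exterior algebra over \<open>complex^'d\<close> is \<open>complex^('d set)\<close>: the unit vector at \<open>S\<close> stands
  for \<open>e\<^sub>S\<close>, the wedge product of the \<open>e\<^sub>k\<close>, \<open>k \<in> S\<close>, in increasing order. These form
  an orthonormal basis. Reordering \<open>e\<^sub>S \<wedge> e\<^sub>S\<^sub>'\<close> for disjoint \<open>S\<close>, \<open>S'\<close> costs the following sign.
\<close>

definition wedge_sign :: "'d::{finite,linorder} set \<Rightarrow> 'd set \<Rightarrow> complex"
  where "wedge_sign S S' = (-1) ^ card {(i, j). i \<in> S \<and> j \<in> S' \<and> j < i}"

definition wedge ::
    "complex^('d::{finite,linorder} set) \<Rightarrow> complex^('d set) \<Rightarrow> complex^('d set)"
  where "wedge x y = (\<chi> U. \<Sum>S\<in>Pow U. wedge_sign S (U - S) * (x $ S) * (y $ (U - S)))"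

definition vector_form :: "complex^('d::{finite,linorder}) \<Rightarrow> complex^('d set)"
  where "vector_form z = (\<Sum>k\<in>UNIV. (z $ k) *\<^sub>C axis {k} 1)"

definition creation ::
    "complex^('d::{finite,linorder}) \<Rightarrow> complex^('d set) \<Rightarrow> complex^('d set)"
  where "creation z x = wedge (vector_form z) x"

text \<open>
  For finite \<open>'n\<close> the Hilbert space tensor product of \<open>'h\<close> and \<open>complex^'n\<close> is \<open>'h^'n\<close>,
  with the elementary tensors and tensor products of operators given by:
\<close>

definition tensor_vec :: "'h::complex_hilbert_space \<Rightarrow> complex^'n \<Rightarrow> 'h^'n"
  where "tensor_vec x v = (\<chi> i. (v $ i) *\<^sub>C x)"

definition tensor_op :: "('h \<Rightarrow> 'h) \<Rightarrow> (complex^'n \<Rightarrow> complex^'n) \<Rightarrow>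
    'h^'n \<Rightarrow> 'h::complex_hilbert_space^'n"
  where "tensor_op A M \<xi> = (\<chi> i. \<Sum>j\<in>UNIV. (M (axis j 1) $ i) *\<^sub>C A (\<xi> $ j))"

lemma cinner_tensor_vec:
  "cinner (tensor_vec x v) (tensor_vec y w) = cinner x y * cinner v w"
proof -
  have r: "cinner a (c *\<^sub>C b) = cnj c * cinner a b" for a b :: 'a and c
    by (metis cinner_commute cinner_scaleC_left complex_cnj_cnj complex_cnj_mult)
  show ?thesis
    by (simp add: tensor_vec_def cinner_vec_def cinner_scaleC_left r cinner_complex_def
        sum_distrib_left algebra_simps)
qed

lemma tensor_op_tensor_vec:
  assumes "bounded_clinear A" "bounded_clinear M"
  shows "tensor_op A M (tensor_vec x v) = tensor_vec (A x) (M v)"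
proof -
  have A: "A (c *\<^sub>C y) = c *\<^sub>C A y" for c y
    using assms(1) by (simp add: bounded_clinear_def)
  have M: "M (c *\<^sub>C y) = c *\<^sub>C M y" for c y
    using assms(2) by (simp add: bounded_clinear_def)
  have "linear M"
    using assms(2) by (simp add: bounded_clinear_def bounded_linear.linear)
  moreover have "v = (\<Sum>j\<in>UNIV. (v $ j) *\<^sub>C axis j 1)"
    by (simp add: vec_eq_iff scaleC_vec_def scaleC_complex_def axis_def if_distrib[of "\<lambda>t. _ * t"]
        cong: if_cong)
  ultimately have "M v = (\<Sum>j\<in>UNIV. (v $ j) *\<^sub>C M (axis j 1))"
    by (metis (no_types, lifting) M linear_sum sum.cong)
  then have "M v $ i = (\<Sum>j\<in>UNIV. (M (axis j 1) $ i) * v $ j)" for i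
    by (simp add: scaleC_vec_def scaleC_complex_def mult.commute)
  then show ?thesis
    by (simp add: vec_eq_iff tensor_op_def tensor_vec_def A scaleC_scaleC
        complex_vector.scale_sum_left)
qed

definition B_op :: "('d::{finite,linorder} \<Rightarrow> 'h::complex_hilbert_space \<Rightarrow> 'h) \<Rightarrow>
    'h^('d set) \<Rightarrow> 'h^('d set)"
  where "B_op T \<xi> = (\<Sum>k\<in>UNIV. tensor_op (T k) (creation (axis k 1)) \<xi>)"

definition dirac_D :: "('d::{finite,linorder} \<Rightarrow> 'h::complex_hilbert_space \<Rightarrow> 'h) \<Rightarrow>
    'h^('d set) \<Rightarrow> 'h^('d set)"
  where "dirac_D T = (\<lambda>\<xi>. B_op T \<xi> + cadjoint (B_op T) \<xi>)"

definition clifford_R ::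
    "complex^('d::{finite,linorder}) \<Rightarrow> 'h::complex_hilbert_space^('d set) \<Rightarrow> 'h^('d set)"
  where "clifford_R z = tensor_op id (\<lambda>x. creation z x + cadjoint (creation z) x)"

definition dirac_operator :: "('d::{finite,linorder} \<Rightarrow> 'h::complex_hilbert_space \<Rightarrow> 'h) \<Rightarrow>
    ('h^('d set) \<Rightarrow> 'h^('d set)) \<times> (complex^('d::{finite,linorder}) \<Rightarrow> 'h^('d set) \<Rightarrow> 'h^('d set))"
  where "dirac_operator T = (dirac_D T, clifford_R)"

text \<open>The sums of the homogeneous parts of even, respectively odd, degree.\<close>

definition even_part :: "('h::complex_hilbert_space^('d::finite set)) set"
  where "even_part = {\<xi>. \<forall>S. odd (card S) \<longrightarrow> \<xi> $ S = 0}"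

definition odd_part :: "('h::complex_hilbert_space^('d::finite set)) set"
  where "odd_part = {\<xi>. \<forall>S. even (card S) \<longrightarrow> \<xi> $ S = 0}"

text \<open>
  With \<open>D\<^sub>+\<close> the restriction of the self-adjoint operator \<open>D\<close> to \<open>even_part\<close>, regarded as a map
  into \<open>odd_part\<close>, the adjoint of \<open>D\<^sub>+\<close> is the restriction of \<open>D\<close> to \<open>odd_part\<close>. So the kernels of
  \<open>D\<^sub>+\<close> and of its adjoint are \<open>ker_on even_part D\<close> and \<open>ker_on odd_part D\<close>.
\<close>

definition ker_on :: "'a set \<Rightarrow> ('a \<Rightarrow> 'b::zero) \<Rightarrow> 'a set"
  where "ker_on V A = {x \<in> V. A x = 0}"

end

theory Submission
  imports Defs "HOL-Combinatorics.Multiset_Permutations"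
begin

text \<open>
  The gauge group splits \<open>H\<close> into weight spaces. Purity and finite rank make them finite-dimensional
  with weights bounded below, so that \<open>H = V 0 \<oplus> V 1 \<oplus> \<dots>\<close> is a finitely generated graded module over
  the polynomials in \<open>T\<^sub>1, \<dots>, T\<^sub>d\<close>. The kernel of \<open>D\<close> consists of the harmonic elements of the Koszul
  complex of this module, which is exact in large degrees by Hilbert's basis theorem; hence it is
  finite-dimensional. Cutting the complex off at a large degree \<open>m\<close> makes everything
  finite-dimensional, and the index becomes \<open>\<Sum>\<^sub>k (-1)\<^sup>k (d choose k) s(m + k)\<close>, where
  \<open>s(n) = dim (V 0 \<oplus> \<dots> \<oplus> V (n - 1))\<close>. Being constant for large \<open>m\<close>, this \<open>d\<close>-th difference
  determines the growth \<open>s(n) \<sim> (-1)\<^sup>d index * n\<^sup>d / d!\<close>.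

  On the analytic side the grading makes \<open>(1 - r\<^sup>2) trace F(r \<zeta>)\<close> the Abel mean of the decreasing sequence
  \<open>\<parallel>T(\<zeta>)\<^sup>n \<Delta>\<parallel>\<^sup>2\<close> (Hilbert-Schmidt norm). So \<open>K\<^sub>0\<close> exists at every point of the sphere, and integrating with
  the known moments of the sphere expresses \<open>K\<close> as the limit of \<open>trace (1 - \<phi>\<^sup>n(1)) * d! / n\<^sup>d\<close>. This trace
  lies between \<open>s(n)\<close> and \<open>s(n + b)\<close> for a constant \<open>b\<close>.
\<close>

section \<open>Complex Hilbert spaces\<close>

\<comment> \<open>The spaces between which \<open>D\<close> acts may be infinite-dimensional, so the
  index cannot be read off directly. The way out: each \<open>T k\<close> raises the weight by one
  and creation by \<open>e_k\<close> raises the exterior degree by one, so \<open>D\<close>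
  preserves their difference \<open>m\<close>, and both kernels split accordingly. Weights are
  bounded below because the adjoints lower them, the range of \<open>\<Delta>\<close> carries only
  finitely many weights, and by purity every nonzero vector is moved by some word in the adjoints to
  one with nonzero defect. Counted from the lower bound, the degrees in the range of
  \<open>\<Delta>\<close> stay below the constant \<open>b\<close>. Hilbert's theorem enters because
  the Koszul induction on the number of variables meets the kernel of one \<open>T s\<close>, a
  submodule whose generators are not given. Growth is measured against \<open>n choose d\<close>,
  whose \<open>d\<close>-th difference is \<open>1\<close>, and replacing \<open>n\<close> by
  \<open>n + b\<close> leaves the leading coefficient unchanged. The moments of the sphere come from
  rotation invariance: diagonal rotations kill the mixed ones, infinitesimal plane rotations relate
  the others, and the total mass fixes their value.\<close>
subclass (in complex_hilbert_space) banach ..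

lemma cinner_add_right: "cinner x (y + z) = cinner x y + cinner x z"
  by (metis cinner_add_left cinner_commute complex_cnj_add)

lemma cinner_scaleC_right: "cinner x (c *\<^sub>C y) = cnj c * cinner x y"
  by (metis cinner_commute cinner_scaleC_left complex_cnj_mult)

lemma cinner_zero_left [simp]: "cinner 0 x = 0"
  using cinner_add_left[of 0 0 x] by simp

lemma cinner_zero_right [simp]: "cinner x 0 = 0"
  using cinner_add_right[of x 0 0] by simp

lemma cinner_minus_left: "cinner (- x) y = - cinner x y"
  using cinner_add_left[of "-x" x y] by (simp add: eq_neg_iff_add_eq_0)

lemma cinner_minus_right: "cinner x (- y) = - cinner x y"
  using cinner_add_right[of x "-y" y] by (simp add: eq_neg_iff_add_eq_0)

lemma cinner_diff_left: "cinner (x - y) z = cinner x z - cinner y z"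
  using cinner_add_left[of x "-y" z] by (simp add: cinner_minus_left)

lemma cinner_diff_right: "cinner z (x - y) = cinner z x - cinner z y"
  using cinner_add_right[of z x "-y"] by (simp add: cinner_minus_right)

lemma cinner_sum_left: "cinner (\<Sum>i\<in>I. f i) y = (\<Sum>i\<in>I. cinner (f i) y)"
  by (induction I rule: infinite_finite_induct) (auto simp: cinner_add_left)

lemma cinner_sum_right: "cinner y (\<Sum>i\<in>I. f i) = (\<Sum>i\<in>I. cinner y (f i))"
  by (induction I rule: infinite_finite_induct) (auto simp: cinner_add_right)

lemma cinner_scaleR_left: "cinner (r *\<^sub>R x) y = of_real r * cinner x y"
  by (simp add: scaleR_scaleC cinner_scaleC_left)

lemmas cinner_simps = cinner_add_left cinner_add_right cinner_diff_left cinner_diff_right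
  cinner_scaleC_left cinner_scaleC_right cinner_minus_left cinner_minus_right

lemma cinner_same: "cinner x x = complex_of_real ((norm x)\<^sup>2)"
proof -
  have "Im (cinner x x) = 0"
    using cinner_commute[of x x] by (simp add: complex_eq_iff)
  moreover have "Re (cinner x x) = (norm x)\<^sup>2"
    by (simp add: Re_cinner power2_norm_eq_inner)
  ultimately show ?thesis
    by (simp add: complex_eq_iff)
qed

lemma cinner_same_eq_0_iff [simp]: "cinner x x = 0 \<longleftrightarrow> x = 0"
  by (simp add: cinner_same)

lemma cinner_eq_0_commute: "cinner x y = 0 \<longleftrightarrow> cinner y x = 0"
  by (metis cinner_commute complex_cnj_zero_iff)

lemma norm_eq_cinner: "(norm x)\<^sup>2 = Re (cinner x x)"
  by (simp add: cinner_same)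

lemma norm_scaleC [simp]: "norm (c *\<^sub>C x) = norm c * norm x"
proof -
  have "(norm (c *\<^sub>C x))\<^sup>2 = Re ((c * cnj c) * cinner x x)"
    by (simp add: norm_eq_cinner cinner_simps algebra_simps)
  also have "\<dots> = (norm c * norm x)\<^sup>2"
    by (simp only: complex_norm_square[symmetric] cinner_same of_real_mult[symmetric] Re_complex_of_real
        power_mult_distrib)
  finally show ?thesis
    by (simp add: power2_eq_iff_nonneg)
qed

text \<open>A phase \<open>c\<close> (zero if the product vanishes) turns the product into its own
  modulus, where the real Cauchy-Schwarz inequality for \<open>inner\<close>, the real part,
  applies.\<close>

lemma norm_cinner_le: "norm (cinner x y) \<le> norm x * norm y"
proof -
  define c where "c = cnj (sgn (cinner x y))"
  have nc: "norm c \<le> 1"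
    by (simp add: c_def norm_sgn)
  have "c * cinner x y = of_real (norm (cinner x y))"
    by (cases "cinner x y = 0")
      (auto simp: c_def sgn_eq divide_simps complex_norm_square[symmetric] power2_eq_square
        mult.commute[of "cnj _"])
  then have "norm (cinner x y) = inner (c *\<^sub>C x) y"
    by (metis Re_cinner Re_complex_of_real cinner_scaleC_left)
  also have "\<dots> \<le> norm (c *\<^sub>C x) * norm y"
    by (rule norm_cauchy_schwarz)
  also have "\<dots> \<le> norm x * norm y"
    using nc by (auto intro!: mult_right_mono mult_left_le_one_le)
  finally show ?thesis .
qed

lemma cinner_ext_left: "(\<And>z. cinner x z = cinner y z) \<Longrightarrow> x = y"
  by (metis cinner_diff_left cinner_same_eq_0_iff eq_iff_diff_eq_0)

lemma bounded_linear_cinner_left: "bounded_linear (\<lambda>x. cinner x y)"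
  by (rule bounded_linear_intro[where K = "norm y"])
    (auto simp: cinner_add_left cinner_scaleR_left scaleR_conv_of_real norm_cinner_le)

lemma bounded_linear_cinner_right: "bounded_linear (cinner x)"
  by (rule bounded_linear_intro[where K = "norm x"])
    (auto simp: cinner_add_right scaleR_scaleC cinner_scaleC_right scaleR_conv_of_real
      scaleC_complex_def norm_cinner_le mult.commute[of "norm x"] intro: order.trans[OF norm_cinner_le])

lemmas tendsto_cinner_left = bounded_linear.tendsto[OF bounded_linear_cinner_left]
lemmas tendsto_cinner_right = bounded_linear.tendsto[OF bounded_linear_cinner_right]

lemma norm_add_orthogonal:
  assumes "cinner x y = 0"
  shows "(norm (x + y))\<^sup>2 = (norm x)\<^sup>2 + (norm y)\<^sup>2"
  using assms cinner_eq_0_commute[of x y]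
  by (simp add: norm_eq_cinner cinner_simps)

lemma norm_sum_orthogonal:
  assumes "finite I" "\<And>i j. i \<in> I \<Longrightarrow> j \<in> I \<Longrightarrow> i \<noteq> j \<Longrightarrow> cinner (f i) (f j) = 0"
  shows "(norm (\<Sum>i\<in>I. f i))\<^sup>2 = (\<Sum>i\<in>I. (norm (f i))\<^sup>2)"
  using assms
proof (induction I rule: finite_induct)
  case (insert i I)
  have "cinner (f i) (\<Sum>j\<in>I. f j) = 0"
    unfolding cinner_sum_right using insert.hyps by (intro sum.neutral) (auto intro!: insert.prems)
  then show ?case
    using insert by (simp add: norm_add_orthogonal)
qed simp

text \<open>Riesz representation: the representing vector minimizes \<open>\<parallel>x\<parallel>\<^sup>2 - 2 f x\<close>; minimizing sequences
  are Cauchy by the parallelogram law.\<close>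

lemma riesz_real:
  fixes f :: "'a::{real_inner,complete_space} \<Rightarrow> real"
  assumes "bounded_linear f"
  obtains y where "\<And>x. f x = inner x y"
proof -
  interpret f: bounded_linear f by fact
  obtain K where K: "\<And>x. \<bar>f x\<bar> \<le> norm x * K" "0 \<le> K"
    using f.nonneg_bounded by auto
  define J where "J x = (norm x)\<^sup>2 - 2 * f x" for x
  have bd: "- K\<^sup>2 \<le> J x" for x
  proof -
    have "0 \<le> (norm x - K)\<^sup>2" by simp
    then show ?thesis
      using K(1)[of x] by (auto simp: J_def power2_eq_square algebra_simps abs_le_iff)
  qed
  have bb: "bdd_below (range J)"
    by (rule bdd_belowI[where m = "- K\<^sup>2"]) (auto simp: bd)
  define m where "m = Inf (range J)"
  have m: "m \<le> J x" for x
    unfolding m_def using bb by (auto intro: cInf_lower)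
  have "\<exists>x. J x < m + 1 / real (Suc n)" for n
    using cInf_lessD[of "range J" "m + 1 / real (Suc n)"] by (auto simp: m_def)
  then obtain X where X: "\<And>n. J (X n) < m + 1 / real (Suc n)"
    by metis
  \<comment> \<open>Parallelogram law; the midpoint term is at least \<open>m\<close>, so
    near-minimizers are close to each other.\<close>
  have par: "(norm (x - y))\<^sup>2 \<le> 2 * (J x - m) + 2 * (J y - m)" for x y
  proof -
    have "(norm (x - y))\<^sup>2 = 2 * J x + 2 * J y - 4 * J ((1/2) *\<^sub>R (x + y))"
      unfolding J_def f.scaleR f.add
      by (simp add: power2_norm_eq_inner inner_simps inner_commute algebra_simps)
    then show ?thesis
      using m[of "(1/2) *\<^sub>R (x + y)"] by simp
  qed
  have "Cauchy X"
  proof (rule metric_CauchyI)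
    fix e :: real assume e: "0 < e"
    obtain N where N: "4 / real (Suc N) < e\<^sup>2"
    proof -
      obtain N where "4 / e\<^sup>2 < real N"
        using reals_Archimedean2 by blast
      then have "4 / e\<^sup>2 < real (Suc N)" by simp
      then show ?thesis
        using e that[of N] by (simp add: field_simps del: of_nat_Suc)
    qed
    have "dist (X i) (X j) < e" if "N \<le> i" "N \<le> j" for i j
    proof -
      have "1 / real (Suc i) \<le> 1 / real (Suc N)" "1 / real (Suc j) \<le> 1 / real (Suc N)"
        using that by (auto simp: divide_simps)
      then have *: "J (X i) - m < 1 / real (Suc N)" "J (X j) - m < 1 / real (Suc N)"
        using X[of i] X[of j] by linarith+
      define s where "s = 1 / real (Suc N)"
      have "4 * s < e\<^sup>2" using N by (simp add: s_def)
      then have "(norm (X i - X j))\<^sup>2 < e\<^sup>2"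
        using *[folded s_def] by (intro order.strict_trans1[OF par]) (simp add: algebra_simps)
      then show ?thesis
        using e by (simp add: dist_norm power_less_imp_less_base)
    qed
    then show "\<exists>M. \<forall>i\<ge>M. \<forall>j\<ge>M. dist (X i) (X j) < e"
      by blast
  qed
  then obtain y where y: "X \<longlonglongrightarrow> y"
    using Cauchy_convergent_iff convergent_def by blast
  have "(\<lambda>n. J (X n)) \<longlonglongrightarrow> J y"
    unfolding J_def by (intro tendsto_intros f.tendsto y)
  moreover have "(\<lambda>n. m + 1 / real (Suc n)) \<longlonglongrightarrow> m + 0"
    by (intro tendsto_intros LIMSEQ_inverse_real_of_nat[unfolded inverse_eq_divide])
  ultimately have Jy: "J y \<le> m"
    using X by (intro LIMSEQ_le) (auto intro: less_imp_le)
  have "f x = inner x y" for x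
  proof -
    \<comment> \<open>\<open>g\<close> is half the derivative of \<open>J\<close> at the minimum
      \<open>y\<close> in direction \<open>x\<close>. Stepping by \<open>- g / s\<close> would lower
      \<open>J\<close> unless \<open>g = 0\<close>; the \<open>+ 1\<close> in \<open>s\<close>
      covers \<open>x = 0\<close>.\<close>
    define g where "g = inner x y - f x"
    have q: "0 \<le> t\<^sup>2 * (norm x)\<^sup>2 + 2 * t * g" for t
    proof -
      have "J (y + t *\<^sub>R x) = J y + t\<^sup>2 * (norm x)\<^sup>2 + 2 * t * g"
        unfolding J_def f.scaleR f.add g_def power2_norm_eq_inner
        by (simp add: inner_simps inner_commute algebra_simps power2_eq_square)
      then show ?thesis
        using m[of "y + t *\<^sub>R x"] Jy by simp
    qed
    have "g = 0"
    proof (rule ccontr)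
      assume g: "g \<noteq> 0"
      define s where "s = (norm x)\<^sup>2 + 1"
      have s: "s > 0" by (simp add: s_def add_nonneg_pos)
      have "0 \<le> (g / s)\<^sup>2 * (norm x)\<^sup>2 - 2 * (g / s) * g"
        using q[of "- g / s"] by simp
      also have "\<dots> \<le> (g / s)\<^sup>2 * s - 2 * (g / s) * g"
        by (simp add: s_def mult_left_mono)
      also have "\<dots> = - (g\<^sup>2 / s)"
        using s by (simp add: field_simps power2_eq_square)
      also have "\<dots> < 0"
        using s g by simp
      finally show False by simp
    qed
    then show ?thesis by (simp add: g_def)
  qed
  then show ?thesis
    using that by blast
qed

section \<open>Bounded complex-linear maps and their adjoints\<close>

lemma bounded_clinear_scaleC: "bounded_clinear A \<Longrightarrow> A (c *\<^sub>C x) = c *\<^sub>C A x"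
  by (simp add: bounded_clinear_def)

lemma bounded_clinear_add: "bounded_clinear A \<Longrightarrow> A (x + y) = A x + A y"
  by (simp add: bounded_clinear_def bounded_linear.linear linear_add)

lemma bounded_clinear_diff: "bounded_clinear A \<Longrightarrow> A (x - y) = A x - A y"
  by (simp add: bounded_clinear_def bounded_linear.linear linear_diff)

lemma bounded_clinear_0: "bounded_clinear A \<Longrightarrow> A 0 = 0"
  by (simp add: bounded_clinear_def bounded_linear.linear linear_0)

lemma bounded_clinear_minus: "bounded_clinear A \<Longrightarrow> A (- x) = - A x"
  by (simp add: bounded_clinear_def bounded_linear.linear linear_neg)

lemma bounded_clinear_sum: "bounded_clinear A \<Longrightarrow> A (\<Sum>i\<in>I. f i) = (\<Sum>i\<in>I. A (f i))"
  by (simp add: bounded_clinear_def bounded_linear.linear linear_sum)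

lemma bounded_clinear_tendsto:
  "bounded_clinear A \<Longrightarrow> (f \<longlongrightarrow> l) F \<Longrightarrow> ((\<lambda>x. A (f x)) \<longlongrightarrow> A l) F"
  by (simp add: bounded_clinear_def bounded_linear.tendsto)

lemma bounded_clinearI:
  assumes "\<And>x y. A (x + y) = A x + A y" "\<And>c x. A (c *\<^sub>C x) = c *\<^sub>C A x"
    "\<And>x. norm (A x) \<le> K * norm x"
  shows "bounded_clinear A"
  unfolding bounded_clinear_def
  by (auto intro!: bounded_linear_intro[where K = K] simp: assms scaleR_scaleC mult.commute[of _ K])

lemma bounded_clinear_bound:
  assumes "bounded_clinear A"
  obtains K where "0 \<le> K" "\<And>x. norm (A x) \<le> K * norm x"
  using assms bounded_linear.nonneg_bounded[of A]
  by (auto simp: bounded_clinear_def mult.commute[of "norm _"])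

lemma bounded_clinear_compose:
  assumes "bounded_clinear A" "bounded_clinear B"
  shows "bounded_clinear (A \<circ> B)"
  using assms by (auto simp: bounded_clinear_def o_def intro: bounded_linear_compose)

lemma bounded_clinear_id: "bounded_clinear (\<lambda>x. x)"
  by (simp add: bounded_clinear_def)

lemma bounded_clinear_lincomb:
  assumes "\<And>i. i \<in> I \<Longrightarrow> bounded_clinear (A i)"
  shows "bounded_clinear (\<lambda>x. \<Sum>i\<in>I. c i *\<^sub>C A i x)"
proof -
  have sc: "bounded_linear ((*\<^sub>C) d)" for d
    by (rule bounded_linear_intro[where K = "norm d"])
      (auto simp: scaleC_add_right scaleR_scaleC scaleC_scaleC mult.commute)
  have "bounded_linear (\<lambda>x. \<Sum>i\<in>I. c i *\<^sub>C A i x)"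
    using assms by (intro bounded_linear_sum bounded_linear_compose[OF sc])
      (auto simp: bounded_clinear_def)
  then show ?thesis
    using assms by (auto simp: bounded_clinear_def complex_vector.scale_sum_right scaleC_scaleC
        mult.commute intro!: sum.cong)
qed

lemma bounded_clinear_add_fun:
  assumes "bounded_clinear A" "bounded_clinear B"
  shows "bounded_clinear (\<lambda>x. A x + B x)"
  using assms by (auto simp: bounded_clinear_def scaleC_add_right intro: bounded_linear_add)

lemma bounded_clinear_diff_fun:
  assumes "bounded_clinear A" "bounded_clinear B"
  shows "bounded_clinear (\<lambda>x. A x - B x)"
  using assms
  by (auto simp: bounded_clinear_def complex_vector.scale_right_diff_distrib intro: bounded_linear_sub)

text \<open>Riesz gives a vector matching real parts only; applying the equality to
  \<open>\<i> *\<^sub>C x\<close> yields the imaginary parts.\<close>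

lemma ex_adjoint:
  assumes A: "bounded_clinear A"
  shows "\<exists>B. \<forall>x y. cinner (A x) y = cinner x (B y)"
proof -
  have "\<exists>z. \<forall>x. cinner (A x) y = cinner x z" for y
  proof -
    have "bounded_linear (\<lambda>x. inner (A x) y)"
      using A by (intro bounded_linear_inner_left_comp) (simp add: bounded_clinear_def)
    then obtain z where z: "\<And>x. inner (A x) y = inner x z"
      using riesz_real by metis
    have "cinner (A x) y = cinner x z" for x
    proof -
      have "Re (\<i> * cinner (A x) y) = Re (\<i> * cinner x z)"
        using z[of "\<i> *\<^sub>C x"] A
        by (metis Re_cinner bounded_clinear_scaleC cinner_scaleC_left)
      then show ?thesis
        using z[of x] by (simp add: complex_eq_iff Re_cinner)
    qed
    then show ?thesis by blast
  qed
  then show ?thesis by metis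
qed

lemma cinner_cadjoint:
  assumes "bounded_clinear A"
  shows "cinner (A x) y = cinner x (cadjoint A y)"
  using someI_ex[OF ex_adjoint[OF assms]] unfolding cadjoint_def by blast

lemma cinner_cadjoint_left:
  assumes "bounded_clinear A"
  shows "cinner (cadjoint A x) y = cinner x (A y)"
  by (metis assms cinner_cadjoint cinner_commute)

lemma bounded_clinear_cadjoint:
  assumes A: "bounded_clinear A"
  shows "bounded_clinear (cadjoint A)"
proof -
  obtain K where K: "0 \<le> K" "\<And>x. norm (A x) \<le> K * norm x"
    using bounded_clinear_bound[OF A] by blast
  show ?thesis
  proof (rule bounded_clinearI)
    show "cadjoint A (x + y) = cadjoint A x + cadjoint A y" for x y
      by (rule cinner_ext_left) (simp add: cinner_cadjoint_left A cinner_simps)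
    show "cadjoint A (c *\<^sub>C x) = c *\<^sub>C cadjoint A x" for c x
      by (rule cinner_ext_left) (simp add: cinner_cadjoint_left A cinner_simps)
    show "norm (cadjoint A x) \<le> K * norm x" for x
    proof (cases "cadjoint A x = 0")
      case False
      have "(norm (cadjoint A x))\<^sup>2 = norm (cinner x (A (cadjoint A x)))"
        by (simp add: cinner_cadjoint_left[OF A, symmetric] cinner_same norm_power)
      also have "\<dots> \<le> norm x * (K * norm (cadjoint A x))"
        using norm_cinner_le K(2) by (meson mult_left_mono norm_ge_zero order.trans)
      finally show ?thesis
        using False by (simp add: power2_eq_square algebra_simps)
    qed (use K in auto)
  qed
qed

section \<open>Orthonormal bases\<close>

lemma orthonormal_independent:
  assumes "finite E" "\<And>e e'. e \<in> E \<Longrightarrow> e' \<in> E \<Longrightarrow> cinner e e' = (if e = e' then 1 else 0)"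
  shows "complex_vector.independent E"
proof (rule complex_vector.independent_if_scalars_zero)
  fix f e assume s: "(\<Sum>x\<in>E. f x *\<^sub>C x) = 0" and e: "e \<in> E"
  have "0 = cinner (\<Sum>x\<in>E. f x *\<^sub>C x) e"
    by (simp add: s)
  also have "\<dots> = (\<Sum>x\<in>E. if x = e then f x else 0)"
    unfolding cinner_sum_left using e assms by (intro sum.cong) (auto simp: cinner_scaleC_left)
  finally show "f e = 0"
    using assms(1) e by simp
qed (fact assms)

lemma orthonormal_expansion:
  assumes "orthonormal_basis V E" "x \<in> V"
  shows "x = (\<Sum>e\<in>E. cinner x e *\<^sub>C e)"
proof -
  have E: "finite E" "complex_vector.span E = V"
    "\<And>e e'. e \<in> E \<Longrightarrow> e' \<in> E \<Longrightarrow> cinner e e' = (if e = e' then 1 else 0)"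
    using assms(1) by (auto simp: orthonormal_basis_def)
  obtain u where u: "x = (\<Sum>e\<in>E. u e *\<^sub>C e)"
    using assms(2) E(1,2) complex_vector.span_finite by blast
  have "cinner x e' = u e'" if "e' \<in> E" for e'
  proof -
    have "cinner x e' = (\<Sum>e\<in>E. if e = e' then u e else 0)"
      unfolding u cinner_sum_left using that E by (intro sum.cong) (auto simp: cinner_scaleC_left)
    then show ?thesis
      using E(1) that by simp
  qed
  then show ?thesis
    using u by (metis (no_types, lifting) sum.cong)
qed

text \<open>The remainder of \<open>x\<close> after subtracting its Fourier sum over
  \<open>E\<close> stays in \<open>V\<close> and is orthogonal to \<open>E\<close>, so the last
  assumption forces it to vanish. Spanning is thus reduced to a maximality test.\<close>

lemma orthonormal_basisI:
  assumes "complex_vector.subspace V" "finite E" "E \<subseteq> V"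
    "\<And>e e'. e \<in> E \<Longrightarrow> e' \<in> E \<Longrightarrow> cinner e e' = (if e = e' then 1 else 0)"
    "\<And>x. x \<in> V \<Longrightarrow> (\<And>e. e \<in> E \<Longrightarrow> cinner x e = 0) \<Longrightarrow> x = 0"
  shows "orthonormal_basis V E"
proof -
  have "x \<in> complex_vector.span E" if x: "x \<in> V" for x
  proof -
    define y where "y = (\<Sum>e\<in>E. cinner x e *\<^sub>C e)"
    have y: "y \<in> complex_vector.span E"
      unfolding y_def by (intro complex_vector.span_sum complex_vector.span_scale complex_vector.span_base)
    have "complex_vector.span E \<subseteq> V"
      using assms(1,3) by (simp add: complex_vector.span_minimal)
    then have "x - y \<in> V"
      using x y assms(1) complex_vector.subspace_diff by blast
    moreover have "cinner (x - y) e = 0" if e: "e \<in> E" for e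
    proof -
      have "cinner y e = (\<Sum>e'\<in>E. if e' = e then cinner x e' else 0)"
        unfolding y_def cinner_sum_left using e assms(4)
        by (intro sum.cong) (auto simp: cinner_scaleC_left)
      then show ?thesis
        using assms(2) e by (simp add: cinner_diff_left)
    qed
    ultimately have "x = y"
      using assms(5)[of "x - y"] by simp
    then show ?thesis using y by simp
  qed
  moreover have "complex_vector.span E \<subseteq> V"
    using assms(1,3) by (simp add: complex_vector.span_minimal)
  ultimately show ?thesis
    using assms(2,4) by (auto simp: orthonormal_basis_def)
qed

text \<open>Instead of Gram-Schmidt, a largest orthonormal set between \<open>E0\<close> and
  \<open>V\<close> is taken; sizes are bounded by a spanning set because orthonormal sets are
  independent. A nonzero vector orthogonal to it could be normalized and added.\<close>

lemma orthonormal_basis_extend: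
  assumes V: "complex_vector.subspace V" "finite_cdim V" and E0: "finite E0" "E0 \<subseteq> V"
    "\<And>e e'. e \<in> E0 \<Longrightarrow> e' \<in> E0 \<Longrightarrow> cinner e e' = (if e = e' then 1 else 0)"
  obtains E where "E0 \<subseteq> E" "orthonormal_basis V E"
proof -
  obtain B where B: "finite B" "V \<subseteq> complex_vector.span B"
    using V(2) by (auto simp: finite_cdim_def)
  define P where "P E \<longleftrightarrow> finite E \<and> E0 \<subseteq> E \<and> E \<subseteq> V \<and>
    (\<forall>e\<in>E. \<forall>e'\<in>E. cinner e e' = (if e = e' then 1 else 0))" for E
  have bound: "card E \<le> card B" if "P E" for E
  proof -
    have "complex_vector.independent E"
      using that by (intro orthonormal_independent) (auto simp: P_def)
    then show ?thesis
      using complex_vector.independent_span_bound[OF B(1), of E] that B(2) by (auto simp: P_def)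
  qed
  have "P E0" using E0 by (auto simp: P_def)
  then obtain E where E: "P E" "\<And>E'. P E' \<Longrightarrow> card E' \<le> card E"
    using ex_has_greatest_nat[of P E0 card "Suc (card B)"] bound by (auto simp: less_Suc_eq_le)
  have "orthonormal_basis V E"
  proof (rule orthonormal_basisI)
    fix x assume x: "x \<in> V" and orth: "\<And>e. e \<in> E \<Longrightarrow> cinner x e = 0"
    show "x = 0"
    proof (rule ccontr)
      assume nz: "x \<noteq> 0"
      define u where "u = of_real (1 / norm x) *\<^sub>C x"
      have uu: "cinner u u = 1"
        using nz by (simp add: u_def cinner_same norm_divide)
      have ue: "cinner u e = 0" "cinner e u = 0" if "e \<in> E" for e
        using orth[OF that] cinner_eq_0_commute[of x e] by (auto simp: u_def cinner_simps)
      have "u \<notin> E"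
        using uu ue by fastforce
      moreover have "P (insert u E)"
        using E(1) x V(1) uu ue by (auto simp: P_def u_def complex_vector.subspace_scale)
      ultimately show False
        using E(2)[of "insert u E"] E(1) by (auto simp: P_def)
    qed
  qed (use E(1) V(1) in \<open>auto simp: P_def\<close>)
  then show ?thesis
    using that E(1) by (auto simp: P_def)
qed

lemma ex_orthonormal_basis:
  assumes "complex_vector.subspace V" "finite_cdim V"
  obtains E where "orthonormal_basis V E"
  using orthonormal_basis_extend[OF assms, of "{}"] by auto

lemma cdim_orthonormal_basis:
  assumes "orthonormal_basis V E"
  shows "cdim V = card E"
proof -
  have E: "finite E" "complex_vector.span E = V"
    "\<And>e e'. e \<in> E \<Longrightarrow> e' \<in> E \<Longrightarrow> cinner e e' = (if e = e' then 1 else 0)"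
    using assms by (auto simp: orthonormal_basis_def)
  then show ?thesis
    using complex_vector.dim_span_eq_card_independent[of E] orthonormal_independent[of E]
    by (simp add: cdim_def)
qed

lemma orthonormal_basisD:
  assumes "orthonormal_basis V E"
  shows "finite E" "E \<subseteq> V" "complex_vector.subspace V" "finite_cdim V"
    "e \<in> E \<Longrightarrow> e' \<in> E \<Longrightarrow> cinner e e' = (if e = e' then 1 else 0)"
    "e \<in> E \<Longrightarrow> norm e = 1"
  using assms complex_vector.span_base complex_vector.subspace_span
  by (auto simp: orthonormal_basis_def finite_cdim_def norm_eq_sqrt_inner Re_cinner[symmetric])

lemma finite_cdim_subset: "finite_cdim W \<Longrightarrow> V \<subseteq> W \<Longrightarrow> finite_cdim V"
  by (auto simp: finite_cdim_def)

lemma orthonormal_parseval: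
  assumes "orthonormal_basis V E" "x \<in> V"
  shows "(norm x)\<^sup>2 = (\<Sum>e\<in>E. (norm (cinner x e))\<^sup>2)"
proof -
  note E = orthonormal_basisD[OF assms(1)]
  have "(norm x)\<^sup>2 = (norm (\<Sum>e\<in>E. cinner x e *\<^sub>C e))\<^sup>2"
    using orthonormal_expansion[OF assms] by simp
  also have "\<dots> = (\<Sum>e\<in>E. (norm (cinner x e *\<^sub>C e))\<^sup>2)"
    using E by (intro norm_sum_orthogonal) (auto simp: cinner_simps)
  also have "\<dots> = (\<Sum>e\<in>E. (norm (cinner x e))\<^sup>2)"
    using E by (intro sum.cong) auto
  finally show ?thesis .
qed

text \<open>The orthocomplements of the two kernels have equal dimension, because \<open>D\<close> maps each of them
  injectively into the other.\<close>

lemma index_selfadjoint_pair: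
  fixes D :: "'a::complex_hilbert_space \<Rightarrow> 'a"
  assumes fd: "finite_cdim V" "finite_cdim W"
    and sub: "complex_vector.subspace V" "complex_vector.subspace W"
    and D: "\<And>x y. D (x + y) = D x + D y" "\<And>c x. D (c *\<^sub>C x) = c *\<^sub>C D x"
    and sa: "\<And>x y. cinner (D x) y = cinner x (D y)"
    and VW: "\<And>x. x \<in> V \<Longrightarrow> D x \<in> W" "\<And>x. x \<in> W \<Longrightarrow> D x \<in> V"
  shows "int (cdim (ker_on V D)) - int (cdim (ker_on W D)) = int (cdim V) - int (cdim W)"
proof -
  have lin: "module_hom (*\<^sub>C) (*\<^sub>C) D"
    using D by unfold_locales auto
  have sk: "complex_vector.subspace (ker_on Z D)" if "complex_vector.subspace Z" for Z
    using that D(1)[of 0 0] D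
    by (auto simp: complex_vector.subspace_def ker_on_def)
  \<comment> \<open>\<open>p\<close> is the rank of \<open>D\<close> on \<open>V\<close>. The
    equation and the inequality, read for both orderings of the pair, force the two ranks to
    coincide.\<close>
  have main: "\<exists>p. cdim V = cdim (ker_on V D) + p \<and> p + cdim (ker_on W D) \<le> cdim W"
    if fd: "finite_cdim V" "finite_cdim W"
      and sub: "complex_vector.subspace V" "complex_vector.subspace W"
      and VW: "\<And>x. x \<in> V \<Longrightarrow> D x \<in> W" for V W
  proof -
    have "finite_cdim (ker_on V D)" "finite_cdim (ker_on W D)"
      using fd by (auto simp: ker_on_def intro: finite_cdim_subset)
    then obtain K L where K: "orthonormal_basis (ker_on V D) K" and L: "orthonormal_basis (ker_on W D) L"
      using sub sk ex_orthonormal_basis by metis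
    note K' = orthonormal_basisD[OF K] and L' = orthonormal_basisD[OF L]
    obtain E where E: "K \<subseteq> E" "orthonormal_basis V E"
      using orthonormal_basis_extend[OF sub(1) fd(1) K'(1) _ K'(5)] K'(2) by (auto simp: ker_on_def)
    note E' = orthonormal_basisD[OF E(2)]
    define R where "R = E - K"
    have finR: "finite R" and RV: "R \<subseteq> V" using E' by (auto simp: R_def)
    have orthK: "cinner x k = 0" if x: "x \<in> complex_vector.span R" and k: "k \<in> K" for x k
    proof -
      obtain u where "x = (\<Sum>e\<in>R. u e *\<^sub>C e)"
        using x unfolding complex_vector.span_finite[OF finR] by (rule imageE)
      moreover have "cinner e k = 0" if "e \<in> R" for e
        using E'(5)[of e k] E(1) that k by (auto simp: R_def split: if_splits)
      ultimately show ?thesis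
        by (simp add: cinner_sum_left cinner_scaleC_left)
    qed
    have inj: "inj_on D (complex_vector.span R)"
    proof (rule inj_onI)
      fix x y assume xy: "x \<in> complex_vector.span R" "y \<in> complex_vector.span R" "D x = D y"
      have d: "x - y \<in> complex_vector.span R"
        using xy by (simp add: complex_vector.span_diff)
      then have "x - y \<in> V"
        using complex_vector.span_minimal[OF RV sub(1)] by blast
      moreover have "D (x - y) = 0"
        using D(1)[of "x - y" y] xy(3) by simp
      ultimately have k: "x - y \<in> ker_on V D"
        by (simp add: ker_on_def)
      have "x - y = (\<Sum>k\<in>K. cinner (x - y) k *\<^sub>C k)"
        by (rule orthonormal_expansion[OF K k])
      also have "\<dots> = 0"
        using orthK[OF d] by (intro sum.neutral) auto
      finally show "x = y" by simp
    qed
    have "R \<subseteq> E" by (auto simp: R_def)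
    then have indR: "complex_vector.independent R"
      using orthonormal_independent[OF E'(1,5)] complex_vector.independent_mono by blast
    define S where "S = complex_vector.span (D ` R)"
    have vp: "vector_space_pair (*\<^sub>C) ((*\<^sub>C) :: complex \<Rightarrow> 'a \<Rightarrow> 'a)"
      by unfold_locales
    have indDR: "complex_vector.independent (D ` R)"
      using vector_space_pair.linear_independent_injective_image[OF vp, of D R] lin indR inj
      by (simp add: Vector_Spaces.linear_def module_hom_def vector_space_pair_def complex_vector.vector_space_axioms)
    have cDR: "card (D ` R) = card R"
      using inj complex_vector.span_superset by (intro card_image) (blast intro: inj_on_subset)
    have SW: "S \<subseteq> W"
      unfolding S_def using RV VW sub by (intro complex_vector.span_minimal) auto
    have fdS: "finite_cdim S" using SW fd finite_cdim_subset by blast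
    then obtain F where F: "orthonormal_basis S F"
      using ex_orthonormal_basis[of S] by (auto simp: S_def)
    note F' = orthonormal_basisD[OF F]
    have cF: "card F = card R"
      using cdim_orthonormal_basis[OF F] complex_vector.dim_span_eq_card_independent[OF indDR] cDR
      by (simp add: S_def cdim_def)
    \<comment> \<open>By symmetry of \<open>D\<close> its range is orthogonal to its kernel, so
      bases of \<open>S\<close> and of the kernel in \<open>W\<close> fit into one basis of
      \<open>W\<close>.\<close>
    have SL: "cinner f l = 0" if f: "f \<in> S" and l: "l \<in> L" for f l
    proof -
      have "D l = 0" using l L' by (auto simp: ker_on_def)
      then have "cinner (D r) l = 0" for r by (simp add: sa)
      moreover obtain u where "f = (\<Sum>e\<in>D ` R. u e *\<^sub>C e)"
        using f unfolding S_def complex_vector.span_finite[OF finite_imageI[OF finR]] by (rule imageE)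
      ultimately show ?thesis
        by (auto simp: cinner_sum_left cinner_scaleC_left intro!: sum.neutral)
    qed
    have SL': "cinner l f = 0" if f: "f \<in> S" and l: "l \<in> L" for f l
      using SL[OF f l] cinner_eq_0_commute by blast
    have disj: "F \<inter> L = {}"
      using SL F' L'(6) cinner_same_eq_0_iff by fastforce
    obtain G where G: "F \<union> L \<subseteq> G" "orthonormal_basis W G"
    proof (rule orthonormal_basis_extend[OF sub(2) fd(2), of "F \<union> L"])
      show "cinner e e' = (if e = e' then 1 else 0)" if "e \<in> F \<union> L" "e' \<in> F \<union> L" for e e'
        using that disj F' L' SL SL' by (auto split: if_splits)
    qed (use F' L' SW in \<open>auto simp: ker_on_def\<close>)
    have "card F + card L \<le> card G"
      using card_mono[OF orthonormal_basisD(1)[OF G(2)] G(1)] card_Un_disjoint[OF F'(1) L'(1) disj] by simp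
    moreover have "card E = card K + card R"
      using E(1) E'(1) by (simp add: R_def card_Diff_subset finite_subset card_mono)
    ultimately show ?thesis
      using cdim_orthonormal_basis[OF K] cdim_orthonormal_basis[OF L] cdim_orthonormal_basis[OF E(2)]
        cdim_orthonormal_basis[OF G(2)] cF by (intro exI[of _ "card R"]) auto
  qed
  show ?thesis
    using main[OF fd sub VW(1)] main[OF fd(2,1) sub(2,1) VW(2)] by auto
qed

section \<open>The positive square root\<close>

lemma square_nonneg_linear_term_0:
  fixes a b :: real
  assumes "\<And>t. 0 \<le> t\<^sup>2 * a + t * b"
  shows "b = 0"
proof (rule ccontr)
  assume b: "b \<noteq> 0"
  define s where "s = \<bar>a\<bar> + 1"
  have s: "s > 0" "a \<le> s" by (auto simp: s_def)
  have "0 \<le> (- b / (2 * s))\<^sup>2 * a + (- b / (2 * s)) * b"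
    by (rule assms)
  also have "\<dots> \<le> (- b / (2 * s))\<^sup>2 * s + (- b / (2 * s)) * b"
    using s by (intro add_right_mono mult_left_mono) auto
  also have "\<dots> = - (b\<^sup>2 / (4 * s))"
    using s by (simp add: field_simps power2_eq_square)
  also have "\<dots> < 0"
    using s b by simp
  finally show False by simp
qed

text \<open>Polarization: the quadratic form is real at \<open>x + y\<close> and at
  \<open>x + \<i> *\<^sub>C y\<close>, which gives the imaginary and the real part of the symmetry
  relation.\<close>

lemma positive_op_selfadjoint:
  assumes R: "positive_op R"
  shows "cinner (R x) y = cinner x (R y)"
proof -
  have bl: "bounded_clinear R" and re: "Im (cinner (R z) z) = 0" for z
    using R by (auto simp: positive_op_def complex_nonneg_Reals_iff)
  note lin = bounded_clinear_add[OF bl] bounded_clinear_scaleC[OF bl]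
  have "Im (cinner (R x) y) + Im (cinner (R y) x) = 0"
    using re[of "x + y"] re[of x] re[of y] by (simp add: lin cinner_simps)
  moreover have "Re (cinner (R y) x) = Re (cinner (R x) y)"
    using re[of "x + \<i> *\<^sub>C y"] re[of x] re[of y] by (simp add: lin cinner_simps)
  ultimately have "cinner (R x) y = cnj (cinner (R y) x)"
    by (simp add: complex_eq_iff)
  then show ?thesis
    by (metis cinner_commute)
qed

lemma positive_op_nonneg: "positive_op R \<Longrightarrow> 0 \<le> Re (cinner (R x) x)"
  by (auto simp: positive_op_def complex_nonneg_Reals_iff)

text \<open>At a zero of a nonnegative form the first variation vanishes; in the direction
  \<open>R u\<close> it equals \<open>2 * (norm (R u))\<^sup>2\<close>.\<close>

lemma positive_op_eq_0:
  assumes R: "positive_op R" and 0: "Re (cinner (R u) u) = 0"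
  shows "R u = 0"
proof -
  have bl: "bounded_clinear R" using R by (simp add: positive_op_def)
  have "0 \<le> t\<^sup>2 * Re (cinner (R (R u)) (R u)) + t * (2 * (norm (R u))\<^sup>2)" for t
  proof -
    have "Re (cinner (R (u + of_real t *\<^sub>C R u)) (u + of_real t *\<^sub>C R u)) =
      t\<^sup>2 * Re (cinner (R (R u)) (R u)) + t * (2 * (norm (R u))\<^sup>2)"
      using 0 positive_op_selfadjoint[OF R, of "R u" u]
      by (simp add: bounded_clinear_add[OF bl] bounded_clinear_scaleC[OF bl] cinner_simps cinner_same
          power2_eq_square algebra_simps)
    then show ?thesis
      using positive_op_nonneg[OF R] by metis
  qed
  then have "2 * (norm (R u))\<^sup>2 = 0"
    by (rule square_nonneg_linear_term_0)
  then show ?thesis by simp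
qed

text \<open>For \<open>u = R x - S x\<close> commutation gives
  \<open>R u + S u = R (R x) - S (S x) = 0\<close>, so both nonnegative forms vanish at
  \<open>u\<close>, whence \<open>R u = S u = 0\<close> and \<open>u\<close> is orthogonal to
  itself.\<close>

lemma positive_sqrt_unique:
  assumes R: "positive_op R" and S: "positive_op S" and eq: "R \<circ> R = S \<circ> S"
    and comm: "\<And>x. R (S x) = S (R x)"
  shows "R = S"
proof
  fix x
  have bl: "bounded_clinear R" "bounded_clinear S"
    using R S by (auto simp: positive_op_def)
  note lin = bl[THEN bounded_clinear_diff]
  have RR: "R (R z) = S (S z)" for z
    using eq by (metis comp_apply)
  define u where "u = R x - S x"
  have "R u + S u = 0"
    by (simp add: u_def lin RR comm)
  then have "Re (cinner (R u) u) + Re (cinner (S u) u) = 0"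
    by (metis cinner_add_left cinner_zero_left plus_complex.simps(1) zero_complex.simps(1))
  then have "Re (cinner (R u) u) = 0" "Re (cinner (S u) u) = 0"
    using positive_op_nonneg[OF R, of u] positive_op_nonneg[OF S, of u] by auto
  then have u: "R u = 0" "S u = 0"
    using positive_op_eq_0 R S by blast+
  have "cinner u u = cinner x (R u - S u)"
    by (simp add: u_def cinner_simps lin positive_op_selfadjoint[OF R] positive_op_selfadjoint[OF S])
  then show "R x = S x"
    using u by (simp add: u_def)
qed

text \<open>\<open>1 - sqrt (1 - A)\<close> is a fixed point of \<open>Y \<mapsto> (A + Y\<^sup>2) / 2\<close>; the iterates are polynomials in
  \<open>A\<close>, and the scalar iteration for \<open>A = 1\<close> majorizes their increments.\<close>

fun sqrt_iter :: "('a::complex_hilbert_space \<Rightarrow> 'a) \<Rightarrow> nat \<Rightarrow> 'a \<Rightarrow> 'a"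
  where "sqrt_iter A 0 x = 0"
  | "sqrt_iter A (Suc n) x = (1/2) *\<^sub>C (A x + sqrt_iter A n (sqrt_iter A n x))"

fun sqrt_scalar_iter :: "nat \<Rightarrow> real"
  where "sqrt_scalar_iter 0 = 0"
  | "sqrt_scalar_iter (Suc n) = (1 + (sqrt_scalar_iter n)\<^sup>2) / 2"

lemma sqrt_scalar_iter_bounds: "0 \<le> sqrt_scalar_iter n" "sqrt_scalar_iter n \<le> 1"
proof -
  have "0 \<le> sqrt_scalar_iter n \<and> sqrt_scalar_iter n \<le> 1"
    by (induction n) (auto simp: power_le_one)
  then show "0 \<le> sqrt_scalar_iter n" "sqrt_scalar_iter n \<le> 1" by auto
qed

lemma sqrt_scalar_iter_Suc: "sqrt_scalar_iter n \<le> sqrt_scalar_iter (Suc n)"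
proof -
  have "0 \<le> (1 - sqrt_scalar_iter n)\<^sup>2" by simp
  then show ?thesis by (simp add: power2_eq_square algebra_simps)
qed

lemma Cauchy_sqrt_scalar_iter: "Cauchy sqrt_scalar_iter"
proof -
  have "convergent sqrt_scalar_iter"
    using sqrt_scalar_iter_bounds lift_Suc_mono_le[of sqrt_scalar_iter, OF sqrt_scalar_iter_Suc]
    by (intro Bseq_mono_convergent BseqI'[where K = 1]) auto
  then show ?thesis by (rule convergent_Cauchy)
qed

context
  fixes A :: "'a::complex_hilbert_space \<Rightarrow> 'a"
  assumes A: "bounded_clinear A" and nA: "\<And>x. norm (A x) \<le> norm x"
    and saA: "\<And>x y. cinner (A x) y = cinner x (A y)"
begin

lemma sqrt_iter_linear:
  "sqrt_iter A n (x + y) = sqrt_iter A n x + sqrt_iter A n y"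
  "sqrt_iter A n (c *\<^sub>C x) = c *\<^sub>C sqrt_iter A n x"
  by (induction n arbitrary: x y)
    (auto simp: bounded_clinear_add[OF A] bounded_clinear_scaleC[OF A] scaleC_add_right
      scaleC_scaleC mult.commute)

lemma sqrt_iter_diff: "sqrt_iter A n (x - y) = sqrt_iter A n x - sqrt_iter A n y"
  using sqrt_iter_linear(1)[of n "x - y" y] by simp

lemma sqrt_iter_norm: "norm (sqrt_iter A n x) \<le> sqrt_scalar_iter n * norm x"
proof (induction n arbitrary: x)
  case (Suc n)
  have "norm (sqrt_iter A n (sqrt_iter A n x)) \<le> sqrt_scalar_iter n * (sqrt_scalar_iter n * norm x)"
    using Suc.IH sqrt_scalar_iter_bounds(1)[of n] by (meson mult_left_mono order.trans)
  then have "norm (A x + sqrt_iter A n (sqrt_iter A n x)) \<le> norm x + (sqrt_scalar_iter n)\<^sup>2 * norm x"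
    using nA[of x] norm_triangle_ineq[of "A x" "sqrt_iter A n (sqrt_iter A n x)"]
    by (simp add: power2_eq_square)
  then show ?case
    unfolding sqrt_iter.simps norm_scaleC by (simp add: field_simps)
qed simp

lemma sqrt_iter_commute:
  assumes C: "bounded_clinear C" and CA: "\<And>x. C (A x) = A (C x)"
  shows "C (sqrt_iter A n x) = sqrt_iter A n (C x)"
  by (induction n arbitrary: x)
    (auto simp: bounded_clinear_0[OF C] bounded_clinear_scaleC[OF C] bounded_clinear_add[OF C] CA)

lemma bounded_clinear_sqrt_iter: "bounded_clinear (sqrt_iter A n)"
  by (rule bounded_clinearI[OF sqrt_iter_linear sqrt_iter_norm])

lemma sqrt_iter_commute_sqrt_iter: "sqrt_iter A m (sqrt_iter A n x) = sqrt_iter A n (sqrt_iter A m x)"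
proof (rule sqrt_iter_commute[OF bounded_clinear_sqrt_iter])
  show "sqrt_iter A m (A x) = A (sqrt_iter A m x)" for x
    by (rule sqrt_iter_commute[OF A refl, symmetric])
qed

lemma sqrt_iter_selfadjoint: "cinner (sqrt_iter A n x) y = cinner x (sqrt_iter A n y)"
  by (induction n arbitrary: x y) (auto simp: cinner_simps saA)

text \<open>Difference of squares: since consecutive iterates \<open>P\<close> and \<open>Q\<close>
  commute, the next increment is half of \<open>P + Q\<close> applied to the previous increment. The
  scalar iteration obeys the same recursion, so the majorization is passed on.\<close>

lemma sqrt_iter_step:
  "norm (sqrt_iter A (Suc n) x - sqrt_iter A n x) \<le>
    (sqrt_scalar_iter (Suc n) - sqrt_scalar_iter n) * norm x"
proof (induction n arbitrary: x)
  case 0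
  then show ?case using nA[of x] by simp
next
  case (Suc n)
  let ?Y = "sqrt_iter A" and ?y = sqrt_scalar_iter
  define u where "u = ?Y (Suc n) x - ?Y n x"
  have u: "norm u \<le> (?y (Suc n) - ?y n) * norm x"
    using Suc.IH by (simp only: u_def)
  define P where "P = ?Y (Suc n)"
  define Q where "Q = ?Y n"
  have "P (Q z) = Q (P z)" for z
    unfolding P_def Q_def by (rule sqrt_iter_commute_sqrt_iter)
  then have "P u + Q u = P (P x) - Q (Q x)"
    unfolding u_def P_def[symmetric] Q_def[symmetric] by (simp add: P_def Q_def sqrt_iter_diff del: sqrt_iter.simps)
  moreover have "?Y (Suc (Suc n)) x = (1/2) *\<^sub>C (A x + P (P x))"
    unfolding P_def by (rule sqrt_iter.simps(2))
  moreover have "?Y (Suc n) x = (1/2) *\<^sub>C (A x + Q (Q x))"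
    unfolding Q_def by (rule sqrt_iter.simps(2))
  moreover have "(1/2) *\<^sub>C (A x + P (P x)) - (1/2) *\<^sub>C (A x + Q (Q x)) = (1/2) *\<^sub>C (P (P x) - Q (Q x))"
    by (simp add: complex_vector.scale_right_diff_distrib[symmetric] del: complex_vector.scale_right_diff_distrib)
  ultimately have "?Y (Suc (Suc n)) x - ?Y (Suc n) x = (1/2) *\<^sub>C (P u + Q u)"
    by (simp only:)
  then have step: "norm (?Y (Suc (Suc n)) x - ?Y (Suc n) x) = (1/2) * norm (P u + Q u)"
    by (simp only: norm_scaleC) simp
  have "norm (P u + Q u) \<le> (?y (Suc n) + ?y n) * norm u"
    unfolding distrib_right P_def Q_def
    by (intro norm_triangle_le add_mono sqrt_iter_norm)
  also have "\<dots> \<le> (?y (Suc n) + ?y n) * ((?y (Suc n) - ?y n) * norm x)"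
    using u sqrt_scalar_iter_bounds(1)[of n] sqrt_scalar_iter_bounds(1)[of "Suc n"]
    by (intro mult_left_mono) auto
  also have "\<dots> = 2 * ((?y (Suc (Suc n)) - ?y (Suc n)) * norm x)"
    unfolding sqrt_scalar_iter.simps(2)[of "Suc n"] sqrt_scalar_iter.simps(2)[of n]
    by (simp add: power2_eq_square field_simps)
  finally show ?case
    unfolding step by (simp del: sqrt_iter.simps sqrt_scalar_iter.simps)
qed

lemma sqrt_iter_diff_norm:
  assumes "n \<le> m"
  shows "norm (sqrt_iter A m x - sqrt_iter A n x) \<le> (sqrt_scalar_iter m - sqrt_scalar_iter n) * norm x"
  using assms
proof (induction m rule: dec_induct)
  case (step m)
  have "sqrt_iter A (Suc m) x - sqrt_iter A n x =
      (sqrt_iter A (Suc m) x - sqrt_iter A m x) + (sqrt_iter A m x - sqrt_iter A n x)" by simp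
  also have "norm \<dots> \<le> (sqrt_scalar_iter (Suc m) - sqrt_scalar_iter m) * norm x +
      (sqrt_scalar_iter m - sqrt_scalar_iter n) * norm x"
    by (rule norm_triangle_le[OF add_mono[OF sqrt_iter_step step.IH]])
  finally show ?case by (simp only: algebra_simps)
qed simp

lemma convergent_sqrt_iter: "convergent (\<lambda>n. sqrt_iter A n x)"
proof (rule Cauchy_convergent, rule metric_CauchyI)
  fix e :: real assume e: "0 < e"
  define d where "d = e / (norm x + 1)"
  have d: "d > 0" using e by (simp add: d_def add_nonneg_pos)
  obtain M where M: "\<And>m n. m \<ge> M \<Longrightarrow> n \<ge> M \<Longrightarrow> dist (sqrt_scalar_iter m) (sqrt_scalar_iter n) < d"
    using metric_CauchyD[OF Cauchy_sqrt_scalar_iter d] by blast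
  have main: "dist (sqrt_iter A m x) (sqrt_iter A n x) < e" if mn: "n \<ge> M" "n \<le> m" for m n
  proof -
    have "norm (sqrt_iter A m x - sqrt_iter A n x) \<le> (sqrt_scalar_iter m - sqrt_scalar_iter n) * norm x"
      by (rule sqrt_iter_diff_norm[OF mn(2)])
    also have "\<dots> \<le> d * norm x"
      using M[of m n] mn by (intro mult_right_mono) (auto simp: dist_real_def)
    also have "\<dots> < d * (norm x + 1)" using d by simp
    also have "\<dots> = e"
    proof -
      have "norm x + 1 \<noteq> 0" using norm_ge_zero[of x] by linarith
      then show ?thesis by (simp add: d_def)
    qed
    finally show ?thesis by (simp add: dist_norm)
  qed
  show "\<exists>M. \<forall>m\<ge>M. \<forall>n\<ge>M. dist (sqrt_iter A m x) (sqrt_iter A n x) < e"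
    using main by (metis dist_commute nle_le)
qed

text \<open>The root is \<open>1 - Y\<close> with \<open>Y\<close> the limit of the iterates: the
  fixed point equation says that it squares to \<open>1 - A\<close>, and
  \<open>norm (Y x) \<le> norm x\<close> gives positivity. The last clause, inherited from the
  iterates, later yields uniqueness and gauge invariance of the root.\<close>

lemma ex_positive_sqrt:
  "\<exists>S. positive_op S \<and> (\<forall>x. S (S x) = x - A x) \<and>
    (\<forall>C. bounded_clinear C \<longrightarrow> (\<forall>x. C (A x) = A (C x)) \<longrightarrow> (\<forall>x. C (S x) = S (C x)))"
proof -
  define Y where "Y x = lim (\<lambda>n. sqrt_iter A n x)" for x
  have lim: "(\<lambda>n. sqrt_iter A n x) \<longlonglongrightarrow> Y x" for x
    using convergent_sqrt_iter by (simp add: Y_def convergent_LIMSEQ_iff)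
  have sc: "bounded_clinear ((*\<^sub>C) d :: 'a \<Rightarrow> 'a)" for d
    by (rule bounded_clinearI[where K = "norm d"]) (auto simp: scaleC_add_right scaleC_scaleC mult.commute)
  have Yadd: "Y (x + y) = Y x + Y y" for x y
    by (rule LIMSEQ_unique[OF lim]) (simp add: sqrt_iter_linear tendsto_add lim)
  have Yscale: "Y (c *\<^sub>C x) = c *\<^sub>C Y x" for c x
    by (rule LIMSEQ_unique[OF lim]) (simp add: sqrt_iter_linear bounded_clinear_tendsto[OF sc] lim)
  have it1: "norm (sqrt_iter A n x) \<le> norm x" for n x
    using sqrt_iter_norm[of n x] sqrt_scalar_iter_bounds[of n]
    by (meson mult_left_le_one_le norm_ge_zero order.trans)
  have Ynorm: "norm (Y x) \<le> norm x" for x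
    by (rule LIMSEQ_le_const2[OF tendsto_norm[OF lim[of x]]]) (use it1 in blast)
  have Y: "bounded_clinear Y"
    by (rule bounded_clinearI[where K = 1]) (auto simp: Yadd Yscale Ynorm)
  have Ysa: "cinner (Y x) y = cinner x (Y y)" for x y
    by (rule LIMSEQ_unique[OF tendsto_cinner_left[OF lim]])
      (simp add: sqrt_iter_selfadjoint tendsto_cinner_right lim)
  have YY: "(\<lambda>n. sqrt_iter A n (sqrt_iter A n x)) \<longlonglongrightarrow> Y (Y x)" for x
  proof -
    have "(\<lambda>n. sqrt_iter A n (sqrt_iter A n x - Y x)) \<longlonglongrightarrow> 0"
    proof (rule Lim_null_comparison)
      show "(\<lambda>n. norm (sqrt_iter A n x - Y x)) \<longlonglongrightarrow> 0"
        using lim[of x] by (simp add: LIM_zero_iff tendsto_norm_zero)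
    qed (use it1 in auto)
    from tendsto_add[OF this lim[of "Y x"]] show ?thesis
      by (simp add: sqrt_iter_diff)
  qed
  have fixpoint: "2 *\<^sub>C Y x = A x + Y (Y x)" for x
  proof -
    have "(\<lambda>n. sqrt_iter A (Suc n) x) \<longlonglongrightarrow> (1/2) *\<^sub>C (A x + Y (Y x))"
      unfolding sqrt_iter.simps
      by (intro bounded_clinear_tendsto[OF sc] tendsto_add tendsto_const YY)
    then have "Y x = (1/2) *\<^sub>C (A x + Y (Y x))"
      using LIMSEQ_unique LIMSEQ_Suc[OF lim] by blast
    then have "2 *\<^sub>C Y x = 2 *\<^sub>C (1/2) *\<^sub>C (A x + Y (Y x))" by simp
    then show ?thesis by (simp add: scaleC_scaleC)
  qed
  have two: "2 *\<^sub>C x = x + x" for x :: 'a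
    using scaleC_add_left[of 1 1 x] by simp
  define S where "S x = x - Y x" for x
  have "bounded_clinear S"
    unfolding S_def by (intro bounded_clinear_diff_fun bounded_clinear_id Y)
  moreover have "cinner (S x) x \<in> \<real>\<^sub>\<ge>\<^sub>0" for x
  proof -
    have "Im (cinner (Y x) x) = 0"
      using Ysa[of x x] cinner_commute[of "Y x" x] by (simp add: complex_eq_iff)
    moreover have "Re (cinner (Y x) x) \<le> norm x * norm x"
      using complex_Re_le_cmod norm_cinner_le Ynorm
      by (meson mult_right_mono norm_ge_zero order.trans)
    ultimately show ?thesis
      by (simp add: complex_nonneg_Reals_iff S_def cinner_diff_left cinner_same power2_eq_square)
  qed
  moreover have "S (S x) = x - A x" for x
    using fixpoint[of x] by (simp add: S_def bounded_clinear_diff[OF Y] two algebra_simps)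
  moreover have "C (S x) = S (C x)" if C: "bounded_clinear C" "\<And>x. C (A x) = A (C x)" for C x
  proof -
    have "C (Y x) = Y (C x)"
      by (rule LIMSEQ_unique[OF bounded_clinear_tendsto[OF C(1) lim]])
        (simp add: sqrt_iter_commute[OF C] lim)
    then show ?thesis
      by (simp add: S_def bounded_clinear_diff[OF C(1)])
  qed
  ultimately show ?thesis
    by (intro exI[of _ S]) (auto simp: positive_op_def)
qed

text \<open>Any positive root \<open>R\<close> of \<open>1 - A\<close> commutes with
  \<open>A = 1 - R \<circ> R\<close>, hence with the constructed root, so uniqueness among commuting
  roots suffices to evaluate the description in \<open>sqrt_op\<close>.\<close>

lemma sqrt_op_props:
  defines "S \<equiv> sqrt_op (\<lambda>x. x - A x)"
  shows "positive_op S" "S (S x) = x - A x"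
    "bounded_clinear C \<Longrightarrow> (\<And>x. C (A x) = A (C x)) \<Longrightarrow> C (S x) = S (C x)"
proof -
  obtain S' where S': "positive_op S'" "\<And>x. S' (S' x) = x - A x"
    "\<And>C x. bounded_clinear C \<Longrightarrow> (\<And>x. C (A x) = A (C x)) \<Longrightarrow> C (S' x) = S' (C x)"
    using ex_positive_sqrt by blast
  have "S = S'"
    unfolding S_def sqrt_op_def
  proof (rule the_equality)
    fix R assume R: "positive_op R \<and> R \<circ> R = (\<lambda>x. x - A x)"
    then have bl: "bounded_clinear R" by (simp add: positive_op_def)
    have "A x = x - R (R x)" for x
      using R by (metis comp_apply diff_diff_eq2 diff_add_cancel add_diff_cancel_left')
    then have "R (A x) = A (R x)" for x
      by (simp add: bounded_clinear_diff[OF bl])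
    then have "R (S' x) = S' (R x)" for x
      using S'(3) bl by blast
    then show "R = S'"
      using positive_sqrt_unique[of R S'] R S' by (auto simp: o_def)
  qed (use S' in auto)
  then show "positive_op S" "S (S x) = x - A x"
    "bounded_clinear C \<Longrightarrow> (\<And>x. C (A x) = A (C x)) \<Longrightarrow> C (S x) = S (C x)"
    using S' by auto
qed

end

section \<open>Row contractions\<close>

locale row_contraction =
  fixes T :: "'d::finite \<Rightarrow> 'h::complex_hilbert_space \<Rightarrow> 'h"
  assumes d_contraction: "d_contraction T"
begin

lemma T_bounded_clinear: "bounded_clinear (T k)"
  using d_contraction by (simp add: d_contraction_def)

lemma T_commute: "T j (T k x) = T k (T j x)"
  using d_contraction by (metis comp_apply d_contraction_def)

lemmas T_lin = bounded_clinear_add[OF T_bounded_clinear] bounded_clinear_scaleC[OF T_bounded_clinear]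
  bounded_clinear_diff[OF T_bounded_clinear] bounded_clinear_0[OF T_bounded_clinear]
  bounded_clinear_sum[OF T_bounded_clinear] bounded_clinear_minus[OF T_bounded_clinear]

definition T_adj :: "'d \<Rightarrow> 'h \<Rightarrow> 'h"
  where "T_adj k = cadjoint (T k)"

lemma cinner_T: "cinner (T k x) y = cinner x (T_adj k y)"
  by (simp add: T_adj_def cinner_cadjoint T_bounded_clinear)

lemma cinner_T_adj: "cinner (T_adj k x) y = cinner x (T k y)"
  by (simp add: T_adj_def cinner_cadjoint_left T_bounded_clinear)

lemma T_adj_bounded_clinear: "bounded_clinear (T_adj k)"
  by (simp add: T_adj_def bounded_clinear_cadjoint T_bounded_clinear)

lemmas T_adj_lin = bounded_clinear_add[OF T_adj_bounded_clinear]
  bounded_clinear_scaleC[OF T_adj_bounded_clinear] bounded_clinear_diff[OF T_adj_bounded_clinear]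
  bounded_clinear_0[OF T_adj_bounded_clinear] bounded_clinear_sum[OF T_adj_bounded_clinear]

definition row_sq :: "'h \<Rightarrow> 'h"
  where "row_sq x = (\<Sum>k\<in>UNIV. T k (T_adj k x))"

lemma cinner_row_sq: "cinner (row_sq x) x = of_real (\<Sum>k\<in>UNIV. (norm (T_adj k x))\<^sup>2)"
  by (simp add: row_sq_def cinner_sum_left cinner_T cinner_same)

lemma column_le: "(\<Sum>k\<in>UNIV. (norm (T_adj k x))\<^sup>2) \<le> (norm x)\<^sup>2"
proof -
  have "positive_op (\<lambda>x. x - row_sq x)"
    using d_contraction by (simp add: d_contraction_def row_sq_def T_adj_def)
  then have "0 \<le> Re (cinner (x - row_sq x) x)"
    by (rule positive_op_nonneg)
  then show ?thesis
    by (simp add: cinner_diff_left cinner_row_sq cinner_same)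
qed

text \<open>The row operator is adjoint to the column \<open>y \<mapsto> (T_adj k y)\<close>, a
  contraction by \<open>column_le\<close>; pairing \<open>y\<close> with itself and using
  Cauchy-Schwarz twice transfers the bound.\<close>

lemma row_le: "(norm (\<Sum>k\<in>UNIV. T k (f k)))\<^sup>2 \<le> (\<Sum>k\<in>UNIV. (norm (f k))\<^sup>2)"
proof -
  define y where "y = (\<Sum>k\<in>UNIV. T k (f k))"
  define a where "a = (\<Sum>k\<in>UNIV. (norm (f k))\<^sup>2)"
  have a0: "0 \<le> a" by (simp add: a_def sum_nonneg)
  have "(norm y)\<^sup>2 = norm (\<Sum>k\<in>UNIV. cinner (f k) (T_adj k y))"
    by (simp only: cinner_T[symmetric] cinner_sum_left[symmetric] y_def[symmetric] cinner_same
        norm_of_real) simp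
  also have "\<dots> \<le> (\<Sum>k\<in>UNIV. norm (f k) * norm (T_adj k y))"
    by (intro sum_norm_le norm_cinner_le)
  also have "\<dots> \<le> L2_set (\<lambda>k. norm (f k)) UNIV * L2_set (\<lambda>k. norm (T_adj k y)) UNIV"
    using L2_set_mult_ineq[of "\<lambda>k. norm (f k)" "\<lambda>k. norm (T_adj k y)" UNIV] by simp
  also have "\<dots> \<le> sqrt a * norm y"
  proof -
    have "L2_set (\<lambda>k. norm (T_adj k y)) UNIV \<le> sqrt ((norm y)\<^sup>2)"
      unfolding L2_set_def by (intro real_sqrt_le_mono column_le)
    then show ?thesis
      using a0 by (intro mult_mono) (auto simp: L2_set_def a_def sum_nonneg)
  qed
  finally have "norm y * norm y \<le> sqrt a * norm y"
    by (simp add: power2_eq_square)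
  then have "norm y \<le> sqrt a"
    using a0 by (cases "norm y = 0") auto
  then have "(norm y)\<^sup>2 \<le> (sqrt a)\<^sup>2"
    by (intro power_mono) auto
  then show ?thesis
    using a0 by (simp add: y_def a_def)
qed

lemma norm_row_sq: "norm (row_sq x) \<le> norm x"
proof -
  have "(norm (row_sq x))\<^sup>2 \<le> (norm x)\<^sup>2"
    unfolding row_sq_def using row_le[of "\<lambda>k. T_adj k x"] column_le[of x] by linarith
  then show ?thesis by (rule power2_le_imp_le) simp
qed

lemma row_sq_selfadjoint: "cinner (row_sq x) y = cinner x (row_sq y)"
  by (simp add: row_sq_def cinner_sum_left cinner_sum_right cinner_T cinner_T_adj[symmetric])

lemma row_sq_bounded_clinear: "bounded_clinear row_sq"
proof (rule bounded_clinearI[where K = 1])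
  show "norm (row_sq x) \<le> 1 * norm x" for x
    using norm_row_sq by simp
qed (auto simp: row_sq_def T_lin T_adj_lin sum.distrib complex_vector.scale_sum_right)

definition \<Delta> :: "'h \<Rightarrow> 'h"
  where "\<Delta> = defect_op T"

lemma \<Delta>_props:
  shows \<Delta>_positive: "positive_op \<Delta>" and \<Delta>_\<Delta>: "\<Delta> (\<Delta> x) = x - row_sq x"
    and \<Delta>_commute: "bounded_clinear C \<Longrightarrow> (\<And>x. C (row_sq x) = row_sq (C x)) \<Longrightarrow> C (\<Delta> x) = \<Delta> (C x)"
proof -
  have "\<Delta> = sqrt_op (\<lambda>x. x - row_sq x)"
    by (simp add: \<Delta>_def defect_op_def row_sq_def T_adj_def)
  then show "positive_op \<Delta>" "\<Delta> (\<Delta> x) = x - row_sq x"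
    "bounded_clinear C \<Longrightarrow> (\<And>x. C (row_sq x) = row_sq (C x)) \<Longrightarrow> C (\<Delta> x) = \<Delta> (C x)"
    using sqrt_op_props[OF row_sq_bounded_clinear norm_row_sq row_sq_selfadjoint] by simp_all
qed

lemma \<Delta>_bounded_clinear: "bounded_clinear \<Delta>"
  using \<Delta>_positive by (simp add: positive_op_def)

lemmas \<Delta>_lin = bounded_clinear_add[OF \<Delta>_bounded_clinear] bounded_clinear_scaleC[OF \<Delta>_bounded_clinear]
  bounded_clinear_diff[OF \<Delta>_bounded_clinear] bounded_clinear_0[OF \<Delta>_bounded_clinear]
  bounded_clinear_sum[OF \<Delta>_bounded_clinear]

lemma cinner_\<Delta>: "cinner (\<Delta> x) y = cinner x (\<Delta> y)"
  using \<Delta>_positive by (rule positive_op_selfadjoint)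

lemma norm_\<Delta>: "(norm (\<Delta> x))\<^sup>2 = (norm x)\<^sup>2 - (\<Sum>k\<in>UNIV. (norm (T_adj k x))\<^sup>2)"
  using cinner_row_sq[of x]
  by (simp add: norm_eq_cinner cinner_\<Delta>[of x] \<Delta>_\<Delta> cinner_diff_right row_sq_selfadjoint[symmetric])

end

section \<open>Graded modules over polynomial rings\<close>

text \<open>Chain condition in a single degree: the union has finite dimension, and the finitely
  many vectors of an orthonormal basis of it all lie in one member.\<close>

lemma increasing_subspaces_stabilize:
  fixes L :: "nat \<Rightarrow> 'a::complex_hilbert_space set"
  assumes sub: "\<And>j. complex_vector.subspace (L j)" and mono: "\<And>j. L j \<subseteq> L (Suc j)"
    and fd: "finite_cdim V" "\<And>j. L j \<subseteq> V"
  obtains j where "(\<Union>i. L i) \<subseteq> L j"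
proof -
  have mono': "L i \<subseteq> L j" if "i \<le> j" for i j
    using that lift_Suc_mono_le[of L, OF mono] by blast
  have subU: "complex_vector.subspace (\<Union>i. L i)"
  proof (rule complex_vector.subspaceI)
    show "0 \<in> (\<Union>i. L i)"
      using complex_vector.subspace_0[OF sub] by blast
    show "x + y \<in> (\<Union>i. L i)" if x: "x \<in> (\<Union>i. L i)" and y: "y \<in> (\<Union>i. L i)" for x y
    proof -
      obtain i j where "x \<in> L i" "y \<in> L j" using x y by blast
      then have "x \<in> L (max i j)" "y \<in> L (max i j)"
        using mono'[of i "max i j"] mono'[of j "max i j"] by auto
      then show ?thesis
        using complex_vector.subspace_add[OF sub] by blast
    qed
    show "c *\<^sub>C x \<in> (\<Union>i. L i)" if "x \<in> (\<Union>i. L i)" for c x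
      using that complex_vector.subspace_scale[OF sub] by blast
  qed
  have "finite_cdim (\<Union>i. L i)"
    using fd by (meson UN_least finite_cdim_subset)
  then obtain E where E: "orthonormal_basis (\<Union>i. L i) E"
    using ex_orthonormal_basis[OF subU] by blast
  have "\<forall>e\<in>E. \<exists>i. e \<in> L i"
    using orthonormal_basisD(2)[OF E] by blast
  then obtain f where f: "\<And>e. e \<in> E \<Longrightarrow> e \<in> L (f e)"
    by metis
  have "e \<in> L (Max (f ` E))" if "e \<in> E" for e
    using f[OF that] mono'[of "f e" "Max (f ` E)"] orthonormal_basisD(1)[OF E] that by auto
  then have "complex_vector.span E \<subseteq> L (Max (f ` E))"
    by (intro complex_vector.span_minimal sub) auto
  then show ?thesis
    using E that[of "Max (f ` E)"] by (auto simp: orthonormal_basis_def)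
qed

text \<open>Pure algebra of commuting linear maps. The family of maps stays fixed, while the set
  \<open>S\<close> of variables regarded as acting shrinks in the inductions below.\<close>

locale commuting_family =
  fixes T :: "'i \<Rightarrow> 'a::complex_hilbert_space \<Rightarrow> 'a"
  assumes T_add: "T k (x + y) = T k x + T k y"
    and T_scale: "T k (c *\<^sub>C x) = c *\<^sub>C T k x"
    and T_comm: "T j (T k x) = T k (T j x)"
begin

lemma T_0: "T k 0 = 0"
  using T_add[of k 0 0] by simp

lemma T_minus: "T k (- x) = - T k x"
  using T_add[of k x "-x"] by (simp add: T_0 minus_unique)

lemma T_diff: "T k (x - y) = T k x - T k y"
  using T_add[of k x "-y"] by (simp add: T_minus)

lemma T_sum: "T k (\<Sum>i\<in>I. f i) = (\<Sum>i\<in>I. T k (f i))"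
  by (induction I rule: infinite_finite_induct) (auto simp: T_0 T_add)

lemma Tpow_add: "(T k ^^ j) (x + y) = (T k ^^ j) x + (T k ^^ j) y"
  by (induction j) (auto simp: T_add)

lemma Tpow_scale: "(T k ^^ j) (c *\<^sub>C x) = c *\<^sub>C (T k ^^ j) x"
  by (induction j) (auto simp: T_scale)

lemma Tpow_0: "(T k ^^ j) 0 = 0"
  by (induction j) (auto simp: T_0)

lemma Tpow_diff: "(T k ^^ j) (x - y) = (T k ^^ j) x - (T k ^^ j) y"
  by (induction j) (auto simp: T_diff)

lemma Tpow_sum: "(T k ^^ j) (\<Sum>i\<in>I. f i) = (\<Sum>i\<in>I. (T k ^^ j) (f i))"
  by (induction I rule: infinite_finite_induct) (auto simp: Tpow_0 Tpow_add)

lemma Tpow_comm: "(T k ^^ j) (T i x) = T i ((T k ^^ j) x)"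
  by (induction j) (auto simp: T_comm)

text \<open>A sequence of subspaces \<open>A n\<close> closed under the operators of \<open>S\<close> is a graded module over the
  polynomials in the variables \<open>S\<close>. Subquotients \<open>A/B\<close> are represented by pairs \<open>B \<subseteq> A\<close>;
  \<open>fin_gen S A B\<close> says that \<open>A/B\<close> is generated by its elements of bounded degree.\<close>

definition graded_mod :: "'i set \<Rightarrow> (nat \<Rightarrow> 'a set) \<Rightarrow> bool"
  where "graded_mod S A \<longleftrightarrow> (\<forall>n. complex_vector.subspace (A n)) \<and>
    (\<forall>k\<in>S. \<forall>n. \<forall>x\<in>A n. T k x \<in> A (Suc n))"

definition fin_gen :: "'i set \<Rightarrow> (nat \<Rightarrow> 'a set) \<Rightarrow> (nat \<Rightarrow> 'a set) \<Rightarrow> bool"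
  where "fin_gen S A B \<longleftrightarrow> (\<exists>n1. \<forall>n\<ge>n1. \<forall>x\<in>A (Suc n). \<exists>a. (\<forall>k\<in>S. a k \<in> A n) \<and>
    x - (\<Sum>k\<in>S. T k (a k)) \<in> B (Suc n))"

definition shift :: "'i \<Rightarrow> (nat \<Rightarrow> 'a set) \<Rightarrow> nat \<Rightarrow> 'a set"
  where "shift s A n = (case n of 0 \<Rightarrow> {0} | Suc m \<Rightarrow> T s ` A m)"

text \<open>Taking \<open>B + T s A\<close> as denominator turns \<open>A/B\<close> into the
  cokernel of \<open>T s\<close>, on which \<open>s\<close> acts as zero.\<close>

definition shift_plus :: "'i \<Rightarrow> (nat \<Rightarrow> 'a set) \<Rightarrow> (nat \<Rightarrow> 'a set) \<Rightarrow> nat \<Rightarrow> 'a set"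
  where "shift_plus s A B n = {x + y |x y. x \<in> shift s A n \<and> y \<in> B n}"

lemma graded_modD:
  assumes "graded_mod S A"
  shows "0 \<in> A n" "x \<in> A n \<Longrightarrow> y \<in> A n \<Longrightarrow> x + y \<in> A n" "x \<in> A n \<Longrightarrow> y \<in> A n \<Longrightarrow> x - y \<in> A n"
    "x \<in> A n \<Longrightarrow> c *\<^sub>C x \<in> A n" "x \<in> A n \<Longrightarrow> - x \<in> A n" "k \<in> S \<Longrightarrow> x \<in> A n \<Longrightarrow> T k x \<in> A (Suc n)"
    "(\<And>i. i \<in> I \<Longrightarrow> f i \<in> A n) \<Longrightarrow> (\<Sum>i\<in>I. f i) \<in> A n"
    "complex_vector.subspace (A n)"
  using assms
  by (auto simp: graded_mod_def complex_vector.subspace_0 complex_vector.subspace_add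
      complex_vector.subspace_diff complex_vector.subspace_scale complex_vector.subspace_neg
      complex_vector.subspace_sum)

lemma graded_modI:
  assumes "\<And>n. 0 \<in> A n" "\<And>n x y. x \<in> A n \<Longrightarrow> y \<in> A n \<Longrightarrow> x + y \<in> A n"
    "\<And>n x c. x \<in> A n \<Longrightarrow> c *\<^sub>C x \<in> A n" "\<And>n x k. k \<in> S \<Longrightarrow> x \<in> A n \<Longrightarrow> T k x \<in> A (Suc n)"
  shows "graded_mod S A"
  using assms by (auto simp: graded_mod_def intro: complex_vector.subspaceI)

lemma graded_mod_mono: "graded_mod S A \<Longrightarrow> S' \<subseteq> S \<Longrightarrow> graded_mod S' A"
  by (auto simp: graded_mod_def)

lemma graded_mod_pow:
  assumes "graded_mod S A" "k \<in> S" "x \<in> A n"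
  shows "(T k ^^ j) x \<in> A (j + n)"
  using assms by (induction j) (auto simp: graded_mod_def)

lemma graded_mod_shift:
  assumes A: "graded_mod S A"
  shows "graded_mod S (shift s A)"
proof (rule graded_modI)
  note [simp] = graded_modD[OF A]
  show "0 \<in> shift s A n" for n
    by (auto simp: shift_def T_0 image_iff split: nat.split intro!: bexI[of _ 0])
  show "x + y \<in> shift s A n" if "x \<in> shift s A n" "y \<in> shift s A n" for x y n
    using that by (auto simp: shift_def T_add[symmetric] split: nat.splits)
  show "c *\<^sub>C x \<in> shift s A n" if "x \<in> shift s A n" for x c n
    using that by (auto simp: shift_def T_scale[symmetric] split: nat.splits)
  show "T k x \<in> shift s A (Suc n)" if k: "k \<in> S" and x: "x \<in> shift s A n" for x k n
  proof (cases n)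
    case 0
    then show ?thesis
      using x by (auto simp: shift_def T_0 image_iff intro!: bexI[of _ 0])
  next
    case (Suc m)
    then obtain w where "x = T s w" "w \<in> A m" using x by (auto simp: shift_def)
    then show ?thesis
      using k Suc T_comm[of k s w] by (auto simp: shift_def)
  qed
qed

lemma shift_subset: "graded_mod S A \<Longrightarrow> s \<in> S \<Longrightarrow> shift s A n \<subseteq> A n"
  by (auto simp: shift_def graded_modD split: nat.split)

lemma graded_mod_shift_plus:
  assumes A: "graded_mod S A" and B: "graded_mod S B"
  shows "graded_mod S (shift_plus s A B)"
proof -
  note S = graded_modD[OF graded_mod_shift[OF A, of s]] and B = graded_modD[OF B]
  show ?thesis
  proof (rule graded_modI)
    show "0 \<in> shift_plus s A B n" for n
      using S(1) B(1) by (force simp: shift_plus_def)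
    show "x + y \<in> shift_plus s A B n" if xy: "x \<in> shift_plus s A B n" "y \<in> shift_plus s A B n" for x y n
    proof -
      obtain a b c d where "x = a + b" "y = c + d" "a \<in> shift s A n" "c \<in> shift s A n" "b \<in> B n" "d \<in> B n"
        using xy unfolding shift_plus_def by blast
      then have "x + y = (a + c) + (b + d)" "a + c \<in> shift s A n" "b + d \<in> B n"
        using S(2) B(2) by auto
      then show ?thesis by (auto simp: shift_plus_def)
    qed
    show "c *\<^sub>C x \<in> shift_plus s A B n" if "x \<in> shift_plus s A B n" for x c n
      using that S(4) B(4) by (fastforce simp: shift_plus_def scaleC_add_right)
    show "T k x \<in> shift_plus s A B (Suc n)" if "k \<in> S" "x \<in> shift_plus s A B n" for x k n
      using that S(6) B(6) by (fastforce simp: shift_plus_def T_add)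
  qed
qed

text \<open>The summand \<open>T s (a s)\<close> is absorbed by the enlarged denominator, so the
  remaining variables generate.\<close>

lemma fin_gen_shift_plus:
  assumes fin: "finite S" "s \<notin> S" and fg: "fin_gen (insert s S) A B"
  shows "fin_gen S A (shift_plus s A B)"
proof -
  obtain n1 where n1: "\<And>n x. n \<ge> n1 \<Longrightarrow> x \<in> A (Suc n) \<Longrightarrow> \<exists>a. (\<forall>k\<in>insert s S. a k \<in> A n) \<and>
    x - (\<Sum>k\<in>insert s S. T k (a k)) \<in> B (Suc n)"
    using fg unfolding fin_gen_def by blast
  have "\<exists>a. (\<forall>k\<in>S. a k \<in> A n) \<and> x - (\<Sum>k\<in>S. T k (a k)) \<in> shift_plus s A B (Suc n)"
    if n: "n \<ge> n1" and x: "x \<in> A (Suc n)" for n x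
  proof -
    obtain a where a: "\<And>k. k \<in> insert s S \<Longrightarrow> a k \<in> A n"
      and b: "x - (\<Sum>k\<in>insert s S. T k (a k)) \<in> B (Suc n)"
      using n1[OF n x] by blast
    have "x - (\<Sum>k\<in>S. T k (a k)) = T s (a s) + (x - (\<Sum>k\<in>insert s S. T k (a k)))"
      using fin by simp
    then have "\<exists>u v. x - (\<Sum>k\<in>S. T k (a k)) = u + v \<and> u \<in> T s ` A n \<and> v \<in> B (Suc n)"
      using a b by blast
    then have "x - (\<Sum>k\<in>S. T k (a k)) \<in> shift_plus s A B (Suc n)"
      by (simp add: shift_plus_def shift_def)
    then show ?thesis
      using a by blast
  qed
  then show ?thesis
    unfolding fin_gen_def by blast
qed

text \<open>Hilbert's basis theorem. \<open>L j\<close> collects the leading coefficients of the elements of \<open>N\<close> that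
  have order \<open>j\<close> in the variable \<open>s\<close>; these modules over the remaining variables increase with \<open>j\<close>
  and stabilize.\<close>

theorem fin_gen_submodule:
  assumes "finite S" "graded_mod S A" "graded_mod S B" "graded_mod S N"
    "\<And>n. B n \<subseteq> N n" "\<And>n. N n \<subseteq> A n" "\<And>n. finite_cdim (A n)" "fin_gen S A B"
  shows "fin_gen S N B"
  using assms
proof (induction S arbitrary: A B N rule: finite_induct)
  case empty
  then show ?case
    by (fastforce simp: fin_gen_def)
next
  case (insert s S)
  let ?S = "insert s S"
  note A = graded_modD[OF insert.prems(1)] and B = graded_modD[OF insert.prems(2)]
    and N = graded_modD[OF insert.prems(3)]
  note BN = insert.prems(4) and NA = insert.prems(5)
  let ?TA = "shift s A" and ?C = "shift_plus s A B"
  note TA = graded_modD[OF graded_mod_shift[OF insert.prems(1), of s]]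
  have TAA: "?TA n \<subseteq> A n" for n
    using shift_subset insert.prems(1) by blast
  have C: "graded_mod S ?C"
    using graded_mod_mono[OF graded_mod_shift_plus[OF insert.prems(1,2)]] by blast
  have fgC: "fin_gen S A ?C"
    using fin_gen_shift_plus insert.hyps insert.prems(7) by blast
  \<comment> \<open>Elements of \<open>N\<close> of order \<open>j\<close> in \<open>s\<close> are
    written \<open>(T s ^^ j) (x - z)\<close> with \<open>z\<close> in \<open>T s A\<close>;
    \<open>x\<close> is the leading coefficient. It is determined at best modulo
    \<open>T s A\<close>, which \<open>L j\<close> contains together with \<open>B\<close>.\<close>
  define L where "L j n = {x\<in>A n. \<exists>z\<in>?TA n. (T s ^^ j) (x - z) \<in> N (j + n)}" for j n
  have CL: "?C n \<subseteq> L j n" for j n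
  proof
    fix x assume "x \<in> ?C n"
    then obtain z b where x: "x = z + b" "z \<in> ?TA n" "b \<in> B n"
      by (auto simp: shift_plus_def)
    moreover have "(T s ^^ j) b \<in> N (j + n)"
      using graded_mod_pow[OF insert.prems(2) insertI1 x(3)] BN by blast
    moreover have "z \<in> A n" "b \<in> A n"
      using x TAA BN NA by blast+
    ultimately show "x \<in> L j n"
      using A(2) by (auto simp: L_def intro!: bexI[of _ z])
  qed
  have Lmod: "graded_mod S (L j)" for j
  proof (rule graded_modI)
    show "0 \<in> L j n" for n
      using A(1) N(1) TA(1) by (auto simp: L_def Tpow_0 intro!: bexI[of _ 0])
    show "x + y \<in> L j n" if xy: "x \<in> L j n" "y \<in> L j n" for x y n
    proof -
      obtain z w where zw: "z \<in> ?TA n" "w \<in> ?TA n" "(T s ^^ j) (x - z) \<in> N (j + n)"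
        "(T s ^^ j) (y - w) \<in> N (j + n)" "x \<in> A n" "y \<in> A n"
        using xy by (auto simp: L_def)
      have "(T s ^^ j) ((x + y) - (z + w)) = (T s ^^ j) (x - z) + (T s ^^ j) (y - w)"
        by (simp add: Tpow_add[symmetric] algebra_simps)
      also have "\<dots> \<in> N (j + n)"
        using zw N by blast
      finally show ?thesis
        using zw A(2) TA(2) by (auto simp: L_def)
    qed
    show "c *\<^sub>C x \<in> L j n" if x: "x \<in> L j n" for x c n
    proof -
      obtain z where z: "z \<in> ?TA n" "(T s ^^ j) (x - z) \<in> N (j + n)" "x \<in> A n"
        using x by (auto simp: L_def)
      have "(T s ^^ j) (c *\<^sub>C x - c *\<^sub>C z) \<in> N (j + n)"
        using N(4)[OF z(2)] by (simp add: complex_vector.scale_right_diff_distrib[symmetric] Tpow_scale)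
      then show ?thesis
        using z A(4) TA(4) by (auto simp: L_def)
    qed
    show "T k x \<in> L j (Suc n)" if k: "k \<in> S" and x: "x \<in> L j n" for x k n
    proof -
      obtain z where z: "z \<in> ?TA n" "(T s ^^ j) (x - z) \<in> N (j + n)" "x \<in> A n"
        using x by (auto simp: L_def)
      have "(T s ^^ j) (T k x - T k z) \<in> N (j + Suc n)"
        using N(6)[OF _ z(2), of k] k by (simp add: T_diff[symmetric] Tpow_comm)
      then show ?thesis
        using z A(6) TA(6) k by (auto simp: L_def)
    qed
  qed
  have Lmono: "L j n \<subseteq> L (Suc j) n" for j n
    using N(6) by (fastforce simp: L_def)
  have LA: "L j n \<subseteq> A n" for j n
    by (auto simp: L_def)
  define U where "U n = (\<Union>j. L j n)" for n
  have Lmono': "L i n \<subseteq> L j n" if "i \<le> j" for i j n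
    using that lift_Suc_mono_le[of "\<lambda>j. L j n", OF Lmono] by blast
  have stab: "\<exists>j. U n \<subseteq> L j n" for n
    using increasing_subspaces_stabilize[of "\<lambda>j. L j n" "A n"] graded_modD(8)[OF Lmod] Lmono
      insert.prems(6) LA unfolding U_def by metis
  have Umod: "graded_mod S U"
  proof (rule graded_modI)
    fix n
    obtain j where j: "U n \<subseteq> L j n" using stab by blast
    then have Uj: "U n = L j n" by (auto simp: U_def)
    show "0 \<in> U n" "\<And>x y. x \<in> U n \<Longrightarrow> y \<in> U n \<Longrightarrow> x + y \<in> U n" "\<And>x c. x \<in> U n \<Longrightarrow> c *\<^sub>C x \<in> U n"
      unfolding Uj using graded_modD[OF Lmod] by auto
    show "T k x \<in> U (Suc n)" if "k \<in> S" "x \<in> U n" for k x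
      using graded_modD(6)[OF Lmod that(1)] that(2) by (auto simp: U_def)
  qed
  have CU: "?C n \<subseteq> U n" and UA: "U n \<subseteq> A n" for n
    unfolding U_def using CL LA by blast+
  have As: "graded_mod S A"
    using graded_mod_mono[OF insert.prems(1)] by blast
  have "fin_gen S U ?C"
    by (rule insert.IH[OF As C Umod CU UA insert.prems(6) fgC])
  then obtain n2 where n2: "\<And>n x. n \<ge> n2 \<Longrightarrow> x \<in> U (Suc n) \<Longrightarrow> \<exists>a. (\<forall>k\<in>S. a k \<in> U n) \<and>
    x - (\<Sum>k\<in>S. T k (a k)) \<in> ?C (Suc n)"
    unfolding fin_gen_def by blast
  have "\<exists>n3. \<forall>n x. n \<ge> n3 \<longrightarrow> x \<in> L j (Suc n) \<longrightarrow> (\<exists>a. (\<forall>k\<in>S. a k \<in> L j n) \<and>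
    x - (\<Sum>k\<in>S. T k (a k)) \<in> ?C (Suc n))" for j
    using insert.IH[OF As C Lmod CL LA insert.prems(6) fgC, of j] unfolding fin_gen_def by blast
  then obtain n3 where n3: "\<And>j n x. n \<ge> n3 j \<Longrightarrow> x \<in> L j (Suc n) \<Longrightarrow> \<exists>a. (\<forall>k\<in>S. a k \<in> L j n) \<and>
    x - (\<Sum>k\<in>S. T k (a k)) \<in> ?C (Suc n)"
    by metis
  obtain jn where jn: "\<And>n. U n \<subseteq> L (jn n) n"
    using stab by metis
  \<comment> \<open>In each degree the chain stabilizes, at a stage depending on the degree. Past
    \<open>n2\<close> the module \<open>U\<close> is generated from the preceding degree modulo
    \<open>?C\<close>, so stability at one stage is inherited and a maximum over
    \<open>{..n2}\<close> serves all degrees.\<close>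
  define J where "J = Max (jn ` {..n2})"
  have UJ: "U n \<subseteq> L J n" for n
  proof (cases "n \<le> n2")
    case True
    then have "jn n \<le> J" by (auto simp: J_def)
    then show ?thesis using jn Lmono' by blast
  next
    case False
    then have "n2 \<le> n" by simp
    then show ?thesis
    proof (induction n rule: dec_induct)
      case base
      have "jn n2 \<le> J" by (auto simp: J_def)
      then show ?case using jn Lmono' by blast
    next
      case (step n)
      show ?case
      proof
        fix x assume "x \<in> U (Suc n)"
        then obtain a where a: "\<And>k. k \<in> S \<Longrightarrow> a k \<in> U n" "x - (\<Sum>k\<in>S. T k (a k)) \<in> ?C (Suc n)"
          using n2[OF step.hyps(1)] by blast
        note L = graded_modD[OF Lmod]
        have "(\<Sum>k\<in>S. T k (a k)) \<in> L J (Suc n)"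
          using a(1) step.IH by (intro L(7) L(6)) auto
        then have "(x - (\<Sum>k\<in>S. T k (a k))) + (\<Sum>k\<in>S. T k (a k)) \<in> L J (Suc n)"
          using a(2) CL L(2) by blast
        then show "x \<in> L J (Suc n)" by simp
      qed
    qed
  qed
  \<comment> \<open>The first summand bounds the generating degrees of
    \<open>L 0, \<dots>, L J\<close>; the second compensates that a coefficient of order
    \<open>j\<close> has degree lower by \<open>j\<close>.\<close>
  define p where "p = Max (n3 ` {..J}) + J"
  have p: "n3 j + j \<le> p" if "j \<le> J" for j
    using that unfolding p_def by (intro add_mono) auto
  have "\<exists>a. (\<forall>k\<in>?S. a k \<in> N n) \<and> x - (\<Sum>k\<in>?S. T k (a k)) \<in> B (Suc n)"
    if n: "n \<ge> p" and x: "x \<in> N (Suc n)" for n x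
  proof -
    \<comment> \<open>\<open>I\<close> is the part of degree \<open>Suc n\<close> generated by
      \<open>N n\<close> modulo \<open>B\<close>; the aim is \<open>x \<in> I\<close>.\<close>
    define I where "I = {(\<Sum>k\<in>?S. T k (a k)) + b |a b. (\<forall>k\<in>?S. a k \<in> N n) \<and> b \<in> B (Suc n)}"
    have I0: "0 \<in> I"
      using N(1) B(1) by (force simp: I_def T_0)
    have Iadd: "u + v \<in> I" if u: "u \<in> I" and v: "v \<in> I" for u v
    proof -
      obtain a b a' b' where "u = (\<Sum>k\<in>?S. T k (a k)) + b" "v = (\<Sum>k\<in>?S. T k (a' k)) + b'"
        "\<forall>k\<in>?S. a k \<in> N n" "\<forall>k\<in>?S. a' k \<in> N n" "b \<in> B (Suc n)" "b' \<in> B (Suc n)"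
        using u v unfolding I_def by blast
      then have "u + v = (\<Sum>k\<in>?S. T k (a k + a' k)) + (b + b')"
        "\<forall>k\<in>?S. a k + a' k \<in> N n" "b + b' \<in> B (Suc n)"
        using N(2) B(2) by (auto simp: T_add sum.distrib)
      then show ?thesis
        unfolding I_def mem_Collect_eq
        by (intro exI[of _ "\<lambda>k. a k + a' k"] exI[of _ "b + b'"]) simp
    qed
    have IT: "T k u \<in> I" if k: "k \<in> ?S" and u: "u \<in> N n" for k u
    proof -
      have "T k u = (\<Sum>i\<in>?S. T i (if i = k then u else 0)) + 0"
        using k insert.hyps(1) by (simp add: if_distrib[of "T _"] T_0 cong: if_cong)
      then show ?thesis
        unfolding I_def mem_Collect_eq using u N(1) B(1)
        by (intro exI[of _ "\<lambda>i. if i = k then u else 0"] exI[of _ 0]) simp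
    qed
    have IB: "b \<in> I" if "b \<in> B (Suc n)" for b
    proof -
      have "b = (\<Sum>k\<in>?S. T k 0) + b" by (simp add: T_0)
      then show ?thesis
        unfolding I_def mem_Collect_eq using that N(1)
        by (intro exI[of _ "\<lambda>_. 0"] exI[of _ b]) simp
    qed
    have IN: "I \<subseteq> N (Suc n)"
    proof
      fix u assume "u \<in> I"
      then obtain a b where "u = (\<Sum>k\<in>?S. T k (a k)) + b" "\<forall>k\<in>?S. a k \<in> N n" "b \<in> B (Suc n)"
        unfolding I_def by blast
      then show "u \<in> N (Suc n)"
        using BN by (auto intro!: N(2) N(6) N(7))
    qed
    have Isum: "(\<Sum>i\<in>F. g i) \<in> I" if "\<And>i. i \<in> F \<Longrightarrow> g i \<in> I" for F and g :: "'i \<Rightarrow> 'a"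
      using that by (induction F rule: infinite_finite_induct) (auto simp: I0 Iadd)
    \<comment> \<open>Modulo \<open>I\<close> the element \<open>x\<close> is pushed to ever higher
      order in \<open>s\<close>. For \<open>j \<le> J\<close> its leading coefficient is combined
      from coefficients one degree lower; for \<open>j > J\<close> it already occurs at order
      \<open>j - 1\<close>, so one factor \<open>T s\<close> can be pulled out of an element of
      \<open>N\<close>.\<close>
    have "\<exists>y\<in>A (Suc n - j). x - (T s ^^ j) y \<in> I" if "j \<le> Suc n" for j
      using that
    proof (induction j)
      case 0
      then show ?case
        using x NA I0 by (auto intro!: bexI[of _ x])
    next
      case (Suc j)
      then obtain y where y: "y \<in> A (Suc n - j)" "x - (T s ^^ j) y \<in> I" by auto
      have jn: "j \<le> n" "Suc n - j = Suc (n - j)" using Suc.prems by auto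
      have "x - (x - (T s ^^ j) y) \<in> N (Suc n)"
        using x y(2) IN N(3) by blast
      then have TyN: "(T s ^^ j) y \<in> N (j + (Suc n - j))"
        using jn by simp
      then have yL: "y \<in> L j (Suc n - j)"
        using y(1) TA(1) by (auto simp: L_def intro!: bexI[of _ 0])
      have "\<exists>y'\<in>A (n - j). (T s ^^ j) (y - T s y') \<in> I"
      proof (cases "j \<le> J")
        case True
        then have "n3 j \<le> n - j" using p[OF True] n jn by simp
        then obtain a where a: "\<And>k. k \<in> S \<Longrightarrow> a k \<in> L j (n - j)"
          "y - (\<Sum>k\<in>S. T k (a k)) \<in> ?C (Suc (n - j))"
          using n3 yL jn(2) by metis
        have "\<forall>k\<in>S. \<exists>z\<in>?TA (n - j). (T s ^^ j) (a k - z) \<in> N (j + (n - j))"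
          using a(1) by (auto simp: L_def)
        then obtain z where z: "\<And>k. k \<in> S \<Longrightarrow> z k \<in> ?TA (n - j)"
          "\<And>k. k \<in> S \<Longrightarrow> (T s ^^ j) (a k - z k) \<in> N n"
          using jn(1) by (metis le_add_diff_inverse)
        obtain z' b where zb: "y - (\<Sum>k\<in>S. T k (a k)) = z' + b" "z' \<in> ?TA (Suc (n - j))"
          "b \<in> B (Suc (n - j))"
          using a(2) by (auto simp: shift_plus_def)
        have "(\<Sum>k\<in>S. T k (z k)) + z' \<in> ?TA (Suc (n - j))"
          using z(1) zb(2) by (intro TA(2) TA(7) TA(6)) auto
        then obtain y' where y': "y' \<in> A (n - j)" "(\<Sum>k\<in>S. T k (z k)) + z' = T s y'"
          by (auto simp: shift_def)
        have "y - T s y' = (\<Sum>k\<in>S. T k (a k - z k)) + b"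
          using y'(2) zb(1) by (simp add: T_diff sum_subtractf algebra_simps)
        then have eq: "(T s ^^ j) (y - T s y') = (\<Sum>k\<in>S. T k ((T s ^^ j) (a k - z k))) + (T s ^^ j) b"
          by (simp add: Tpow_add Tpow_sum Tpow_comm)
        have "(T s ^^ j) b \<in> B (Suc n)"
          using graded_mod_pow[OF insert.prems(2) insertI1 zb(3), of j] jn by simp
        then have "(T s ^^ j) (y - T s y') \<in> I"
          unfolding eq using z(2) by (intro Iadd Isum IT IB) auto
        then show ?thesis using y' by blast
      next
        case False
        then obtain i where i: "j = Suc i" "J \<le> i" by (cases j) auto
        have "y \<in> L i (Suc n - j)"
          using yL UJ Lmono'[OF i(2)] by (auto simp: U_def)
        then obtain z where z: "z \<in> ?TA (Suc n - j)" "(T s ^^ i) (y - z) \<in> N (i + (Suc n - j))"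
          by (auto simp: L_def)
        obtain y' where y': "z = T s y'" "y' \<in> A (n - j)"
          using z(1) unfolding jn(2) by (auto simp: shift_def)
        have "i + (Suc n - j) = n" using i jn by simp
        then have "T s ((T s ^^ i) (y - z)) \<in> I"
          using z(2) by (intro IT) auto
        then show ?thesis
          using y' i(1) by auto
      qed
      then obtain y' where y': "y' \<in> A (n - j)" "(T s ^^ j) (y - T s y') \<in> I"
        by blast
      have "x - (T s ^^ Suc j) y' = (x - (T s ^^ j) y) + (T s ^^ j) (y - T s y')"
        by (simp add: Tpow_diff Tpow_comm)
      also have "\<dots> \<in> I"
        using y(2) y'(2) by (rule Iadd)
      finally show ?case
        using y'(1) by auto
    qed
    from this[of "Suc n"] obtain y where y: "y \<in> A 0" "x - (T s ^^ Suc n) y \<in> I"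
      by auto
    have "x - (x - (T s ^^ Suc n) y) \<in> N (Suc n)"
      using x y(2) IN N(3) by blast
    then have "y \<in> L (Suc n) 0"
      using y(1) TA(1) by (auto simp: L_def intro!: bexI[of _ 0])
    moreover have "J \<le> n" using n by (simp add: p_def)
    ultimately have "y \<in> L n 0"
      using UJ[of 0] Lmono'[of J n 0] by (auto simp: U_def)
    \<comment> \<open>In degree \<open>0\<close> the set \<open>shift s A 0\<close> is
      \<open>{0}\<close>, so no higher-order correction remains.\<close>
    then have "(T s ^^ n) y \<in> N n"
      by (auto simp: L_def shift_def)
    then have "(T s ^^ Suc n) y \<in> I"
      using IT[of s] by simp
    then have "x \<in> I"
      using Iadd[OF y(2)] by fastforce
    then obtain a b where ab: "x = (\<Sum>k\<in>?S. T k (a k)) + b" "\<forall>k\<in>?S. a k \<in> N n" "b \<in> B (Suc n)"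
      unfolding I_def by blast
    then show ?thesis by (intro exI[of _ a]) simp
  qed
  then show ?case
    unfolding fin_gen_def by blast
qed

end

section \<open>The Koszul complex\<close>

text \<open>The sign of moving \<open>e_k\<close> from the front to its place in the increasing
  product over \<open>U\<close>.\<close>

definition koszul_sign :: "'i::linorder \<Rightarrow> 'i set \<Rightarrow> complex"
  where "koszul_sign k U = (-1) ^ card {j\<in>U. j < k}"

text \<open>The Koszul differential with forms as functions on index sets. Evaluated at
  \<open>U\<close> it sees subsets of \<open>U\<close> only, so passing to fewer variables means
  restricting \<open>U\<close>.\<close>

definition koszul :: "('i::linorder \<Rightarrow> 'a::complex_hilbert_space \<Rightarrow> 'a) \<Rightarrow> ('i set \<Rightarrow> 'a) \<Rightarrow> 'i set \<Rightarrow> 'a"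
  where "koszul T \<xi> U = (\<Sum>k\<in>U. koszul_sign k U *\<^sub>C T k (\<xi> (U - {k})))"

lemma koszul_sign_remove:
  assumes "finite U" "k \<in> U"
  shows "koszul_sign l (U - {k}) = (if k < l then - koszul_sign l U else koszul_sign l U)"
proof (cases "k < l")
  case True
  have "{j\<in>U. j < l} = insert k {j\<in>U - {k}. j < l}"
    using assms True by auto
  moreover have "card (insert k {j\<in>U - {k}. j < l}) = Suc (card {j\<in>U - {k}. j < l})"
    using assms by (intro card_insert_disjoint) auto
  ultimately show ?thesis
    using True by (simp add: koszul_sign_def)
next
  case False
  then have "{j\<in>U. j < l} = {j\<in>U - {k}. j < l}" by auto
  then show ?thesis
    using False by (simp add: koszul_sign_def)
qed

lemma koszul_sign_insert_min:
  assumes "finite U" "s \<notin> U" "\<And>x. x \<in> U \<Longrightarrow> s < x"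
  shows "koszul_sign s (insert s U) = 1" "k \<in> U \<Longrightarrow> koszul_sign k (insert s U) = - koszul_sign k U"
proof -
  have "{j\<in>insert s U. j < s} = {}"
    using assms(3) by force
  then show "koszul_sign s (insert s U) = 1"
    unfolding koszul_sign_def by (simp only: card.empty power_0)
  show "koszul_sign k (insert s U) = - koszul_sign k U" if "k \<in> U"
    using koszul_sign_remove[of "insert s U" s k] assms that by simp
qed

lemma koszul_cong: "(\<And>X. X \<subseteq> U \<Longrightarrow> \<xi> X = \<eta> X) \<Longrightarrow> koszul T \<xi> U = koszul T \<eta> U"
  by (auto simp: koszul_def intro!: sum.cong)

locale ordered_commuting_family = commuting_family T
  for T :: "'i::linorder \<Rightarrow> 'a::complex_hilbert_space \<Rightarrow> 'a"
begin

lemma koszul_add: "koszul T (\<lambda>X. \<xi> X + \<eta> X) U = koszul T \<xi> U + koszul T \<eta> U"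
  by (simp add: koszul_def T_add scaleC_add_right sum.distrib)

lemma koszul_diff: "koszul T (\<lambda>X. \<xi> X - \<eta> X) U = koszul T \<xi> U - koszul T \<eta> U"
  by (simp add: koszul_def T_diff complex_vector.scale_right_diff_distrib sum_subtractf)

lemma koszul_minus: "koszul T (\<lambda>X. - \<xi> X) U = - koszul T \<xi> U"
  by (simp add: koszul_def T_minus sum_negf)

lemma koszul_T: "koszul T (\<lambda>X. T s (\<xi> X)) U = T s (koszul T \<xi> U)"
  by (simp add: koszul_def T_sum T_scale T_comm[of s])

lemma koszul_in:
  assumes A: "graded_mod S A" and "U \<subseteq> S" and "finite U"
    and \<xi>: "\<And>X. X \<subseteq> U \<Longrightarrow> \<xi> X \<in> A (m + card X)"
  shows "koszul T \<xi> U \<in> A (m + card U)"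
  unfolding koszul_def
proof (rule graded_modD(7)[OF A], rule graded_modD(4)[OF A])
  fix k assume k: "k \<in> U"
  have "T k (\<xi> (U - {k})) \<in> A (Suc (m + card (U - {k})))"
    using k assms(2) by (intro graded_modD(6)[OF A] \<xi>) auto
  moreover have "Suc (m + card (U - {k})) = m + card U"
    using card_Suc_Diff1[OF assms(3) k] by simp
  ultimately show "T k (\<xi> (U - {k})) \<in> A (m + card U)" by simp
qed

text \<open>Removing \<open>k\<close> and \<open>l\<close> in the two possible orders produces
  opposite signs while \<open>T k\<close> and \<open>T l\<close> commute, so the double sum is
  antisymmetric and equals its own negative.\<close>

lemma koszul_koszul:
  assumes "finite U"
  shows "koszul T (koszul T \<xi>) U = 0"
proof -
  define g where "g k l = (if l = k then 0 else
      (koszul_sign k U * koszul_sign l (U - {k})) *\<^sub>C T k (T l (\<xi> (U - {k} - {l}))))" for k l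
  have eq: "koszul T (koszul T \<xi>) U = (\<Sum>k\<in>U. \<Sum>l\<in>U. g k l)"
    unfolding koszul_def
  proof (rule sum.cong)
    fix k assume k: "k \<in> U"
    have "(\<Sum>l\<in>U. g k l) = (\<Sum>l\<in>U - {k}. g k l)"
      using assms k by (subst sum.remove[of _ k]) (auto simp: g_def)
    also have "\<dots> = (\<Sum>l\<in>U - {k}. (koszul_sign k U * koszul_sign l (U - {k})) *\<^sub>C
        T k (T l (\<xi> (U - {k} - {l}))))"
      by (intro sum.cong) (auto simp: g_def)
    finally show "koszul_sign k U *\<^sub>C T k (\<Sum>ka\<in>U - {k}. koszul_sign ka (U - {k}) *\<^sub>C
        T ka (\<xi> (U - {k} - {ka}))) = (\<Sum>l\<in>U. g k l)"
      by (simp add: T_sum T_scale complex_vector.scale_sum_right scaleC_scaleC)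
  qed simp
  have anti: "g l k = - g k l" if "k \<in> U" "l \<in> U" for k l
  proof (cases "k = l")
    case False
    have "U - {k} - {l} = U - {l} - {k}" by auto
    moreover have "koszul_sign l U * koszul_sign k (U - {l}) = - (koszul_sign k U * koszul_sign l (U - {k}))"
      using False koszul_sign_remove[OF assms that(1), of l] koszul_sign_remove[OF assms that(2), of k]
      by (cases "k < l") auto
    moreover have "T l (T k (\<xi> (U - {k} - {l}))) = T k (T l (\<xi> (U - {k} - {l})))"
      by (rule T_comm)
    ultimately show ?thesis
      using False by (simp add: g_def)
  qed (auto simp: g_def)
  have "(\<Sum>k\<in>U. \<Sum>l\<in>U. g k l) = (\<Sum>l\<in>U. \<Sum>k\<in>U. g k l)"
    by (rule sum.swap)
  also have "\<dots> = (\<Sum>l\<in>U. \<Sum>k\<in>U. - g l k)"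
    by (intro sum.cong refl anti)
  also have "\<dots> = - (\<Sum>l\<in>U. \<Sum>k\<in>U. g l k)"
    by (simp add: sum_negf)
  finally have "(\<Sum>k\<in>U. \<Sum>l\<in>U. g k l) = - (\<Sum>k\<in>U. \<Sum>l\<in>U. g k l)" .
  then have "(2::real) *\<^sub>R (\<Sum>k\<in>U. \<Sum>l\<in>U. g k l) = 0"
    by (simp add: scaleR_2 eq_neg_iff_add_eq_0)
  then show ?thesis
    by (simp add: eq)
qed

text \<open>For the least index the sign of \<open>s\<close> itself is \<open>1\<close> and every
  other sign flips, which is the source of the minus.\<close>

lemma koszul_insert_min:
  assumes "finite U" "s \<notin> U" "\<And>x. x \<in> U \<Longrightarrow> s < x"
  shows "koszul T \<xi> (insert s U) = T s (\<xi> U) - koszul T (\<lambda>X. \<xi> (insert s X)) U"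
proof -
  have "koszul T \<xi> (insert s U) = T s (\<xi> U) +
      (\<Sum>k\<in>U. koszul_sign k (insert s U) *\<^sub>C T k (\<xi> (insert s U - {k})))"
    using assms by (simp add: koszul_def koszul_sign_insert_min)
  also have "(\<Sum>k\<in>U. koszul_sign k (insert s U) *\<^sub>C T k (\<xi> (insert s U - {k}))) =
      (\<Sum>k\<in>U. - (koszul_sign k U *\<^sub>C T k (\<xi> (insert s (U - {k})))))"
  proof (rule sum.cong)
    fix k assume k: "k \<in> U"
    then have "insert s U - {k} = insert s (U - {k})" using assms(2) by auto
    then show "koszul_sign k (insert s U) *\<^sub>C T k (\<xi> (insert s U - {k})) =
        - (koszul_sign k U *\<^sub>C T k (\<xi> (insert s (U - {k}))))"
      using koszul_sign_insert_min(2)[OF assms k] by simp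
  qed simp
  finally show ?thesis
    by (simp add: koszul_def sum_negf)
qed

text \<open>For the least variable \<open>s\<close> the complex is the mapping cone of \<open>T s\<close> on the complex of the
  remaining variables. These act finitely on the kernel \<open>K\<close> (by the basis theorem) and on the
  cokernel of \<open>T s\<close>.\<close>

theorem koszul_exact_large_degree:
  assumes "finite S" "graded_mod S A" "graded_mod S B"
    "\<And>n. B n \<subseteq> A n" "\<And>n. finite_cdim (A n)" "fin_gen S A B"
  shows "\<exists>m0. \<forall>m\<ge>m0. \<forall>\<xi>. (\<forall>X\<subseteq>S. \<xi> X \<in> A (m + card X)) \<longrightarrow>
    (\<forall>X\<subseteq>S. koszul T \<xi> X \<in> B (m + card X)) \<longrightarrow>
    (\<exists>\<eta>. (\<forall>X\<subseteq>S. \<eta> X \<in> A (m + card X)) \<and> (\<forall>X\<subseteq>S. \<xi> X - koszul T \<eta> X \<in> B (m + card X)))"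
  using assms
proof (induction S arbitrary: A B rule: finite_linorder_min_induct)
  case empty
  obtain n1 where n1: "\<And>n x. n \<ge> n1 \<Longrightarrow> x \<in> A (Suc n) \<Longrightarrow> x \<in> B (Suc n)"
    using empty.prems(5) by (auto simp: fin_gen_def)
  show ?case
  proof (intro exI allI impI)
    fix m and \<xi> :: "'i set \<Rightarrow> 'a"
    assume m: "Suc n1 \<le> m" and \<xi>: "\<forall>X\<subseteq>{}. \<xi> X \<in> A (m + card X)"
    obtain n where "m = Suc n" "n1 \<le> n" using m by (cases m) auto
    then show "(\<forall>X\<subseteq>{}. \<xi> X \<in> A (m + card X)) \<and> (\<forall>X\<subseteq>{}. \<xi> X - koszul T \<xi> X \<in> B (m + card X))"
      using n1 \<xi> by (auto simp: koszul_def)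
  qed
next
  case (insert s S)
  let ?S = "insert s S"
  have sS: "s \<notin> S" using insert.hyps by auto
  note A = graded_modD[OF insert.prems(1)] and B = graded_modD[OF insert.prems(2)]
  note BA = insert.prems(3)
  let ?C = "shift_plus s A B"
  have As: "graded_mod S A" and Bs: "graded_mod S B"
    using graded_mod_mono[OF insert.prems(1)] graded_mod_mono[OF insert.prems(2)] by blast+
  have C: "graded_mod S ?C"
    using graded_mod_mono[OF graded_mod_shift_plus[OF insert.prems(1,2)]] by blast
  have CA: "?C n \<subseteq> A n" for n
    using shift_subset[OF insert.prems(1) insertI1] BA A(2) by (fastforce simp: shift_plus_def)
  have fgC: "fin_gen S A ?C"
    using fin_gen_shift_plus insert.hyps(1) sS insert.prems(5) by blast
  define K where "K n = {x\<in>A n. T s x \<in> B (Suc n)}" for n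
  have K: "graded_mod ?S K"
    by (rule graded_modI) (auto simp: K_def A B T_0 T_add T_scale T_comm[of s])
  have Ks: "graded_mod S K"
    using graded_mod_mono[OF K] by blast
  have BK: "B n \<subseteq> K n" and KA: "K n \<subseteq> A n" for n
    using BA B(6) by (auto simp: K_def)
  have fdK: "finite_cdim (K n)" for n
    using insert.prems(4) KA finite_cdim_subset by blast
  have fgK: "fin_gen ?S K B"
    using insert.hyps(1) insert.prems BK KA
    by (intro fin_gen_submodule[OF _ insert.prems(1,2) K]) auto
  \<comment> \<open>\<open>T s\<close> maps \<open>K\<close> into \<open>B\<close>, so the
    contributions of \<open>s\<close> vanish in \<open>K/B\<close>.\<close>
  have fgK': "fin_gen S K B"
  proof -
    obtain n1 where n1: "\<And>n x. n \<ge> n1 \<Longrightarrow> x \<in> K (Suc n) \<Longrightarrow> \<exists>a. (\<forall>k\<in>?S. a k \<in> K n) \<and>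
      x - (\<Sum>k\<in>?S. T k (a k)) \<in> B (Suc n)"
      using fgK unfolding fin_gen_def by blast
    have "\<exists>a. (\<forall>k\<in>S. a k \<in> K n) \<and> x - (\<Sum>k\<in>S. T k (a k)) \<in> B (Suc n)"
      if n: "n \<ge> n1" and x: "x \<in> K (Suc n)" for n x
    proof -
      obtain a where a: "\<And>k. k \<in> ?S \<Longrightarrow> a k \<in> K n"
        and b: "x - (\<Sum>k\<in>?S. T k (a k)) \<in> B (Suc n)"
        using n1[OF n x] by blast
      have "x - (\<Sum>k\<in>S. T k (a k)) = T s (a s) + (x - (\<Sum>k\<in>?S. T k (a k)))"
        using insert.hyps(1) sS by simp
      moreover have "T s (a s) \<in> B (Suc n)"
        using a[of s] by (simp add: K_def)
      ultimately have "x - (\<Sum>k\<in>S. T k (a k)) \<in> B (Suc n)"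
        using b B(2) by metis
      then show ?thesis using a by blast
    qed
    then show ?thesis unfolding fin_gen_def by blast
  qed
  define exact where "exact A B m \<longleftrightarrow> (\<forall>\<xi>. (\<forall>X\<subseteq>S. \<xi> X \<in> A (m + card X)) \<longrightarrow>
    (\<forall>X\<subseteq>S. koszul T \<xi> X \<in> B (m + card X)) \<longrightarrow>
    (\<exists>\<eta>. (\<forall>X\<subseteq>S. \<eta> X \<in> A (m + card X)) \<and> (\<forall>X\<subseteq>S. \<xi> X - koszul T \<eta> X \<in> B (m + card X))))"
    for A B :: "nat \<Rightarrow> 'a set" and m
  obtain m1 where m1: "\<And>m. m \<ge> m1 \<Longrightarrow> exact K B m"
    using insert.IH[OF Ks Bs BK fdK fgK'] unfolding exact_def by blast
  obtain m2 where m2: "\<And>m. m \<ge> m2 \<Longrightarrow> exact A ?C m"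
    using insert.IH[OF As C CA insert.prems(4) fgC] unfolding exact_def by blast
  have finX: "finite X" "s \<notin> X" "\<And>x. x \<in> X \<Longrightarrow> s < x" if "X \<subseteq> S" for X
    using that insert.hyps(1,2) sS finite_subset by blast+
  have "\<exists>\<eta>. (\<forall>X\<subseteq>?S. \<eta> X \<in> A (m + card X)) \<and> (\<forall>X\<subseteq>?S. \<xi> X - koszul T \<eta> X \<in> B (m + card X))"
    if m: "m \<ge> m1 + m2" and \<xi>: "\<And>X. X \<subseteq> ?S \<Longrightarrow> \<xi> X \<in> A (m + card X)"
      and d\<xi>: "\<And>X. X \<subseteq> ?S \<Longrightarrow> koszul T \<xi> X \<in> B (m + card X)" for m \<xi>
  proof -
    \<comment> \<open>\<open>\<beta>\<close> is the half of \<open>\<xi>\<close> indexed by sets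
      containing \<open>s\<close>, one degree higher. The fact \<open>cone\<close> says that its
      boundary is \<open>T s\<close> of the other half modulo \<open>B\<close>, so
      \<open>\<beta>\<close> is a cycle in the cokernel complex.\<close>
    define \<beta> where "\<beta> = (\<lambda>X. \<xi> (insert s X))"
    have card: "card (insert s X) = Suc (card X)" if "X \<subseteq> S" for X
      using finX[OF that] by simp
    have \<beta>A: "\<beta> X \<in> A (Suc m + card X)" if "X \<subseteq> S" for X
      using \<xi>[of "insert s X"] that card[OF that] by (auto simp: \<beta>_def)
    have cone: "T s (\<xi> X) - koszul T \<beta> X \<in> B (Suc m + card X)" if "X \<subseteq> S" for X
      using d\<xi>[of "insert s X"] that koszul_insert_min[OF finX[OF that], of \<xi>] card[OF that]
      by (auto simp: \<beta>_def)
    have "koszul T \<beta> X \<in> ?C (Suc m + card X)" if X: "X \<subseteq> S" for X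
    proof -
      have "koszul T \<beta> X = T s (\<xi> X) + - (T s (\<xi> X) - koszul T \<beta> X)" by simp
      moreover have "T s (\<xi> X) \<in> shift s A (Suc m + card X)"
        using \<xi>[of X] X by (auto simp: shift_def)
      moreover have "- (T s (\<xi> X) - koszul T \<beta> X) \<in> B (Suc m + card X)"
        using cone[OF X] by (rule B(5))
      ultimately show ?thesis unfolding shift_plus_def by blast
    qed
    then obtain \<gamma> where \<gamma>: "\<And>X. X \<subseteq> S \<Longrightarrow> \<gamma> X \<in> A (Suc m + card X)"
      "\<And>X. X \<subseteq> S \<Longrightarrow> \<beta> X - koszul T \<gamma> X \<in> ?C (Suc m + card X)"
      using m2[of "Suc m"] m \<beta>A unfolding exact_def by (metis le_SucI add_leE)
    have "\<exists>d\<in>A (m + card X). \<beta> X - koszul T \<gamma> X - T s d \<in> B (Suc m + card X)" if X: "X \<subseteq> S" for X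
    proof -
      obtain t b where "\<beta> X - koszul T \<gamma> X = t + b" "t \<in> shift s A (Suc m + card X)" "b \<in> B (Suc m + card X)"
        using \<gamma>(2)[OF X] unfolding shift_plus_def by blast
      then show ?thesis by (force simp: shift_def)
    qed
    then obtain \<delta> where \<delta>: "\<And>X. X \<subseteq> S \<Longrightarrow> \<delta> X \<in> A (m + card X)"
      "\<And>X. X \<subseteq> S \<Longrightarrow> \<beta> X - koszul T \<gamma> X - T s (\<delta> X) \<in> B (Suc m + card X)"
      by metis
    \<comment> \<open>Subtracting the boundary of \<open>\<delta>\<close> moves the other half into
      the kernel \<open>K\<close> of \<open>T s\<close> modulo \<open>B\<close>, where the second
      exactness statement applies.\<close>
    define \<alpha> where "\<alpha> X = \<xi> X - koszul T \<delta> X" for X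
    have k\<delta>: "koszul T \<delta> X \<in> A (m + card X)" if "X \<subseteq> S" for X
      using that \<delta>(1) finX[OF that] by (intro koszul_in[OF As]) auto
    have "\<alpha> X \<in> K (m + card X)" if X: "X \<subseteq> S" for X
    proof -
      have "\<alpha> X \<in> A (m + card X)"
        using \<xi>[of X] k\<delta>[OF X] X A(3) by (auto simp: \<alpha>_def)
      moreover
      have "koszul T (\<lambda>Y. \<beta> Y - koszul T \<gamma> Y - T s (\<delta> Y)) X = koszul T \<beta> X - T s (koszul T \<delta> X)"
        using koszul_koszul[OF finX(1)[OF X], of \<gamma>] by (simp add: koszul_diff koszul_T)
      moreover have "koszul T (\<lambda>Y. \<beta> Y - koszul T \<gamma> Y - T s (\<delta> Y)) X \<in> B (Suc m + card X)"
        using X \<delta>(2) finX[OF X] by (intro koszul_in[OF Bs]) auto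
      ultimately have "koszul T \<beta> X - T s (koszul T \<delta> X) \<in> B (Suc m + card X)"
        by simp
      then have "(T s (\<xi> X) - koszul T \<beta> X) + (koszul T \<beta> X - T s (koszul T \<delta> X)) \<in> B (Suc m + card X)"
        using cone[OF X] by (intro B(2))
      then have "T s (\<alpha> X) \<in> B (Suc (m + card X))"
        by (simp add: \<alpha>_def T_diff)
      then show ?thesis
        using \<open>\<alpha> X \<in> A (m + card X)\<close> by (simp add: K_def)
    qed
    moreover have "koszul T \<alpha> X \<in> B (m + card X)" if X: "X \<subseteq> S" for X
      using koszul_koszul[OF finX(1)[OF X], of \<delta>] d\<xi>[of X] X
      unfolding \<alpha>_def koszul_diff by auto
    ultimately obtain \<epsilon> where \<epsilon>: "\<And>X. X \<subseteq> S \<Longrightarrow> \<epsilon> X \<in> K (m + card X)"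
      "\<And>X. X \<subseteq> S \<Longrightarrow> \<alpha> X - koszul T \<epsilon> X \<in> B (m + card X)"
      using m1[of m] m unfolding exact_def by (metis add_leE)
    \<comment> \<open>The sign in \<open>- \<gamma>\<close> offsets the minus in
      \<open>koszul_insert_min\<close>.\<close>
    define \<eta> where "\<eta> X = (if s \<in> X then - \<gamma> (X - {s}) else \<delta> X + \<epsilon> X)" for X
    have \<eta>1: "\<eta> X = \<delta> X + \<epsilon> X" "\<eta> (insert s X) = - \<gamma> X" if "X \<subseteq> S" for X
      using finX[OF that] by (auto simp: \<eta>_def)
    have k1: "koszul T \<eta> X = koszul T \<delta> X + koszul T \<epsilon> X" if X: "X \<subseteq> S" for X
    proof -
      have "koszul T \<eta> X = koszul T (\<lambda>Y. \<delta> Y + \<epsilon> Y) X"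
        using X by (intro koszul_cong \<eta>1) auto
      then show ?thesis by (simp add: koszul_add)
    qed
    have k2: "koszul T \<eta> (insert s X) = T s (\<delta> X) + T s (\<epsilon> X) + koszul T \<gamma> X" if X: "X \<subseteq> S" for X
    proof -
      have "koszul T (\<lambda>Y. \<eta> (insert s Y)) X = koszul T (\<lambda>Y. - \<gamma> Y) X"
        using X by (intro koszul_cong \<eta>1) auto
      then show ?thesis
        using koszul_insert_min[OF finX[OF X], of \<eta>] \<eta>1(1)[OF X] by (simp add: koszul_minus T_add)
    qed
    have split: "P X" if "X \<subseteq> ?S" "\<And>Y. Y \<subseteq> S \<Longrightarrow> P Y" "\<And>Y. Y \<subseteq> S \<Longrightarrow> P (insert s Y)" for P X
    proof (cases "s \<in> X")
      case True
      then have "X = insert s (X - {s})" "X - {s} \<subseteq> S" using that(1) by auto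
      then show ?thesis using that(3) by metis
    next
      case False
      then show ?thesis using that by blast
    qed
    show ?thesis
    proof (intro exI[of _ \<eta>] conjI allI impI)
      fix X assume X: "X \<subseteq> ?S"
      show "\<eta> X \<in> A (m + card X)"
        using X
      proof (rule split)
        show "\<eta> Y \<in> A (m + card Y)" if Y: "Y \<subseteq> S" for Y
          unfolding \<eta>1(1)[OF Y] using \<delta>(1)[OF Y] \<epsilon>(1)[OF Y] KA A(2) by blast
        show "\<eta> (insert s Y) \<in> A (m + card (insert s Y))" if Y: "Y \<subseteq> S" for Y
          unfolding \<eta>1(2)[OF Y] card[OF Y] using \<gamma>(1)[OF Y] A(5) by simp
      qed
      show "\<xi> X - koszul T \<eta> X \<in> B (m + card X)"
        using X
      proof (rule split)
        show "\<xi> Y - koszul T \<eta> Y \<in> B (m + card Y)" if Y: "Y \<subseteq> S" for Y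
          unfolding k1[OF Y] using \<epsilon>(2)[OF Y] by (simp add: \<alpha>_def diff_diff_add)
        show "\<xi> (insert s Y) - koszul T \<eta> (insert s Y) \<in> B (m + card (insert s Y))" if Y: "Y \<subseteq> S" for Y
        proof -
          have "\<xi> (insert s Y) - koszul T \<eta> (insert s Y) =
              (\<beta> Y - koszul T \<gamma> Y - T s (\<delta> Y)) - T s (\<epsilon> Y)"
            unfolding k2[OF Y] \<beta>_def by simp
          moreover have "T s (\<epsilon> Y) \<in> B (Suc m + card Y)"
            using \<epsilon>(1)[OF Y] by (simp add: K_def)
          ultimately show ?thesis
            using \<delta>(2)[OF Y] B(3) card[OF Y] by simp
        qed
      qed
    qed
  qed
  then show ?case by blast
qed

end

section \<open>Moments of the unit sphere\<close>

lemma finite_measure_sphere_prob: "finite_measure (sphere_prob :: 'a::euclidean_space measure)"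
  by (rule finite_measureI) (simp add: space_sphere_prob emeasure_sphere_prob_sphere)

lemma measure_sphere_prob: "measure (sphere_prob :: 'a::euclidean_space measure) (sphere 0 1) = 1"
  by (simp add: measure_def emeasure_sphere_prob_sphere)

lemma borel_measurable_sphere_prob:
  fixes f :: "'a::euclidean_space \<Rightarrow> 'b::{second_countable_topology,banach}"
  assumes "continuous_on UNIV f"
  shows "f \<in> borel_measurable sphere_prob"
proof -
  have "f \<in> borel_measurable (restrict_space borel (sphere 0 1))"
    using assms by (intro borel_measurable_continuous_on_restrict) (blast intro: continuous_on_subset)
  then show ?thesis
    by (simp cong: measurable_cong_sets add: sets_sphere_prob)
qed

lemma integrable_sphere_prob:
  fixes f :: "'a::euclidean_space \<Rightarrow> 'b::{second_countable_topology,banach}"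
  assumes f: "continuous_on UNIV f"
  shows "integrable sphere_prob f"
proof -
  interpret finite_measure "sphere_prob :: 'a measure"
    by (rule finite_measure_sphere_prob)
  have "bounded (f ` sphere 0 1)"
    by (intro compact_imp_bounded compact_continuous_image continuous_on_subset[OF f]) auto
  then obtain K where "\<And>x. x \<in> sphere 0 1 \<Longrightarrow> norm (f x) \<le> K"
    by (force simp: bounded_iff)
  then have "AE x in sphere_prob. norm (f x) \<le> K"
    by (intro AE_I2) (simp add: space_sphere_prob)
  then show ?thesis
    by (intro integrable_const_bound borel_measurable_sphere_prob f)
qed

lemma integral_sphere_prob_orthogonal:
  fixes f :: "complex^'d \<Rightarrow> 'b::{second_countable_topology,banach}" and R :: "complex^'d \<Rightarrow> complex^'d"
  assumes R: "orthogonal_transformation R" and f: "continuous_on UNIV f"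
  shows "(LINT \<zeta>|sphere_prob. f (R \<zeta>)) = (LINT \<zeta>|sphere_prob. f \<zeta>)"
proof -
  have "(LINT \<zeta>|distr sphere_prob sphere_prob R. f \<zeta>) = (LINT \<zeta>|sphere_prob. f (R \<zeta>))"
    by (intro integral_distr sphere_prob_invariant(1)[OF R] borel_measurable_sphere_prob f)
  then show ?thesis
    by (simp add: sphere_prob_invariant(2)[OF R])
qed

section \<open>Monomials on the sphere and their mixed moments\<close>

definition monom_at :: "complex^'d \<Rightarrow> 'd multiset \<Rightarrow> complex"
  where "monom_at \<zeta> A = prod_mset (image_mset (\<lambda>k. \<zeta> $ k) A)"

lemma monom_at_simps [simp]:
  "monom_at \<zeta> {#} = 1" "monom_at \<zeta> (add_mset k A) = \<zeta> $ k * monom_at \<zeta> A"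
  by (simp_all add: monom_at_def)

lemma continuous_on_monom_at [continuous_intros]:
  "continuous_on S f \<Longrightarrow> continuous_on S (\<lambda>x. monom_at (f x) A)"
  by (induction A) (auto intro!: continuous_intros)

definition moment :: "'d::finite multiset \<Rightarrow> 'd multiset \<Rightarrow> complex"
  where "moment A B = (LINT \<zeta>|sphere_prob. monom_at \<zeta> A * cnj (monom_at \<zeta> B))"

lemma continuous_on_moment_integrand:
  "continuous_on UNIV (\<lambda>\<zeta>. monom_at \<zeta> A * cnj (monom_at \<zeta> B))"
  by (intro continuous_intros)

lemma monom_at_scale_coordinates:
  assumes "\<And>i. \<xi> $ i = (if i \<in> I then c else 1) * \<zeta> $ i"
  shows "monom_at \<xi> A = c ^ size (filter_mset (\<lambda>i. i \<in> I) A) * monom_at \<zeta> A"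
  by (induction A) (auto simp: assms)

text \<open>Rotating by \<open>\<mu>\<close> the coordinate \<open>k\<close> in which the
  multiplicities differ multiplies the integrand by \<open>\<mu> powi n = -1\<close>, while the
  integral is invariant.\<close>

lemma moment_neq:
  assumes "A \<noteq> B"
  shows "moment A B = 0"
proof -
  obtain k where k: "count A k \<noteq> count B k"
    using assms by (auto simp: multiset_eq_iff)
  define n where "n = int (count A k) - int (count B k)"
  have n: "n \<noteq> 0" using k by (simp add: n_def)
  define \<mu> where "\<mu> = cis (pi / of_int n)"
  have \<mu>0: "\<mu> \<noteq> 0" and \<mu>c: "cnj \<mu> = inverse \<mu>"
    by (simp_all add: \<mu>_def cis_cnj)
  have \<mu>n: "\<mu> powi n = -1"
    using n by (simp add: \<mu>_def cis_power_int)
  define R where "R \<zeta> = (\<chi> i. (if i \<in> {k} then \<mu> else 1) * \<zeta> $ i)" for \<zeta> :: "complex^'a"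
  have R: "orthogonal_transformation R"
    unfolding orthogonal_transformation
  proof (intro conjI allI)
    show "linear R"
      by (rule linearI) (auto simp: R_def vec_eq_iff algebra_simps)
    show "norm (R \<zeta>) = norm \<zeta>" for \<zeta>
      by (auto simp: R_def norm_vec_def L2_set_def norm_mult \<mu>_def intro!: arg_cong[where f = sqrt] sum.cong)
  qed
  have mR: "monom_at (R \<zeta>) C = \<mu> ^ count C k * monom_at \<zeta> C" for \<zeta> C
    using monom_at_scale_coordinates[of "R \<zeta>" "{k}" \<mu> \<zeta> C]
    by (simp add: R_def filter_eq_replicate_mset)
  have "\<mu> ^ count A k * cnj \<mu> ^ count B k = \<mu> powi n"
    using \<mu>0 by (simp add: \<mu>c n_def power_int_diff power_inverse divide_inverse)
  then have "monom_at (R \<zeta>) A * cnj (monom_at (R \<zeta>) B) = - (monom_at \<zeta> A * cnj (monom_at \<zeta> B))" for \<zeta>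
    using \<mu>n by (simp add: mR algebra_simps)
  then have "- moment A B = moment A B"
    using integral_sphere_prob_orthogonal[OF R continuous_on_moment_integrand, of A B]
    by (simp add: moment_def)
  then show ?thesis by simp
qed

text \<open>First-order expansion in \<open>t\<close>, uniform on the sphere. Being closed under
  products and integrable term by term, it replaces differentiation under the integral sign.\<close>

definition expansion ::
    "(real \<Rightarrow> complex^'d \<Rightarrow> complex) \<Rightarrow> (complex^'d \<Rightarrow> complex) \<Rightarrow> (complex^'d \<Rightarrow> complex) \<Rightarrow> bool"
  where "expansion g g0 g1 \<longleftrightarrow> (\<exists>K\<ge>0. \<forall>\<zeta>\<in>sphere 0 1. norm (g0 \<zeta>) \<le> K \<and> norm (g1 \<zeta>) \<le> K \<and>
    (\<forall>t\<in>{0..1}. norm (g t \<zeta> - g0 \<zeta> - of_real t * g1 \<zeta>) \<le> K * t\<^sup>2))"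

lemma expansion_affine:
  assumes "\<And>\<zeta>. \<zeta> \<in> sphere 0 1 \<Longrightarrow> norm (g0 \<zeta>) \<le> 1" "\<And>\<zeta>. \<zeta> \<in> sphere 0 1 \<Longrightarrow> norm (g1 \<zeta>) \<le> 1"
    "\<And>t \<zeta>. g t \<zeta> = g0 \<zeta> + of_real t * g1 \<zeta>"
  shows "expansion g g0 g1"
  unfolding expansion_def using assms by (intro exI[of _ 1]) simp

lemma expansion_cnj:
  assumes "expansion g g0 g1"
  shows "expansion (\<lambda>t \<zeta>. cnj (g t \<zeta>)) (\<lambda>\<zeta>. cnj (g0 \<zeta>)) (\<lambda>\<zeta>. cnj (g1 \<zeta>))"
proof -
  have "norm (cnj a - cnj b - of_real t * cnj c) = norm (a - b - of_real t * c)" for a b c t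
    by (metis complex_cnj_complex_of_real complex_cnj_diff complex_cnj_mult complex_mod_cnj)
  then show ?thesis
    using assms by (simp add: expansion_def)
qed

lemma expansion_mult:
  assumes "expansion g g0 g1" "expansion h h0 h1"
  shows "expansion (\<lambda>t \<zeta>. g t \<zeta> * h t \<zeta>) (\<lambda>\<zeta>. g0 \<zeta> * h0 \<zeta>) (\<lambda>\<zeta>. g0 \<zeta> * h1 \<zeta> + g1 \<zeta> * h0 \<zeta>)"
proof -
  obtain K where K: "0 \<le> K" "\<And>\<zeta>. \<zeta> \<in> sphere 0 1 \<Longrightarrow> norm (g0 \<zeta>) \<le> K"
    "\<And>\<zeta>. \<zeta> \<in> sphere 0 1 \<Longrightarrow> norm (g1 \<zeta>) \<le> K"
    "\<And>\<zeta> t. \<zeta> \<in> sphere 0 1 \<Longrightarrow> t \<in> {0..1} \<Longrightarrow> norm (g t \<zeta> - g0 \<zeta> - of_real t * g1 \<zeta>) \<le> K * t\<^sup>2"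
    using assms(1) unfolding expansion_def by blast
  obtain L where L: "0 \<le> L" "\<And>\<zeta>. \<zeta> \<in> sphere 0 1 \<Longrightarrow> norm (h0 \<zeta>) \<le> L"
    "\<And>\<zeta>. \<zeta> \<in> sphere 0 1 \<Longrightarrow> norm (h1 \<zeta>) \<le> L"
    "\<And>\<zeta> t. \<zeta> \<in> sphere 0 1 \<Longrightarrow> t \<in> {0..1} \<Longrightarrow> norm (h t \<zeta> - h0 \<zeta> - of_real t * h1 \<zeta>) \<le> L * t\<^sup>2"
    using assms(2) unfolding expansion_def by blast
  show ?thesis
    unfolding expansion_def
  \<comment> \<open>The remainder has one part from \<open>g1 * h1\<close>, three from the bound
    \<open>L + L + L\<close> on \<open>h t\<close> and two from the bound \<open>K + K\<close>: six
    in all.\<close>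
  proof (intro exI[of _ "6 * (K * L)"] conjI ballI)
    fix \<zeta> :: "complex^'a" assume z: "\<zeta> \<in> sphere 0 1"
    have KL: "norm (g0 \<zeta> * h0 \<zeta>) \<le> K * L" "norm (g0 \<zeta> * h1 \<zeta>) \<le> K * L"
      "norm (g1 \<zeta> * h0 \<zeta>) \<le> K * L" "norm (g1 \<zeta> * h1 \<zeta>) \<le> K * L"
      unfolding norm_mult using K L z by (auto intro!: mult_mono)
    have p: "0 \<le> K * L" using K L by simp
    show "norm (g0 \<zeta> * h0 \<zeta>) \<le> 6 * (K * L)" using KL p by linarith
    show "norm (g0 \<zeta> * h1 \<zeta> + g1 \<zeta> * h0 \<zeta>) \<le> 6 * (K * L)"
      using norm_triangle_le[OF add_mono[OF KL(2,3)]] p by linarith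
    fix t :: real assume t: "t \<in> {0..1}"
    define e where "e = g t \<zeta> - g0 \<zeta> - of_real t * g1 \<zeta>"
    define f where "f = h t \<zeta> - h0 \<zeta> - of_real t * h1 \<zeta>"
    have e: "norm e \<le> K * t\<^sup>2" and f: "norm f \<le> L * t\<^sup>2"
      using K(4)[OF z t] L(4)[OF z t] by (auto simp: e_def f_def)
    have t2: "t\<^sup>2 \<le> 1" using t by (simp add: power_le_one)
    have ht: "norm (h t \<zeta>) \<le> L + L + L"
    proof -
      have "h t \<zeta> = h0 \<zeta> + of_real t * h1 \<zeta> + f" by (simp add: f_def)
      moreover have "norm (of_real t * h1 \<zeta>) \<le> L"
        using L(1) L(3)[OF z] t by (auto simp: norm_mult intro: order.trans[OF mult_left_le_one_le])
      moreover have "norm f \<le> L"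
        using f L(1) t2 mult_left_mono[OF t2 L(1)] by simp
      ultimately show ?thesis
        using L(2)[OF z] by (metis add_mono norm_triangle_le)
    qed
    have "g t \<zeta> * h t \<zeta> - g0 \<zeta> * h0 \<zeta> - of_real t * (g0 \<zeta> * h1 \<zeta> + g1 \<zeta> * h0 \<zeta>) =
        of_real (t\<^sup>2) * (g1 \<zeta> * h1 \<zeta>) + e * h t \<zeta> + (g0 \<zeta> + of_real t * g1 \<zeta>) * f"
      by (simp add: e_def f_def algebra_simps power2_eq_square)
    moreover have "norm (of_real (t\<^sup>2) * (g1 \<zeta> * h1 \<zeta>)) \<le> t\<^sup>2 * (K * L)"
      unfolding norm_mult[of "of_real (t\<^sup>2)"] norm_of_real using KL(4) by (simp add: mult_left_mono)
    moreover have "norm (e * h t \<zeta>) \<le> (K * t\<^sup>2) * (L + L + L)"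
      unfolding norm_mult using e ht K(1) by (intro mult_mono) auto
    moreover have "norm ((g0 \<zeta> + of_real t * g1 \<zeta>) * f) \<le> (K + K) * (L * t\<^sup>2)"
    proof -
      have "norm (of_real t * g1 \<zeta>) \<le> K"
        using K(1) K(3)[OF z] t by (auto simp: norm_mult intro: order.trans[OF mult_left_le_one_le])
      then have "norm (g0 \<zeta> + of_real t * g1 \<zeta>) \<le> K + K"
        using K(2)[OF z] by (intro norm_triangle_le add_mono)
      then show ?thesis
        unfolding norm_mult using f K(1) by (intro mult_mono) auto
    qed
    ultimately have "norm (g t \<zeta> * h t \<zeta> - g0 \<zeta> * h0 \<zeta> - of_real t * (g0 \<zeta> * h1 \<zeta> + g1 \<zeta> * h0 \<zeta>)) \<le>
        t\<^sup>2 * (K * L) + (K * t\<^sup>2) * (L + L + L) + (K + K) * (L * t\<^sup>2)"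
      by (metis (no_types, lifting) add_mono norm_triangle_le)
    also have "\<dots> = 6 * (K * L) * t\<^sup>2"
      by (simp add: algebra_simps)
    finally show "norm (g t \<zeta> * h t \<zeta> - g0 \<zeta> * h0 \<zeta> - of_real t * (g0 \<zeta> * h1 \<zeta> + g1 \<zeta> * h0 \<zeta>))
        \<le> 6 * (K * L) * t\<^sup>2" .
  qed (use K(1) L(1) in auto)
qed

text \<open>Integrating the expansion bounds \<open>t\<close> times the integral by a multiple of
  \<open>t\<^sup>2\<close>; divide by \<open>t\<close> and let it tend to \<open>0\<close>.\<close>

lemma expansion_integral_0:
  fixes g :: "real \<Rightarrow> complex^'d \<Rightarrow> complex"
  assumes ex: "expansion g g0 g1"
    and cont: "\<And>t. continuous_on UNIV (g t)" "continuous_on UNIV g0" "continuous_on UNIV g1"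
    and int0: "\<And>t. (LINT \<zeta>|sphere_prob. g t \<zeta>) = 0" "(LINT \<zeta>|sphere_prob. g0 \<zeta>) = 0"
  shows "(LINT \<zeta>|sphere_prob. g1 \<zeta>) = 0"
proof -
  interpret finite_measure "sphere_prob :: (complex^'d) measure"
    by (rule finite_measure_sphere_prob)
  obtain K where K: "0 \<le> K" "\<And>\<zeta> t. \<zeta> \<in> sphere 0 1 \<Longrightarrow> t \<in> {0..1} \<Longrightarrow>
      norm (g t \<zeta> - g0 \<zeta> - of_real t * g1 \<zeta>) \<le> K * t\<^sup>2"
    using ex unfolding expansion_def by blast
  define I where "I = (LINT \<zeta>|sphere_prob. g1 \<zeta>)"
  note int = cont[THEN integrable_sphere_prob]
  have "norm I \<le> K * t" if t: "0 < t" "t \<le> 1" for t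
  proof -
    have "(LINT \<zeta>|sphere_prob. g t \<zeta> - g0 \<zeta> - of_real t * g1 \<zeta>) = - (of_real t * I)"
      using int by (simp add: int0 I_def)
    then have "t * norm I = norm (LINT \<zeta>|sphere_prob. g t \<zeta> - g0 \<zeta> - of_real t * g1 \<zeta>)"
      using t by (simp add: norm_mult)
    also have "\<dots> \<le> (LINT \<zeta>|(sphere_prob :: (complex^'d) measure). K * t\<^sup>2)"
      using K t int by (intro Bochner_Integration.integral_norm_bound_integral) (auto simp: space_sphere_prob)
    also have "\<dots> = K * t\<^sup>2"
      using measure_sphere_prob[where 'a = "complex^'d"] by (simp add: space_sphere_prob)
    finally have "t * norm I \<le> t * (K * t)"
      by (simp add: power2_eq_square mult_ac)
    then show ?thesis
      using t by simp
  qed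
  note bd = this
  have "norm I \<le> 0"
  proof (rule field_le_epsilon)
    fix e :: real assume e: "0 < e"
    define t where "t = min 1 (e / (K + 1))"
    have t: "0 < t" "t \<le> 1" "t \<le> e / (K + 1)" using K e by (auto simp: t_def)
    have "K * t \<le> (K + 1) * (e / (K + 1))"
      using t K by (intro mult_mono) auto
    also have "\<dots> = e" using K by simp
    finally show "norm I \<le> 0 + e" using bd[OF t(1,2)] by simp
  qed
  then show ?thesis by (simp add: I_def)
qed

text \<open>The infinitesimal rotation in the \<open>j\<close>-\<open>k\<close> plane, acting on monomials as a derivation.\<close>

definition rot_deriv :: "'d \<Rightarrow> 'd \<Rightarrow> complex^'d \<Rightarrow> 'd multiset \<Rightarrow> complex"
  where "rot_deriv j k \<zeta> A = of_nat (count A j) * (\<zeta> $ k * monom_at \<zeta> (A - {#j#}))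
    - of_nat (count A k) * (\<zeta> $ j * monom_at \<zeta> (A - {#k#}))"

lemma count_mult_monom_at: "of_nat (count A j) * (\<zeta> $ j * monom_at \<zeta> (A - {#j#})) = of_nat (count A j) * monom_at \<zeta> A"
proof (cases "j \<in># A")
  case True
  then show ?thesis
    by (metis insert_DiffM monom_at_simps(2))
qed (simp add: not_in_iff)

lemma count_mult_monom_at_add:
  assumes "i \<noteq> j"
  shows "of_nat (count A j) * monom_at \<zeta> (add_mset i A - {#j#}) =
    of_nat (count A j) * (\<zeta> $ i * monom_at \<zeta> (A - {#j#}))"
proof (cases "j \<in># A")
  case True
  then have "add_mset i A - {#j#} = add_mset i (A - {#j#})"
    using assms by simp
  then show ?thesis by simp
qed (simp add: not_in_iff)

text \<open>Leibniz rule. The multiplicities as factors make the derivation meaningful also when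
  \<open>j\<close> or \<open>k\<close> does not occur in \<open>A\<close>: truncated subtraction is
  then multiplied by zero.\<close>

lemma rot_deriv_add:
  assumes "j \<noteq> k"
  shows "rot_deriv j k \<zeta> (add_mset i A) =
    \<zeta> $ i * rot_deriv j k \<zeta> A + (if i = j then \<zeta> $ k else if i = k then - \<zeta> $ j else 0) * monom_at \<zeta> A"
proof -
  note a = count_mult_monom_at_add[of i j A \<zeta>] count_mult_monom_at_add[of i k A \<zeta>]
  note b = count_mult_monom_at[of A j \<zeta>] count_mult_monom_at[of A k \<zeta>]
  have plus: "(c + 1) * (y * M) - d * (x * X) = x * (c * (y * m) - d * (x * n)) + y * M"
    if "c * (x * m) = c * M" "d * X = d * (x * n)" for c d x y m n M X :: complex
    using that by algebra
  have minus: "d * (y * X) - (c + 1) * (x * M) = y * (d * (y * n) - c * (x * m)) + (- x) * M"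
    if "c * (y * m) = c * M" "d * X = d * (y * n)" for c d x y m n M X :: complex
    using that by algebra
  consider "i = j" | "i = k" | "i \<noteq> j" "i \<noteq> k" by blast
  then show ?thesis
  proof cases
    case 1
    then show ?thesis
      using 1 plus[OF b(1) count_mult_monom_at_add[OF assms, of A \<zeta>], of "\<zeta> $ k"] assms by (simp add: rot_deriv_def add.commute)
  next
    case 2
    then show ?thesis
      using 2 minus[OF b(2) count_mult_monom_at_add[OF assms[symmetric], of A \<zeta>], of "\<zeta> $ j"] assms by (simp add: rot_deriv_def add.commute)
  next
    case 3
    then show ?thesis
      using a by (simp add: rot_deriv_def algebra_simps)
  qed
qed

lemma norm_component_le_1: "\<zeta> \<in> sphere 0 1 \<Longrightarrow> norm (\<zeta> $ i) \<le> 1"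
  for \<zeta> :: "complex^'d"
  using Finite_Cartesian_Product.norm_nth_le[of \<zeta> i] by simp

text \<open>A rotation in the \<open>j\<close>-\<open>k\<close> plane up to the factor
  \<open>sqrt (1 + t\<^sup>2)\<close>. Leaving out the normalization makes it affine in
  \<open>t\<close>, so each coordinate has an exact expansion.\<close>

definition shear :: "'d::finite \<Rightarrow> 'd \<Rightarrow> real \<Rightarrow> complex^'d \<Rightarrow> complex^'d"
  where "shear j k t \<zeta> = (\<chi> i. if i = j then \<zeta> $ j + of_real t * \<zeta> $ k
    else if i = k then \<zeta> $ k - of_real t * \<zeta> $ j else \<zeta> $ i)"

lemma expansion_monom_at_shear:
  assumes "j \<noteq> k"
  shows "expansion (\<lambda>t \<zeta>. monom_at (shear j k t \<zeta>) A) (\<lambda>\<zeta>. monom_at \<zeta> A) (\<lambda>\<zeta>. rot_deriv j k \<zeta> A)"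
proof (induction A)
  case empty
  show ?case by (rule expansion_affine) (auto simp: rot_deriv_def)
next
  case (add i A)
  have "expansion (\<lambda>t \<zeta>. shear j k t \<zeta> $ i) (\<lambda>\<zeta>. \<zeta> $ i)
      (\<lambda>\<zeta>. if i = j then \<zeta> $ k else if i = k then - \<zeta> $ j else 0)"
    by (rule expansion_affine) (auto simp: shear_def norm_component_le_1)
  from expansion_mult[OF this add] show ?case
    using assms by (simp add: rot_deriv_add)
qed

text \<open>Dividing the two coordinates by \<open>r\<close> gives an orthogonal map
  \<open>R\<close>; the monomials change by constant factors, so the vanishing of the mixed moment
  carries over.\<close>

lemma moment_shear:
  assumes jk: "j \<noteq> k" and AB: "A \<noteq> B"
  shows "(LINT \<zeta>|sphere_prob. monom_at (shear j k t \<zeta>) A * cnj (monom_at (shear j k t \<zeta>) B)) = 0"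
proof -
  define r where "r = sqrt (1 + t\<^sup>2)"
  have r: "r > 0" "r\<^sup>2 = 1 + t\<^sup>2" by (auto simp: r_def add_pos_nonneg)
  define R where "R \<zeta> = (\<chi> i. (if i \<in> {j, k} then of_real (1 / r) else 1) * shear j k t \<zeta> $ i)"
    for \<zeta> :: "complex^'a"
  have R: "orthogonal_transformation R"
    unfolding orthogonal_transformation
  proof (intro conjI allI)
    show "linear R"
      by (rule linearI) (auto simp: R_def shear_def vec_eq_iff scaleR_conv_of_real[where 'a = complex]
          algebra_simps add_divide_distrib)
    show "norm (R \<zeta>) = norm \<zeta>" for \<zeta>
    proof -
      have split: "(\<Sum>i\<in>UNIV. f i) = f j + f k + (\<Sum>i\<in>UNIV - {j,k}. f i)" for f :: "'a \<Rightarrow> real"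
        using jk by (subst sum.remove[of _ j], simp, simp, subst sum.remove[of _ k])
          (auto simp: Diff_insert2[symmetric] insert_commute)
      have "(norm (R \<zeta> $ j))\<^sup>2 + (norm (R \<zeta> $ k))\<^sup>2 =
          ((norm (\<zeta> $ j + of_real t * \<zeta> $ k))\<^sup>2 + (norm (\<zeta> $ k - of_real t * \<zeta> $ j))\<^sup>2) / r\<^sup>2"
      proof -
        have "(norm (R \<zeta> $ j))\<^sup>2 = (norm (\<zeta> $ j + of_real t * \<zeta> $ k))\<^sup>2 / r\<^sup>2"
          "(norm (R \<zeta> $ k))\<^sup>2 = (norm (\<zeta> $ k - of_real t * \<zeta> $ j))\<^sup>2 / r\<^sup>2"
          using jk r(1) by (simp_all add: R_def shear_def norm_divide power_divide)
        then show ?thesis by (simp only: add_divide_distrib)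
      qed
      also have "(norm (\<zeta> $ j + of_real t * \<zeta> $ k))\<^sup>2 + (norm (\<zeta> $ k - of_real t * \<zeta> $ j))\<^sup>2 =
          (1 + t\<^sup>2) * ((norm (\<zeta> $ j))\<^sup>2 + (norm (\<zeta> $ k))\<^sup>2)"
        unfolding cmod_power2 by (simp add: algebra_simps power2_eq_square)
      also have "\<dots> / r\<^sup>2 = (norm (\<zeta> $ j))\<^sup>2 + (norm (\<zeta> $ k))\<^sup>2"
        unfolding r(2)[symmetric] using r(1) by simp
      finally have "(\<Sum>i\<in>UNIV. (norm (R \<zeta> $ i))\<^sup>2) = (\<Sum>i\<in>UNIV. (norm (\<zeta> $ i))\<^sup>2)"
        unfolding split[of "\<lambda>i. (norm (R \<zeta> $ i))\<^sup>2"] split[of "\<lambda>i. (norm (\<zeta> $ i))\<^sup>2"]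
        by (auto simp: R_def shear_def intro!: sum.cong)
      then show ?thesis
        by (simp add: norm_vec_def L2_set_def)
    qed
  qed
  have "shear j k t \<zeta> $ i = (if i \<in> {j,k} then of_real r else 1) * R \<zeta> $ i" for i \<zeta>
    using r by (auto simp: R_def)
  note mR = monom_at_scale_coordinates[OF this]
  obtain c where c: "monom_at (shear j k t \<zeta>) A * cnj (monom_at (shear j k t \<zeta>) B) =
      c * (monom_at (R \<zeta>) A * cnj (monom_at (R \<zeta>) B))" for \<zeta>
  proof
    show "monom_at (shear j k t \<zeta>) A * cnj (monom_at (shear j k t \<zeta>) B) =
      (of_real r ^ size (filter_mset (\<lambda>i. i \<in> {j, k}) A) * of_real r ^ size (filter_mset (\<lambda>i. i \<in> {j, k}) B)) *
      (monom_at (R \<zeta>) A * cnj (monom_at (R \<zeta>) B))" for \<zeta>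
      by (simp add: mR mult_ac)
  qed
  show ?thesis
    unfolding c using moment_neq[OF AB]
      integral_sphere_prob_orthogonal[OF R continuous_on_moment_integrand, of A B]
    by (simp add: moment_def)
qed

text \<open>The mixed moment of \<open>add_mset j V\<close> and \<open>add_mset k V\<close> vanishes
  along the whole rotation, hence so does its first-order term. That term consists of four moments,
  of which two pair distinct multisets and drop out.\<close>

lemma moment_exchange:
  assumes jk: "j \<noteq> k"
  shows "of_nat (count V j + 1) * moment (add_mset k V) (add_mset k V) =
    of_nat (count V k + 1) * moment (add_mset j V) (add_mset j V)"
proof -
  let ?A = "add_mset j V" and ?B = "add_mset k V"
  have AB: "?A \<noteq> ?B" using jk by simp
  define g1 where "g1 \<zeta> = monom_at \<zeta> ?A * cnj (rot_deriv j k \<zeta> ?B) + rot_deriv j k \<zeta> ?A * cnj (monom_at \<zeta> ?B)" for \<zeta>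
  have ex: "expansion (\<lambda>t \<zeta>. monom_at (shear j k t \<zeta>) ?A * cnj (monom_at (shear j k t \<zeta>) ?B))
      (\<lambda>\<zeta>. monom_at \<zeta> ?A * cnj (monom_at \<zeta> ?B)) g1"
    unfolding g1_def using expansion_monom_at_shear[OF jk] by (intro expansion_mult expansion_cnj)
  have cs: "continuous_on UNIV (shear j k t)" for t
  proof -
    have "linear (shear j k t)"
      by (rule linearI) (auto simp: shear_def vec_eq_iff scaleR_conv_of_real[where 'a = complex] algebra_simps)
    then show ?thesis
      by (intro linear_continuous_on linear_linear[THEN iffD2])
  qed
  have cd: "continuous_on UNIV (\<lambda>\<zeta>. rot_deriv j k \<zeta> A)" for A :: "'a multiset"
    unfolding rot_deriv_def by (intro continuous_intros)
  have "(LINT \<zeta>|sphere_prob. g1 \<zeta>) = 0"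
  proof (rule expansion_integral_0[OF ex])
    show "(LINT \<zeta>|sphere_prob. monom_at (shear j k t \<zeta>) ?A * cnj (monom_at (shear j k t \<zeta>) ?B)) = 0" for t
      by (rule moment_shear[OF jk AB])
    show "(LINT \<zeta>|sphere_prob. monom_at \<zeta> ?A * cnj (monom_at \<zeta> ?B)) = 0"
      using moment_neq[OF AB] by (simp add: moment_def)
  qed (auto simp: g1_def[abs_def] intro!: continuous_intros cs cd)
  define P where "P A B \<zeta> = monom_at \<zeta> A * cnj (monom_at \<zeta> B)" for A B and \<zeta> :: "complex^'a"
  have Pint: "integrable sphere_prob (P A B)" for A B
    unfolding P_def by (intro integrable_sphere_prob continuous_on_moment_integrand)
  have PM: "(LINT \<zeta>|sphere_prob. P A B \<zeta>) = moment A B" for A B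
    by (simp add: P_def moment_def)
  have g1P: "g1 \<zeta> = of_nat (count V j) * P ?A (add_mset k (?B - {#j#})) \<zeta>
      - of_nat (count V k + 1) * P ?A ?A \<zeta>
      + of_nat (count V j + 1) * P ?B ?B \<zeta>
      - of_nat (count V k) * P (add_mset j (?A - {#k#})) ?B \<zeta>" for \<zeta>
    using jk by (simp add: g1_def P_def rot_deriv_def algebra_simps)
  have "(LINT \<zeta>|sphere_prob. g1 \<zeta>) = of_nat (count V j) * moment ?A (add_mset k (?B - {#j#}))
      - of_nat (count V k + 1) * moment ?A ?A + of_nat (count V j + 1) * moment ?B ?B
      - of_nat (count V k) * moment (add_mset j (?A - {#k#})) ?B"
    unfolding g1P using Pint by (simp add: PM)
  moreover have "of_nat (count V j) * moment ?A (add_mset k (?B - {#j#})) = 0"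
  proof -
    have "count ?A j \<noteq> count (add_mset k (?B - {#j#})) j"
      using jk by simp
    then have "?A \<noteq> add_mset k (?B - {#j#})" by metis
    then show ?thesis by (simp add: moment_neq)
  qed
  moreover have "of_nat (count V k) * moment (add_mset j (?A - {#k#})) ?B = 0"
  proof -
    have "count ?B k \<noteq> count (add_mset j (?A - {#k#})) k"
      using jk by simp
    then have "add_mset j (?A - {#k#}) \<noteq> ?B" by metis
    then show ?thesis by (simp add: moment_neq)
  qed
  ultimately show ?thesis
    using \<open>(LINT \<zeta>|sphere_prob. g1 \<zeta>) = 0\<close> by simp
qed

section \<open>Words, multisets and the diagonal moments\<close>

definition words :: "nat \<Rightarrow> 'd list set"
  where "words n = {w. length w = n}"

lemma finite_words [simp]: "finite (words n :: 'd::finite list set)"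
  using finite_lists_length_eq[of "UNIV :: 'd set" n] by (simp add: words_def)

lemma words_0: "words 0 = {[]}"
  by (auto simp: words_def)

lemma sum_words_Suc:
  "(\<Sum>w\<in>words (Suc n). f w) = (\<Sum>k\<in>(UNIV :: 'd::finite set). \<Sum>w\<in>words n. f (k # w))"
proof -
  have "words (Suc n) = (\<lambda>(k, w). k # w) ` (UNIV \<times> (words n :: 'd list set))"
    by (auto simp: words_def image_iff length_Suc_conv)
  then have "(\<Sum>w\<in>words (Suc n). f w) = (\<Sum>(k, w)\<in>(UNIV :: 'd set) \<times> words n. f (k # w))"
    by (simp only:) (subst sum.reindex, auto simp: inj_on_def intro!: sum.cong)
  then show ?thesis
    by (simp add: sum.cartesian_product)
qed

lemma sum_words_mset:
  fixes g :: "'d::finite multiset \<Rightarrow> 'b::comm_semiring_1"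
  shows "(\<Sum>w\<in>words n. g (mset w)) =
    (\<Sum>A\<in>multisets_of_size (UNIV :: 'd::finite set) n. of_nat (card (permutations_of_multiset A)) * g A)"
proof -
  have im: "mset ` words n \<subseteq> multisets_of_size (UNIV :: 'd set) n"
    by (auto simp: words_def multisets_of_size_def)
  have fib: "{w \<in> words n. mset w = A} = permutations_of_multiset A"
    if "A \<in> multisets_of_size (UNIV :: 'd set) n" for A
    using that by (auto simp: words_def multisets_of_size_def permutations_of_multiset_def)
  have "(\<Sum>w\<in>words n. g (mset w)) = (\<Sum>A\<in>multisets_of_size (UNIV :: 'd set) n.
      \<Sum>w\<in>{w \<in> words n. mset w = A}. g (mset w))"
    by (rule sum.group[symmetric]) (use im in auto)
  also have "\<dots> = (\<Sum>A\<in>multisets_of_size (UNIV :: 'd set) n. of_nat (card (permutations_of_multiset A)) * g A)"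
  proof (intro sum.cong refl)
    fix A :: "'d multiset" assume A: "A \<in> multisets_of_size UNIV n"
    have "(\<Sum>w\<in>{w \<in> words n. mset w = A}. g (mset w)) = (\<Sum>w\<in>{w \<in> words n. mset w = A}. g A)"
      by (rule sum.cong) auto
    then show "(\<Sum>w\<in>{w \<in> words n. mset w = A}. g (mset w)) =
        of_nat (card (permutations_of_multiset A)) * g A"
      using fib[OF A] by simp
  qed
  finally show ?thesis .
qed

text \<open>The integrands add up to the \<open>n\<close>-th power of the squared norm of
  \<open>\<zeta>\<close>, expanded over words; on the sphere this is \<open>1\<close>.\<close>

lemma sum_words_moment: "(\<Sum>w\<in>(words n :: 'd::finite list set). moment (mset w) (mset w)) = 1"
proof -
  have int: "integrable sphere_prob (\<lambda>\<zeta>. monom_at \<zeta> A * cnj (monom_at \<zeta> A))" for A :: "'d multiset"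
    by (intro integrable_sphere_prob continuous_on_moment_integrand)
  have pw: "(\<Sum>w\<in>(words n :: 'd list set). monom_at \<zeta> (mset w) * cnj (monom_at \<zeta> (mset w))) =
      (\<Sum>k\<in>UNIV. \<zeta> $ k * cnj (\<zeta> $ k)) ^ n" for \<zeta> n
  proof (induction n)
    case (Suc n)
    have "(\<Sum>w\<in>(words (Suc n) :: 'd list set). monom_at \<zeta> (mset w) * cnj (monom_at \<zeta> (mset w))) =
      (\<Sum>k\<in>UNIV. (\<zeta> $ k * cnj (\<zeta> $ k)) *
        (\<Sum>w\<in>(words n :: 'd list set). monom_at \<zeta> (mset w) * cnj (monom_at \<zeta> (mset w))))"
      by (simp add: sum_words_Suc sum_distrib_left mult_ac)
    then show ?case
      by (simp add: Suc sum_distrib_right)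
  qed (simp add: words_0)
  have one: "(\<Sum>k\<in>UNIV. \<zeta> $ k * cnj (\<zeta> $ k)) = 1" if "norm \<zeta> = 1" for \<zeta> :: "complex^'d"
  proof -
    have "(\<Sum>k\<in>UNIV. (norm (\<zeta> $ k))\<^sup>2) = 1"
      using that by (simp add: norm_vec_def L2_set_def)
    then have "complex_of_real (\<Sum>k\<in>UNIV. (norm (\<zeta> $ k))\<^sup>2) = 1"
      by (simp only: of_real_1)
    then show ?thesis
      by (simp only: of_real_sum complex_norm_square)
  qed
  have "(\<Sum>w\<in>(words n :: 'd list set). moment (mset w) (mset w)) =
      (LINT \<zeta>|sphere_prob. (\<Sum>w\<in>(words n :: 'd list set). monom_at \<zeta> (mset w) * cnj (monom_at \<zeta> (mset w))))"
    unfolding moment_def using int by (intro Bochner_Integration.integral_sum[symmetric])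
  also have "\<dots> = (LINT \<zeta>|(sphere_prob :: (complex^'d) measure). 1)"
    by (intro Bochner_Integration.integral_cong) (auto simp: pw one space_sphere_prob)
  also have "\<dots> = 1"
    using measure_sphere_prob[where 'a = "complex^'d"] by (simp add: space_sphere_prob)
  finally show ?thesis .
qed

text \<open>By \<open>moment_exchange\<close> the product is the same for all multisets of one size;
  by \<open>sum_words_moment\<close> these values add up to \<open>1\<close>, and the binomial
  coefficient counts the multisets.\<close>

lemma permutations_mult_moment:
  fixes A :: "'d::finite multiset"
  shows "of_nat (card (permutations_of_multiset A)) * moment A A =
    1 / of_nat ((CARD('d) + size A - 1) choose size A)"
proof -
  define q where "q A = of_nat (card (permutations_of_multiset A)) * moment A A" for A :: "'d multiset"
  have q1: "q (add_mset j V) = of_nat (size V + 1) * of_nat (card (permutations_of_multiset V)) *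
      (moment (add_mset j V) (add_mset j V) / of_nat (count V j + 1))" for j V
  proof -
    have "of_nat (card (permutations_of_multiset (add_mset j V))) * of_nat (count V j + 1) =
      (of_nat (size V + 1) * of_nat (card (permutations_of_multiset V)) :: complex)"
    proof -
      have "V + {#j#} = add_mset j V" by simp
      from card_permutations_of_multiset_insert_aux[of V j, unfolded this] show ?thesis
        by (simp only: of_nat_mult[symmetric])
    qed
    moreover have "of_nat (count V j + 1) \<noteq> (0::complex)"
      by (simp only: of_nat_eq_0_iff)
    moreover have "p * m = s * (m / c)" if "p * c = s" "c \<noteq> 0" for p c s m :: complex
      using that by auto
    ultimately show ?thesis
      unfolding q_def by blast
  qed
  have q2: "q (add_mset j V) = q (add_mset k V)" for j k V
  proof (cases "j = k")
    case False
    have nz: "of_nat (count V i + 1) \<noteq> (0::complex)" for i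
      by (simp only: of_nat_eq_0_iff)
    have "moment (add_mset j V) (add_mset j V) / of_nat (count V j + 1) =
        moment (add_mset k V) (add_mset k V) / of_nat (count V k + 1)"
      unfolding frac_eq_eq[OF nz nz] using moment_exchange[OF False, of V] by (simp only: mult.commute)
    then show ?thesis by (simp only: q1)
  qed simp
  \<comment> \<open>An arbitrary reference index: exchanging elements for \<open>k0\<close> one by
    one reduces every multiset to copies of \<open>k0\<close>.\<close>
  fix k0 :: 'd
  have q3: "q (A + replicate_mset n k0) = q (replicate_mset (size A + n) k0)" for A n
  proof (induction A arbitrary: n)
    case (add a A)
    have "q (add_mset a A + replicate_mset n k0) = q (A + replicate_mset (Suc n) k0)"
      using q2[of a "A + replicate_mset n k0" k0] by simp
    then show ?case using add.IH[of "Suc n"] by simp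
  qed simp
  have q4: "q B = q A" if "size B = size A" for B
    using q3[of A 0] q3[of B 0] that by simp
  let ?M = "multisets_of_size (UNIV :: 'd set) (size A)"
  have "1 = (\<Sum>B\<in>?M. q B)"
    using sum_words_moment[where 'd = 'd and n = "size A"] sum_words_mset[of "\<lambda>B :: 'd multiset. moment B B" "size A"]
    by (simp add: q_def)
  also have "\<dots> = (\<Sum>B\<in>?M. q A)"
    by (intro sum.cong refl q4) (simp add: multisets_of_size_def)
  also have "\<dots> = of_nat ((CARD('d) + size A - 1) choose size A) * q A"
    by (simp add: card_multisets_of_size)
  finally have "of_nat ((CARD('d) + size A - 1) choose size A) * q A = 1" by (rule sym)
  moreover have "q = 1 / N" if "N * q = 1" for N q :: complex
    using that by (cases "N = 0") (auto simp: field_simps)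
  ultimately show ?thesis
    unfolding q_def by blast
qed

text \<open>Monomials with different multisets are orthogonal on the sphere. For a given word
  \<open>w\<close>, the words with the same multiset contribute multiplicity times moment, which is
  \<open>1 / N\<close> for every \<open>w\<close>.\<close>

theorem integral_norm_homogeneous:
  fixes y :: "'d::finite multiset \<Rightarrow> 'h::complex_hilbert_space" and n :: nat
  defines "N \<equiv> (CARD('d) + n - 1) choose n"
  shows "(LINT \<zeta>|sphere_prob. (norm (\<Sum>w\<in>words n. cnj (monom_at \<zeta> (mset w)) *\<^sub>C y (mset w)))\<^sup>2) =
    (\<Sum>w\<in>words n. (norm (y (mset w)))\<^sup>2) / real N"
    and "continuous_on UNIV (\<lambda>\<zeta>. (norm (\<Sum>w\<in>words n. cnj (monom_at \<zeta> (mset w)) *\<^sub>C y (mset w)))\<^sup>2)"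
proof -
  define W where "W = (words n :: 'd list set)"
  define P where "P A B \<zeta> = monom_at \<zeta> A * cnj (monom_at \<zeta> B)" for A B and \<zeta> :: "complex^'d"
  have Pint: "integrable sphere_prob (P A B)" for A B
    unfolding P_def by (intro integrable_sphere_prob continuous_on_moment_integrand)
  have PM: "(LINT \<zeta>|sphere_prob. P A B \<zeta>) = moment A B" for A B
    by (simp add: P_def moment_def)
  define f where "f \<zeta> = (norm (\<Sum>w\<in>W. cnj (monom_at \<zeta> (mset w)) *\<^sub>C y (mset w)))\<^sup>2" for \<zeta>
  have f: "complex_of_real (f \<zeta>) = (\<Sum>w\<in>W. \<Sum>v\<in>W. cinner (y (mset w)) (y (mset v)) * P (mset v) (mset w) \<zeta>)" for \<zeta>
    unfolding f_def cinner_same[symmetric] cinner_sum_left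
    unfolding cinner_sum_right cinner_simps P_def by (simp add: mult_ac)
  have fR: "f \<zeta> = Re (\<Sum>w\<in>W. \<Sum>v\<in>W. cinner (y (mset w)) (y (mset v)) * P (mset v) (mset w) \<zeta>)" for \<zeta>
    by (metis f Re_complex_of_real)
  show "continuous_on UNIV (\<lambda>\<zeta>. (norm (\<Sum>w\<in>words n. cnj (monom_at \<zeta> (mset w)) *\<^sub>C y (mset w)))\<^sup>2)"
    unfolding W_def[symmetric] f_def[symmetric] fR P_def by (intro continuous_intros)
  have "complex_of_real (LINT \<zeta>|sphere_prob. f \<zeta>) = (LINT \<zeta>|sphere_prob. complex_of_real (f \<zeta>))"
    by simp
  also have "\<dots> = (\<Sum>w\<in>W. \<Sum>v\<in>W. cinner (y (mset w)) (y (mset v)) * moment (mset v) (mset w))"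
    unfolding f using Pint by (simp add: Bochner_Integration.integral_sum PM)
  also have "\<dots> = (\<Sum>w\<in>W. complex_of_real ((norm (y (mset w)))\<^sup>2 / real N))"
  proof (rule sum.cong)
    fix w assume w: "w \<in> W"
    have fib: "{v\<in>W. mset v = mset w} = permutations_of_multiset (mset w)"
      using w by (auto simp: W_def words_def permutations_of_multiset_def dest: mset_eq_length)
    have "(\<Sum>v\<in>W. cinner (y (mset w)) (y (mset v)) * moment (mset v) (mset w)) =
        (\<Sum>v\<in>{v\<in>W. mset v = mset w}. cinner (y (mset w)) (y (mset v)) * moment (mset v) (mset w))"
      by (rule sum.mono_neutral_right) (auto simp: W_def moment_neq)
    also have "\<dots> = (\<Sum>v\<in>{v\<in>W. mset v = mset w}. cinner (y (mset w)) (y (mset w)) * moment (mset w) (mset w))"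
      by (rule sum.cong) auto
    also have "\<dots> = cinner (y (mset w)) (y (mset w)) * (of_nat (card (permutations_of_multiset (mset w))) * moment (mset w) (mset w))"
      by (simp add: fib)
    also have "\<dots> = complex_of_real ((norm (y (mset w)))\<^sup>2 / real N)"
      using w unfolding permutations_mult_moment by (simp add: cinner_same N_def W_def words_def)
    finally show "(\<Sum>v\<in>W. cinner (y (mset w)) (y (mset v)) * moment (mset v) (mset w)) =
      complex_of_real ((norm (y (mset w)))\<^sup>2 / real N)" .
  qed simp
  also have "\<dots> = complex_of_real ((\<Sum>w\<in>W. (norm (y (mset w)))\<^sup>2) / real N)"
    by (simp only: of_real_sum[symmetric] sum_divide_distrib)
  finally have "(LINT \<zeta>|sphere_prob. f \<zeta>) = (\<Sum>w\<in>W. (norm (y (mset w)))\<^sup>2) / real N"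
    by (simp only: of_real_eq_iff)
  then show "(LINT \<zeta>|sphere_prob. (norm (\<Sum>w\<in>words n. cnj (monom_at \<zeta> (mset w)) *\<^sub>C y (mset w)))\<^sup>2) =
    (\<Sum>w\<in>words n. (norm (y (mset w)))\<^sup>2) / real N"
    by (simp add: f_def W_def)
qed

section \<open>Fourier coefficients\<close>

lemma integral_periodic_shift:
  fixes f :: "real \<Rightarrow> 'a::banach"
  assumes f: "continuous_on UNIV f" and per: "\<And>t. f (t + p) = f t" and c: "0 \<le> c" "c \<le> p"
  shows "integral {0..p} (\<lambda>t. f (t + c)) = integral {0..p} f"
proof -
  have int: "f integrable_on {a..b}" for a b
    by (intro integrable_continuous_real continuous_on_subset[OF f]) auto
  have sh: "integral {a..b} (\<lambda>t. f (t + e)) = integral {a + e..b + e} f" for a b e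
    using integral_shift_Icc_real[of a b f e] by (simp add: o_def add.commute)
  have "integral {0..p} (\<lambda>t. f (t + c)) = integral {c..p + c} f"
    using sh[of 0 p c] by simp
  also have "\<dots> = integral {c..p} f + integral {p..p + c} f"
    using c int by (intro Henstock_Kurzweil_Integration.integral_combine[symmetric]) auto
  also have "integral {p..p + c} f = integral {0..c} f"
    using sh[of 0 c p] by (simp add: per add.commute)
  also have "integral {c..p} f + integral {0..c} f = integral {0..p} f"
    using c int Henstock_Kurzweil_Integration.integral_combine[of 0 c p f] by (simp add: add.commute)
  finally show ?thesis .
qed

lemma continuous_on_polynomial_cis:
  assumes "real_polynomial_function p"
  shows "continuous_on S (\<lambda>t. p (cis t))"
proof -
  have "continuous_on UNIV p"
    using assms continuous_on_polymonial_function by (simp add: real_polynomial_function_eq)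
  then show ?thesis
    by (rule continuous_on_compose2) (auto intro!: continuous_intros)
qed

text \<open>Multiplication by a polynomial in \<open>cos t\<close>, \<open>sin t\<close> preserves the vanishing of all Fourier
  coefficients; approximate \<open>cnj \<circ> f\<close> by such polynomials.\<close>

lemma fourier_coeffs_0_polynomial:
  fixes f :: "real \<Rightarrow> complex" and p :: "complex \<Rightarrow> real"
  assumes p: "real_polynomial_function p" and f: "continuous_on UNIV f"
    and 0: "\<And>n :: int. integral {0..2*pi} (\<lambda>t. cis (of_int n * t) * f t) = 0"
  shows "integral {0..2*pi} (\<lambda>t. cis (of_int n * t) * (of_real (p (cis t)) * f t)) = 0"
  using p f 0
proof (induction p arbitrary: f n)
  case (linear p)
  have lin: "linear p" using linear(1) by (simp add: bounded_linear.linear)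
  have int: "(\<lambda>t. cis (of_int k * t) * f t) integrable_on {0..2*pi}" for k :: int
    by (intro integrable_continuous_real continuous_intros continuous_on_subset[OF linear.prems(1)]) auto
  have pc: "p (cis t) = cos t * p 1 + sin t * p \<i>" for t
  proof -
    have "p (cis t) = p (cos t *\<^sub>R 1 + sin t *\<^sub>R \<i>)"
      by (rule arg_cong[where f = p]) (simp add: complex_eq_iff)
    then show ?thesis
      by (simp only: linear_add[OF lin] linear_scale[OF lin]) simp
  qed
  \<comment> \<open>Euler's formulas: a real-linear function on the circle is a combination of
    \<open>cis t\<close> and \<open>cis (- t)\<close>, so multiplying by it shifts frequencies by
    one.\<close>
  define a b where "a = of_real (p 1) / 2 - \<i> * of_real (p \<i>) / 2"
    and "b = of_real (p 1) / 2 + \<i> * of_real (p \<i>) / 2"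
  have "of_real (p (cis t)) = a * cis t + b * cis (- t)" for t
    by (simp add: pc a_def b_def complex_eq_iff algebra_simps)
  then have "cis (of_int n * t) * (of_real (p (cis t)) * f t) =
      a * (cis (of_int n * t) * cis t * f t) + b * (cis (of_int n * t) * cis (- t) * f t)" for t
    by (simp add: algebra_simps)
  moreover have "cis (of_int n * t) * cis t = cis (of_int (n + 1) * t)"
    "cis (of_int n * t) * cis (- t) = cis (of_int (n - 1) * t)" for t
    by (simp_all add: cis_mult algebra_simps)
  ultimately have "(\<lambda>t. cis (of_int n * t) * (of_real (p (cis t)) * f t)) =
      (\<lambda>t. a * (cis (of_int (n + 1) * t) * f t) + b * (cis (of_int (n - 1) * t) * f t))"
    by (simp only:)
  then show ?case
    using int[of "n + 1"] int[of "n - 1"] linear.prems(2)[of "n + 1"] linear.prems(2)[of "n - 1"]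
    by (simp only: integral_add integrable_on_mult_right integral_mult_right) simp
next
  case (const c)
  then show ?case
    using const.prems(2)[of n]
    by (simp only: mult.left_commute[of _ "of_real c"] integral_mult_right) simp
next
  case (add p q)
  have c: "continuous_on UNIV (\<lambda>t. of_real (r (cis t)) * f t)" if "real_polynomial_function r" for r :: "complex \<Rightarrow> real"
    by (intro continuous_intros add.prems(1) continuous_on_polynomial_cis that)
  have i: "(\<lambda>t. cis (of_int n * t) * (of_real (r (cis t)) * f t)) integrable_on {0..2*pi}"
    if "real_polynomial_function r" for r :: "complex \<Rightarrow> real"
  proof (intro integrable_continuous_real continuous_on_mult)
    show "continuous_on {0..2*pi} (\<lambda>t. cis (of_int n * t))"
      by (intro continuous_intros)
    show "continuous_on {0..2*pi} (\<lambda>t. complex_of_real (r (cis t)))" "continuous_on {0..2*pi} f"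
      using continuous_on_polynomial_cis[OF that] continuous_on_subset[OF add.prems(1)]
      by (auto intro!: continuous_intros)
  qed
  show ?case
    using add.IH[OF add.prems] i add.hyps
    by (simp only: of_real_add distrib_right distrib_left integral_add) simp
next
  case (mult p q)
  have c: "continuous_on UNIV (\<lambda>t. of_real (q (cis t)) * f t)"
    by (intro continuous_intros mult.prems(1) continuous_on_polynomial_cis mult.hyps(2))
  show ?case
    using mult.IH(1)[OF c mult.IH(2)[OF mult.prems], of n] by (simp only: of_real_mult mult.assoc)
qed

lemma fourier_coeffs_0_imp_0:
  fixes h :: "complex \<Rightarrow> complex"
  assumes h: "continuous_on (sphere 0 1) h"
    and 0: "\<And>n :: int. integral {0..2*pi} (\<lambda>t. cis (of_int n * t) * h (cis t)) = 0"
  shows "h 1 = 0"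
proof -
  define f where "f t = h (cis t)" for t
  have f: "continuous_on UNIV f"
    unfolding f_def using h by (intro continuous_on_compose2[OF h] continuous_intros) auto
  have cf: "continuous_on {0..2*pi} f" using f by (rule continuous_on_subset) simp
  define I where "I = integral {0..2*pi} (\<lambda>t. (norm (f t))\<^sup>2)"
  define J where "J = integral {0..2*pi} (\<lambda>t. norm (f t))"
  have J0: "0 \<le> J"
    unfolding J_def by (intro Henstock_Kurzweil_Integration.integral_nonneg integrable_continuous_real continuous_intros cf) auto
  \<comment> \<open>With \<open>g\<close> uniformly \<open>e\<close>-close to
    \<open>cnj \<circ> h\<close>, the integral of \<open>g (cis t) * f t\<close> vanishes, so in the
    integral of \<open>cnj (f t) * f t\<close> the first factor may be replaced by the error
    \<open>cnj (f t) - g (cis t)\<close>.\<close>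
  have "I \<le> e * J" if e: "e > 0" for e
  proof -
    have "continuous_on (sphere 0 1) (\<lambda>z. cnj (h z))"
      using h by (intro continuous_intros)
    then obtain g where g: "polynomial_function g" "\<And>z. z \<in> sphere 0 1 \<Longrightarrow> norm (cnj (h z) - g z) < e"
      using Stone_Weierstrass_polynomial_function[of "sphere 0 1" "\<lambda>z. cnj (h z)" e] e by auto
    have gr: "real_polynomial_function (\<lambda>z. Re (g z))" "real_polynomial_function (\<lambda>z. Im (g z))"
      using g(1)[unfolded polynomial_function_def, rule_format, OF bounded_linear_Re]
        g(1)[unfolded polynomial_function_def, rule_format, OF bounded_linear_Im]
      by (simp_all add: o_def)
    have cg: "continuous_on UNIV (\<lambda>t. g (cis t))"
      by (rule continuous_on_compose2[OF continuous_on_polymonial_function[OF g(1), of UNIV]])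
        (auto intro!: continuous_intros)
    then have cg': "continuous_on {0..2*pi} (\<lambda>t. g (cis t))" by (rule continuous_on_subset) simp
    have z: "integral {0..2*pi} (\<lambda>t. of_real (Re (g (cis t))) * f t) = 0"
      "integral {0..2*pi} (\<lambda>t. of_real (Im (g (cis t))) * f t) = 0"
      using fourier_coeffs_0_polynomial[OF gr(1) f 0[folded f_def], of 0]
        fourier_coeffs_0_polynomial[OF gr(2) f 0[folded f_def], of 0]
      by simp_all
    have "(\<lambda>t. g (cis t) * f t) = (\<lambda>t. of_real (Re (g (cis t))) * f t + \<i> * (of_real (Im (g (cis t))) * f t))"
      by (rule ext) (simp add: complex_eq_iff algebra_simps)
    moreover have "(\<lambda>t. of_real (Re (g (cis t))) * f t) integrable_on {0..2*pi}"
      "(\<lambda>t. of_real (Im (g (cis t))) * f t) integrable_on {0..2*pi}"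
      by (intro integrable_continuous_real continuous_intros cf cg')+
    ultimately have gf: "integral {0..2*pi} (\<lambda>t. g (cis t) * f t) = 0"
      using z by (simp only: integral_add integrable_on_mult_right integral_mult_right) simp
    have ff: "(\<lambda>t. complex_of_real ((norm (f t))\<^sup>2)) = (\<lambda>t. g (cis t) * f t + (cnj (f t) - g (cis t)) * f t)"
      by (simp only: complex_norm_square) (simp add: algebra_simps)
    have i1: "(\<lambda>t. g (cis t) * f t) integrable_on {0..2*pi}"
      and i2: "(\<lambda>t. (cnj (f t) - g (cis t)) * f t) integrable_on {0..2*pi}"
      by (intro integrable_continuous_real continuous_intros cf cg')+
    have "complex_of_real I = integral {0..2*pi} (\<lambda>t. complex_of_real ((norm (f t))\<^sup>2))"
    proof -
      have "(\<lambda>t. (norm (f t))\<^sup>2) integrable_on {0..2*pi}"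
        by (intro integrable_continuous_real continuous_intros cf)
      from integral_linear[OF this bounded_linear_of_real[where 'a = complex]] show ?thesis
        by (simp add: I_def o_def)
    qed
    also have "\<dots> = integral {0..2*pi} (\<lambda>t. (cnj (f t) - g (cis t)) * f t)"
      unfolding ff using i1 i2 gf by (simp add: integral_add)
    finally have "norm (complex_of_real I) \<le> integral {0..2*pi} (\<lambda>t. e * norm (f t))"
    proof (simp only:, intro Henstock_Kurzweil_Integration.integral_norm_bound_integral i2)
      show "(\<lambda>t. e * norm (f t)) integrable_on {0..2*pi}"
        by (intro integrable_continuous_real continuous_intros cf)
      show "norm ((cnj (f t) - g (cis t)) * f t) \<le> e * norm (f t)" for t
        using g(2)[of "cis t"] unfolding norm_mult by (intro mult_right_mono) (auto simp: f_def)
    qed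
    then show "I \<le> e * J"
      unfolding J_def by simp
  qed
  note bound = this
  have "I \<le> 0"
  proof (rule field_le_epsilon)
    fix e :: real assume e: "e > 0"
    have "I \<le> e / (J + 1) * J"
      using e J0 by (intro bound) simp
    also have "\<dots> \<le> e" using e J0 by (simp add: field_simps)
    finally show "I \<le> 0 + e" by simp
  qed
  moreover have "0 \<le> I"
    unfolding I_def by (intro Henstock_Kurzweil_Integration.integral_nonneg integrable_continuous_real continuous_intros cf) auto
  ultimately have "integral {0..2*pi} (\<lambda>t. (norm (f t))\<^sup>2) = 0"
    by (simp add: I_def)
  then have "\<forall>t\<in>{0..2*pi}. (norm (f t))\<^sup>2 = 0"
    by (subst (asm) integral_eq_0_iff) (auto intro!: continuous_intros cf)
  then have "f 0 = 0" by simp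
  then show ?thesis by (simp add: f_def)
qed

section \<open>The grading\<close>

lemma ex_orthogonal_remainder:
  assumes "complex_vector.subspace W" "finite_cdim W"
  obtains w where "w \<in> W" "\<And>z. z \<in> W \<Longrightarrow> cinner (x - w) z = 0"
proof -
  obtain E where E: "orthonormal_basis W E"
    using ex_orthonormal_basis[OF assms] by blast
  note E' = orthonormal_basisD[OF E]
  define w where "w = (\<Sum>e\<in>E. cinner x e *\<^sub>C e)"
  have "w \<in> W"
    unfolding w_def using E'(2) assms(1)
    by (intro complex_vector.subspace_sum complex_vector.subspace_scale) auto
  moreover have e: "cinner (x - w) e = 0" if "e \<in> E" for e
  proof -
    have "cinner w e = (\<Sum>e'\<in>E. if e' = e then cinner x e' else 0)"
      unfolding w_def cinner_sum_left using that E'(5)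
      by (intro sum.cong) (auto simp: cinner_scaleC_left)
    then show ?thesis
      using E'(1) that by (simp add: cinner_diff_left)
  qed
  have "cinner (x - w) z = 0" if "z \<in> W" for z
    by (subst orthonormal_expansion[OF E that]) (simp add: cinner_sum_right cinner_scaleC_right e)
  ultimately show ?thesis using that by blast
qed

section \<open>Words of operators and the telescoping of defects\<close>

context row_contraction
begin

fun T_word :: "'d list \<Rightarrow> 'h \<Rightarrow> 'h"
  where "T_word [] x = x" | "T_word (k # w) x = T k (T_word w x)"

fun T_adj_word :: "'d list \<Rightarrow> 'h \<Rightarrow> 'h"
  where "T_adj_word [] x = x" | "T_adj_word (k # w) x = T_adj_word w (T_adj k x)"

lemma cinner_T_word: "cinner (T_word w x) y = cinner x (T_adj_word w y)"
  by (induction w arbitrary: y) (auto simp: cinner_T)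

text \<open>The quadratic form of \<open>(phi_map T ^^ n) id\<close>; see
  \<open>cinner_phi_map\<close>.\<close>

definition length_form :: "nat \<Rightarrow> 'h \<Rightarrow> real"
  where "length_form n x = (\<Sum>w\<in>words n. (norm (T_adj_word w x))\<^sup>2)"

text \<open>The quadratic form of \<open>phi_map\<close> iterated on
  \<open>\<Delta> \<circ> \<Delta> = 1 - \<phi>(1)\<close>, that is, of
  \<open>\<phi>^n(1) - \<phi>^(n+1)(1)\<close>; hence the telescoping in
  \<open>sum_defect_form\<close>.\<close>

definition defect_form :: "nat \<Rightarrow> 'h \<Rightarrow> real"
  where "defect_form n x = (\<Sum>w\<in>words n. (norm (\<Delta> (T_adj_word w x)))\<^sup>2)"

lemma length_form_0: "length_form 0 x = (norm x)\<^sup>2"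
  and length_form_Suc: "length_form (Suc n) x = (\<Sum>k\<in>UNIV. length_form n (T_adj k x))"
  by (simp_all add: length_form_def words_0 sum_words_Suc)

lemma length_form_nonneg: "0 \<le> length_form n x"
  by (simp add: length_form_def sum_nonneg)

lemma defect_form_0: "defect_form 0 x = (norm (\<Delta> x))\<^sup>2"
  and defect_form_Suc: "defect_form (Suc n) x = (\<Sum>k\<in>UNIV. defect_form n (T_adj k x))"
  by (simp_all add: defect_form_def words_0 sum_words_Suc)

lemma defect_form_eq: "defect_form n x = length_form n x - length_form (Suc n) x"
proof (induction n arbitrary: x)
  case 0
  then show ?case
    by (simp add: defect_form_0 length_form_Suc length_form_0 norm_\<Delta>)
next
  case (Suc n)
  then show ?case
    by (simp add: defect_form_Suc length_form_Suc[of "Suc n"] length_form_Suc[of n x] sum_subtractf)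
qed

lemma sum_defect_form: "(\<Sum>j<n. defect_form j x) = (norm x)\<^sup>2 - length_form n x"
  by (induction n) (auto simp: length_form_0 defect_form_eq)

lemma cinner_phi_map: "cinner ((phi_map T ^^ n) id x) x = of_real (length_form n x)"
proof (induction n arbitrary: x)
  case 0
  then show ?case by (simp add: length_form_0 cinner_same)
next
  case (Suc n)
  have "cinner ((phi_map T ^^ Suc n) id x) x =
      (\<Sum>k\<in>UNIV. cinner (T k ((phi_map T ^^ n) id (T_adj k x))) x)"
    by (simp add: phi_map_def T_adj_def cinner_sum_left)
  also have "\<dots> = of_real (length_form (Suc n) x)"
    by (simp add: cinner_T Suc length_form_Suc)
  finally show ?case .
qed

lemma subspace_range_\<Delta>: "complex_vector.subspace (range \<Delta>)"
proof (rule complex_vector.subspaceI)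
  show "0 \<in> range \<Delta>" using \<Delta>_lin(4) by (metis rangeI)
  show "x + y \<in> range \<Delta>" if "x \<in> range \<Delta>" "y \<in> range \<Delta>" for x y
    using that by (auto simp: \<Delta>_lin(1)[symmetric])
  show "c *\<^sub>C x \<in> range \<Delta>" if "x \<in> range \<Delta>" for c x
    using that by (auto simp: \<Delta>_lin(2)[symmetric])
qed

text \<open>Without defects the telescoping sum keeps \<open>length_form n x\<close> equal to
  \<open>(norm x)\<^sup>2\<close> for all \<open>n\<close>, whereas purity drives it to
  \<open>0\<close>.\<close>

lemma pure_eq_0:
  assumes pure: "pure T" and 0: "\<And>w. \<Delta> (T_adj_word w x) = 0"
  shows "x = 0"
proof -
  have "(\<lambda>n. cinner ((phi_map T ^^ n) id x) x) \<longlonglongrightarrow> cinner 0 x"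
    using pure unfolding pure_def by (intro tendsto_cinner_left) blast
  then have "(\<lambda>n. complex_of_real (length_form n x)) \<longlonglongrightarrow> of_real 0"
    by (simp add: cinner_phi_map)
  then have "(\<lambda>n. length_form n x) \<longlonglongrightarrow> 0"
    by (simp only: tendsto_of_real_iff)
  moreover have "length_form n x = (norm x)\<^sup>2" for n
    using sum_defect_form[of x n] 0 by (simp add: defect_form_def)
  ultimately have "(\<lambda>n::nat. (norm x)\<^sup>2) \<longlonglongrightarrow> 0"
    by simp
  then show ?thesis
    by (simp add: LIMSEQ_const_iff)
qed

end

section \<open>Weight spaces of the circle action\<close>

locale graded_row_contraction = row_contraction T
  for T :: "'d::finite \<Rightarrow> 'h::complex_hilbert_space \<Rightarrow> 'h" +
  fixes U :: "complex \<Rightarrow> 'h \<Rightarrow> 'h"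
  assumes circle_rep: "circle_rep U"
    and U_T_U: "\<And>k a. a \<in> sphere 0 1 \<Longrightarrow> U a \<circ> T k \<circ> cadjoint (U a) = (\<lambda>x. a *\<^sub>C T k x)"
    and pure: "pure T" and finite_rank: "finite_rank T"
begin

lemma U_bounded_clinear: "a \<in> sphere 0 1 \<Longrightarrow> bounded_clinear (U a)"
  and U_adj_U: "a \<in> sphere 0 1 \<Longrightarrow> cadjoint (U a) (U a x) = x"
  and U_U_adj: "a \<in> sphere 0 1 \<Longrightarrow> U a (cadjoint (U a) x) = x"
  and U_mult: "a \<in> sphere 0 1 \<Longrightarrow> b \<in> sphere 0 1 \<Longrightarrow> U (a * b) x = U a (U b x)"
  and U_continuous: "continuous_on (sphere 0 1) (\<lambda>a. U a x)"
  using circle_rep by (auto simp: circle_rep_def unitary_op_def fun_eq_iff)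

lemmas U_lin = bounded_clinear_add[OF U_bounded_clinear] bounded_clinear_scaleC[OF U_bounded_clinear]
  bounded_clinear_diff[OF U_bounded_clinear] bounded_clinear_0[OF U_bounded_clinear]
  bounded_clinear_sum[OF U_bounded_clinear]

lemma cinner_U_U: "a \<in> sphere 0 1 \<Longrightarrow> cinner (U a x) (U a y) = cinner x y"
  by (simp add: cinner_cadjoint[OF U_bounded_clinear] U_adj_U del: mem_sphere_0)

lemma U_one: "U 1 x = x"
proof -
  have "U 1 (U 1 x) = U 1 x"
    using U_mult[of 1 1 x] by simp
  then have "cadjoint (U 1) (U 1 (U 1 x)) = cadjoint (U 1) (U 1 x)"
    by simp
  then show ?thesis
    using U_adj_U[of 1] by simp
qed

lemma U_T: "a \<in> sphere 0 1 \<Longrightarrow> U a (T k x) = a *\<^sub>C T k (U a x)"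
  using fun_cong[OF U_T_U[of a k], of "U a x"] by (simp add: U_adj_U del: mem_sphere_0)

lemma U_T_adj:
  assumes a: "a \<in> sphere 0 1"
  shows "U a (T_adj k x) = cnj a *\<^sub>C T_adj k (U a x)"
proof (rule cinner_ext_left)
  fix z
  define y where "y = cadjoint (U a) z"
  have z: "z = U a y" using U_U_adj[OF a] by (simp add: y_def)
  have "cinner (U a (T_adj k x)) z = cinner x (T k y)"
    by (simp add: z cinner_U_U[OF a] cinner_T_adj)
  also have "\<dots> = cinner (U a x) (a *\<^sub>C T k (U a y))"
    using cinner_U_U[OF a, of x "T k y"] U_T[OF a] by simp
  also have "\<dots> = cinner (cnj a *\<^sub>C T_adj k (U a x)) z"
    by (simp add: z cinner_simps cinner_T_adj)
  finally show "cinner (U a (T_adj k x)) z = cinner (cnj a *\<^sub>C T_adj k (U a x)) z" .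
qed

text \<open>The phases \<open>a\<close> and \<open>cnj a\<close> cancel in \<open>row_sq\<close>,
  and an operator commuting with \<open>row_sq\<close> commutes with the positive root
  \<open>\<Delta>\<close> of \<open>1 - row_sq\<close>.\<close>

lemma U_\<Delta>:
  assumes a: "a \<in> sphere 0 1"
  shows "U a (\<Delta> x) = \<Delta> (U a x)"
proof (rule \<Delta>_commute[OF U_bounded_clinear[OF a]])
  have "a * cnj a = 1"
    using a by (simp add: complex_norm_square[symmetric])
  then show "U a (row_sq x) = row_sq (U a x)" for x
    by (simp add: row_sq_def U_lin[OF a] U_T[OF a] U_T_adj[OF a] T_lin scaleC_scaleC)
qed

definition weight :: "int \<Rightarrow> 'h set"
  where "weight n = {x. \<forall>a\<in>sphere 0 1. U a x = (a powi n) *\<^sub>C x}"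

lemma subspace_weight: "complex_vector.subspace (weight n)"
  by (rule complex_vector.subspaceI)
    (auto simp: weight_def U_lin scaleC_add_right scaleC_scaleC mult.commute simp del: mem_sphere_0)

lemma T_weight: "x \<in> weight n \<Longrightarrow> T k x \<in> weight (n + 1)"
proof -
  assume x: "x \<in> weight n"
  have "U a (T k x) = (a powi (n + 1)) *\<^sub>C T k x" if a: "a \<in> sphere 0 1" for a
  proof -
    have "a \<noteq> 0" using a by auto
    then have "a powi (n + 1) = a * a powi n"
      by (simp add: power_int_add)
    then show ?thesis
      using x a by (simp add: weight_def U_T T_lin scaleC_scaleC del: mem_sphere_0)
  qed
  then show ?thesis by (simp add: weight_def)
qed

lemma T_adj_weight: "x \<in> weight n \<Longrightarrow> T_adj k x \<in> weight (n - 1)"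
proof -
  assume x: "x \<in> weight n"
  have "U a (T_adj k x) = (a powi (n - 1)) *\<^sub>C T_adj k x" if a: "a \<in> sphere 0 1" for a
  proof -
    have a0: "a \<noteq> 0" using a by auto
    have "a * cnj a = 1"
      using a by (simp add: complex_norm_square[symmetric])
    then have "cnj a = inverse a" using a0 by (simp add: field_simps)
    then have "a powi (n - 1) = cnj a * a powi n"
      using a0 by (simp add: power_int_diff divide_inverse)
    then show ?thesis
      using x a by (simp add: weight_def U_T_adj T_adj_lin scaleC_scaleC del: mem_sphere_0)
  qed
  then show ?thesis by (simp add: weight_def)
qed

lemma \<Delta>_weight: "x \<in> weight n \<Longrightarrow> \<Delta> x \<in> weight n"
  by (simp add: weight_def U_\<Delta> \<Delta>_lin del: mem_sphere_0)

lemma weight_orthogonal: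
  assumes "x \<in> weight m" "y \<in> weight n" "m \<noteq> n"
  shows "cinner x y = 0"
proof -
  \<comment> \<open>At this point of the circle the two characters differ by the factor
    \<open>-1\<close>.\<close>
  define a where "a = cis (pi / of_int (m - n))"
  have a: "a \<in> sphere 0 1" and a0: "a \<noteq> 0" by (simp_all add: a_def)
  have "cnj (a powi n) = inverse (a powi n)"
    by (simp add: a_def cis_power_int cis_cnj)
  then have "a powi m * cnj (a powi n) = a powi (m - n)"
    using a0 by (simp add: power_int_diff divide_inverse)
  also have "\<dots> = -1"
    using assms(3) by (simp add: a_def cis_power_int)
  finally have *: "a powi m * cnj (a powi n) = -1" .
  have "cinner x y = cinner (U a x) (U a y)"
    by (simp add: cinner_U_U[OF a])
  also have "\<dots> = (a powi m * cnj (a powi n)) * cinner x y"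
    using assms a by (simp add: weight_def cinner_simps del: mem_sphere_0)
  finally show ?thesis
    unfolding * by simp
qed

text \<open>The Fourier coefficients of the orbit \<open>a \<mapsto> U a x\<close> are weight vectors.\<close>

lemma weight_total:
  assumes x: "\<And>n y. y \<in> weight n \<Longrightarrow> cinner y x = 0"
  shows "x = 0"
proof -
  have sc: "bounded_linear ((*\<^sub>C) d :: 'h \<Rightarrow> 'h)" for d
    using bounded_clinearI[of "(*\<^sub>C) d :: 'h \<Rightarrow> 'h" "norm d"]
    by (auto simp: scaleC_add_right scaleC_scaleC mult.commute bounded_clinear_def)
  have cU: "continuous_on UNIV (\<lambda>t. U (cis t) x)"
    by (rule continuous_on_compose2[OF U_continuous]) (auto intro!: continuous_intros)
  have sphere: "cis t \<in> sphere 0 1" for t by simp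
  define g where "g n t = cis (of_int n * t) *\<^sub>C U (cis t) x" for n :: int and t
  have g_eq: "g n t = cos (of_int n * t) *\<^sub>R U (cis t) x + sin (of_int n * t) *\<^sub>R (\<i> *\<^sub>C U (cis t) x)" for n t
  proof -
    have "cis (of_int n * t) = of_real (cos (of_int n * t)) + of_real (sin (of_int n * t)) * \<i>"
      by (simp add: complex_eq_iff)
    then show ?thesis
      by (simp only: g_def scaleC_add_left scaleR_scaleC scaleC_scaleC)
  qed
  have cg: "continuous_on UNIV (g n)" for n
    unfolding g_eq[abs_def]
    by (intro continuous_intros cU bounded_linear.continuous_on[OF sc])
  have ig: "g n integrable_on {0..2*pi}" for n
    by (intro integrable_continuous_real continuous_on_subset[OF cg]) auto
  have per: "g n (t + 2*pi) = g n t" for n t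
  proof -
    have "cis (of_int n * (t + 2*pi)) = cis (of_int n * t) * cis (2 * pi * of_int n)"
      by (simp add: cis_mult algebra_simps)
    also have "cis (2 * pi * of_int n) = 1"
      by (rule cis_multiple_2pi) simp
    finally show ?thesis
      by (simp add: g_def cis_mult[symmetric])
  qed
  define p where "p n = integral {0..2*pi} (g n)" for n
  \<comment> \<open>By translation of the periodic integrand; the weight is \<open>- n\<close>
    because \<open>g n\<close> carries the factor \<open>cis (n * t)\<close>, not its
    conjugate.\<close>
  have "U a (p n) = (a powi (- n)) *\<^sub>C p n" if a: "a \<in> sphere 0 1" for a n
  proof -
    obtain s where s: "a = cis s" "0 \<le> s" "s < 2*pi"
    proof -
      have "cmod a = 1" using a by simp
      then have "a = cis (Arg2pi a)"
        using Arg2pi_eq[of a] by (simp add: cis_conv_exp)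
      then show ?thesis
        using that[of "Arg2pi a"] Arg2pi_ge_0 Arg2pi_lt_2pi by blast
    qed
    have bl: "bounded_linear (U a)"
      using U_bounded_clinear[OF a] by (simp add: bounded_clinear_def)
    have "U a (g n t) = (a powi (- n)) *\<^sub>C g n (t + s)" for t
    proof -
      have "a powi (- n) * cis (of_int n * (t + s)) = cis (of_int n * t)"
        by (simp add: s(1) cis_power_int cis_mult algebra_simps)
      moreover have "U a (U (cis t) x) = U (cis (t + s)) x"
        using U_mult[OF a sphere, of t x] by (simp add: s(1) cis_mult add.commute)
      ultimately show ?thesis
        by (simp add: g_def U_lin[OF a] scaleC_scaleC)
    qed
    then have "U a \<circ> g n = (*\<^sub>C) (a powi (- n)) \<circ> (\<lambda>t. g n (t + s))"
      by (simp add: fun_eq_iff)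
    moreover have "(\<lambda>t. g n (t + s)) integrable_on {0..2*pi}"
      by (intro integrable_continuous_real continuous_on_compose2[OF cg] continuous_intros) auto
    ultimately have "U a (p n) = (a powi (- n)) *\<^sub>C integral {0..2*pi} (\<lambda>t. g n (t + s))"
      unfolding p_def using integral_linear[OF ig bl, of n] integral_linear[OF _ sc] by metis
    also have "integral {0..2*pi} (\<lambda>t. g n (t + s)) = p n"
      unfolding p_def using s(2,3) by (intro integral_periodic_shift cg per) auto
    finally show ?thesis .
  qed
  then have pw: "p n \<in> weight (- n)" for n
    by (simp add: weight_def)
  \<comment> \<open>The function \<open>a \<mapsto> cinner (U a x) x\<close> has the Fourier
    coefficients \<open>cinner (p n) x\<close>, all zero; its value at \<open>1\<close> is the
    squared norm of \<open>x\<close>.\<close>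
  have "cinner (U 1 x) x = 0"
  proof (rule fourier_coeffs_0_imp_0)
    show "continuous_on (sphere 0 1) (\<lambda>a. cinner (U a x) x)"
      by (intro bounded_linear.continuous_on[OF bounded_linear_cinner_left] U_continuous)
    fix n :: int
    have "integral {0..2*pi} (\<lambda>t. cis (of_int n * t) * cinner (U (cis t) x) x) =
        integral {0..2*pi} ((\<lambda>z. cinner z x) \<circ> g n)"
      by (simp add: o_def g_def cinner_scaleC_left)
    also have "\<dots> = cinner (p n) x"
      unfolding p_def by (rule integral_linear[OF ig bounded_linear_cinner_left])
    also have "\<dots> = 0"
      using x pw by blast
    finally show "integral {0..2*pi} (\<lambda>t. cis (of_int n * t) * cinner (U (cis t) x) x) = 0" .
  qed
  then show ?thesis
    by (simp add: U_one)
qed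

text \<open>Unit vectors of distinct weights are orthonormal, so there cannot be more weights than
  elements of a finite set spanning \<open>range \<Delta>\<close>.\<close>

lemma finite_range_weights: "finite {n. \<exists>x\<in>range \<Delta> \<inter> weight n. x \<noteq> 0}"
proof (rule ccontr)
  assume inf: "infinite {n. \<exists>x\<in>range \<Delta> \<inter> weight n. x \<noteq> 0}"
  obtain B where B: "finite B" "range \<Delta> \<subseteq> complex_vector.span B"
    using finite_rank by (auto simp: finite_rank_def finite_cdim_def \<Delta>_def)
  obtain F where F: "finite F" "card F = Suc (card B)" "F \<subseteq> {n. \<exists>x\<in>range \<Delta> \<inter> weight n. x \<noteq> 0}"
    using infinite_arbitrarily_large[OF inf] by blast
  have "\<forall>n\<in>F. \<exists>x. x \<in> range \<Delta> \<and> x \<in> weight n \<and> x \<noteq> 0"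
    using F(3) by auto
  then obtain f where f: "\<And>n. n \<in> F \<Longrightarrow> f n \<in> range \<Delta>" "\<And>n. n \<in> F \<Longrightarrow> f n \<in> weight n"
    "\<And>n. n \<in> F \<Longrightarrow> f n \<noteq> 0"
    by metis
  define e where "e n = of_real (1 / norm (f n)) *\<^sub>C f n" for n
  have ee: "cinner (e m) (e n) = (if m = n then 1 else 0)" if "m \<in> F" "n \<in> F" for m n
    using f(3)[OF that(1)] weight_orthogonal[OF f(2)[OF that(1)] f(2)[OF that(2)]]
    by (auto simp: e_def cinner_scaleC_left cinner_scaleC_right cinner_same norm_divide power2_eq_square)
  have inj: "inj_on e F"
    using ee by (intro inj_onI) (metis zero_neq_one)
  have "complex_vector.independent (e ` F)"
    using F(1) ee by (intro orthonormal_independent) (auto split: if_splits)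
  moreover have "e ` F \<subseteq> complex_vector.span B"
    using f(1) B(2) by (auto simp: e_def intro!: complex_vector.span_scale)
  ultimately have "card (e ` F) \<le> card B"
    using complex_vector.independent_span_bound[OF B(1)] by blast
  then show False
    using card_image[OF inj] F(2) by simp
qed

lemma finite_cdim_range_\<Delta>: "finite_cdim (range \<Delta>)"
  using finite_rank by (simp add: finite_rank_def \<Delta>_def)

text \<open>Such \<open>x\<close> are orthogonal to the ranges of all \<open>T k\<close>, so they
  are the new generators in their degree; \<open>row_sq x = 0\<close> places them in the
  finite-dimensional range of \<open>\<Delta>\<close>.\<close>

lemma T_adj_0_imp_range_\<Delta>: "(\<And>k. T_adj k x = 0) \<Longrightarrow> x = \<Delta> (\<Delta> x)"
  by (simp add: \<Delta>_\<Delta> row_sq_def T_lin)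

end

section \<open>The decomposition into finite-dimensional degrees\<close>

lemma finite_cdim_span_Un:
  assumes "finite_cdim V" "finite_cdim W"
  shows "finite_cdim (complex_vector.span (V \<union> W))"
proof -
  obtain A B where "finite A" "V \<subseteq> complex_vector.span A" "finite B" "W \<subseteq> complex_vector.span B"
    using assms by (auto simp: finite_cdim_def)
  moreover have "complex_vector.span A \<subseteq> complex_vector.span (A \<union> B)"
    "complex_vector.span B \<subseteq> complex_vector.span (A \<union> B)"
    by (intro complex_vector.span_mono; simp)+
  ultimately have "V \<union> W \<subseteq> complex_vector.span (A \<union> B)" "finite (A \<union> B)"
    by auto
  then show ?thesis
    unfolding finite_cdim_def using complex_vector.span_minimal complex_vector.subspace_span by blast
qed

lemma finite_cdim_UN_image:
  fixes V :: "'a::complex_hilbert_space set" and f :: "'i \<Rightarrow> 'a \<Rightarrow> 'b::complex_hilbert_space"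
  assumes "finite I" "finite_cdim V" "\<And>i. i \<in> I \<Longrightarrow> bounded_clinear (f i)"
  shows "finite_cdim (\<Union>i\<in>I. f i ` V)"
proof -
  obtain B where B: "finite B" "V \<subseteq> complex_vector.span B"
    using assms(2) by (auto simp: finite_cdim_def)
  have "f i x \<in> complex_vector.span (\<Union>i\<in>I. f i ` B)" if i: "i \<in> I" and x: "x \<in> V" for i x
  proof -
    obtain u where "x = (\<Sum>b\<in>B. u b *\<^sub>C b)"
      using x B(2) complex_vector.span_finite[OF B(1)] by blast
    then have "f i x = (\<Sum>b\<in>B. u b *\<^sub>C f i b)"
      by (simp add: bounded_clinear_sum[OF assms(3)[OF i]] bounded_clinear_scaleC[OF assms(3)[OF i]])
    then show ?thesis
      using i by (simp only:) (intro complex_vector.span_sum complex_vector.span_scale complex_vector.span_base; blast)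
  qed
  then show ?thesis
    using assms(1) B(1) unfolding finite_cdim_def by (intro exI[of _ "\<Union>i\<in>I. f i ` B"]) auto
qed

text \<open>What the later sections use of the circle action: degrees starting at \<open>0\<close>,
  raised by the \<open>T k\<close> and lowered by their adjoints, with \<open>\<Delta>\<close> zero
  from degree \<open>b\<close> on.\<close>

locale graded_decomposition = row_contraction T
  for T :: "'d::finite \<Rightarrow> 'h::complex_hilbert_space \<Rightarrow> 'h" +
  fixes V :: "nat \<Rightarrow> 'h set" and b :: nat
  assumes subspace_V: "complex_vector.subspace (V i)"
    and finite_cdim_V: "finite_cdim (V i)"
    and V_orthogonal: "x \<in> V i \<Longrightarrow> y \<in> V j \<Longrightarrow> i \<noteq> j \<Longrightarrow> cinner x y = 0"
    and V_total: "(\<And>i y. y \<in> V i \<Longrightarrow> cinner y x = 0) \<Longrightarrow> x = 0"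
    and T_V: "x \<in> V i \<Longrightarrow> T k x \<in> V (Suc i)"
    and T_adj_V: "x \<in> V (Suc i) \<Longrightarrow> T_adj k x \<in> V i"
    and T_adj_V_0: "x \<in> V 0 \<Longrightarrow> T_adj k x = 0"
    and \<Delta>_V: "x \<in> V i \<Longrightarrow> \<Delta> x \<in> V i"
    and \<Delta>_V_eq_0: "x \<in> V i \<Longrightarrow> b \<le> i \<Longrightarrow> \<Delta> x = 0"
    and finite_cdim_range: "finite_cdim (range \<Delta>)"

context graded_row_contraction
begin

lemma ex_graded_decomposition: "\<exists>V b. graded_decomposition T V b"
proof -
  let ?N = "{n. \<exists>x\<in>range \<Delta> \<inter> weight n. x \<noteq> 0}"
  obtain M where M: "\<And>n. n \<in> ?N \<Longrightarrow> \<bar>n\<bar> < M"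
  proof -
    have "\<bar>n\<bar> < Max (abs ` ?N) + 1" if "n \<in> ?N" for n
      using Max_ge[OF finite_imageI[OF finite_range_weights, of abs], of "\<bar>n\<bar>"] that by fastforce
    then show ?thesis by (rule that)
  qed
  have range0: "x = 0" if "x \<in> range \<Delta>" "x \<in> weight n" "M \<le> \<bar>n\<bar>" for x n
    using M[of n] that by force
  \<comment> \<open>Words in the adjoints never raise the weight, so every defect of
    \<open>x\<close> has weight at most \<open>- M\<close> and vanishes; purity then kills
    \<open>x\<close>.\<close>
  have low: "x = 0" if x: "x \<in> weight n" and n: "n \<le> - M" for x n
  proof (rule pure_eq_0[OF pure])
    have *: "T_adj_word w x \<in> weight (n - int (length w))" if "x \<in> weight n" for w x n
      using that
    proof (induction w arbitrary: x n)
      case (Cons k w)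
      have "T_adj_word w (T_adj k x) \<in> weight ((n - 1) - int (length w))"
        using Cons T_adj_weight by blast
      then show ?case by (simp add: algebra_simps)
    qed simp
    show "\<Delta> (T_adj_word w x) = 0" for w
    proof (rule range0)
      show "\<Delta> (T_adj_word w x) \<in> weight (n - int (length w))"
        using * x \<Delta>_weight by blast
    qed (use n in auto)
  qed
  \<comment> \<open>The shift by \<open>M\<close> turns all weights that carry nonzero vectors into
    natural numbers; \<open>V 0\<close> is itself zero by \<open>low\<close>. Weights on
    \<open>range \<Delta>\<close> lie below \<open>M\<close>, which becomes degree
    \<open>2 * M\<close>.\<close>
  define V where "V i = weight (int i - M)" for i
  define b where "b = nat (2 * M)"
  have VS: "T k x \<in> V (Suc i)" if "x \<in> V i" for k x i
    using T_weight[of x "int i - M" k] that by (simp add: V_def algebra_simps)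
  have VA: "T_adj k x \<in> V i" if "x \<in> V (Suc i)" for k x i
    using T_adj_weight[of x "int (Suc i) - M" k] that by (simp add: V_def algebra_simps)
  have VA0: "T_adj k x = 0" if "x \<in> V 0" for k x
    using T_adj_weight[of x "- M" k] low that by (auto simp: V_def)
  have fd: "finite_cdim (V i)" for i
  proof (induction i)
    case 0
    have "x \<in> range \<Delta>" if "x \<in> V 0" for x
      using T_adj_0_imp_range_\<Delta>[OF VA0[OF that]] by (metis rangeI)
    then show ?case
      using finite_cdim_subset[OF finite_cdim_range_\<Delta>] by blast
  next
    case (Suc i)
    \<comment> \<open>\<open>W\<close> exhausts \<open>V (Suc i)\<close>: the remainder
      \<open>y\<close> of a vector, orthogonal to \<open>W\<close>, is killed by all adjoints, hence
      lies in \<open>range \<Delta>\<close> and therefore in \<open>W\<close>.\<close>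
    define W where "W = complex_vector.span ((range \<Delta> \<inter> V (Suc i)) \<union> (\<Union>k. T k ` V i))"
    have "finite_cdim (range \<Delta> \<inter> V (Suc i))"
      using finite_cdim_subset[OF finite_cdim_range_\<Delta>] by blast
    moreover have "finite_cdim (\<Union>k. T k ` V i)"
      by (rule finite_cdim_UN_image[OF finite_class.finite_UNIV Suc T_bounded_clinear])
    ultimately have fW: "finite_cdim W"
      unfolding W_def by (rule finite_cdim_span_Un)
    have sV: "complex_vector.subspace (V (Suc i))"
      by (simp add: V_def subspace_weight)
    have WV: "W \<subseteq> V (Suc i)"
      unfolding W_def using VS sV by (intro complex_vector.span_minimal) auto
    have "x \<in> W" if x: "x \<in> V (Suc i)" for x
    proof -
      obtain w where w: "w \<in> W" "\<And>z. z \<in> W \<Longrightarrow> cinner (x - w) z = 0"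
        using ex_orthogonal_remainder[of W x] fW by (auto simp: W_def)
      define y where "y = x - w"
      have yV: "y \<in> V (Suc i)"
        unfolding y_def using x w(1) WV sV complex_vector.subspace_diff by blast
      have "T_adj k y = 0" for k
      proof -
        have "T k (T_adj k y) \<in> W"
          unfolding W_def using VA[OF yV] by (intro complex_vector.span_base) auto
        then have "cinner y (T k (T_adj k y)) = 0" using w(2) by (simp add: y_def)
        then show ?thesis by (simp add: cinner_T_adj[symmetric])
      qed
      then have "y = \<Delta> (\<Delta> y)" by (rule T_adj_0_imp_range_\<Delta>)
      then have "y \<in> W"
        unfolding W_def using yV by (intro complex_vector.span_base) auto
      then have "cinner y y = 0" using w(2) by (simp add: y_def)
      then show ?thesis using w(1) by (simp add: y_def)
    qed
    then show ?case using fW finite_cdim_subset by blast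
  qed
  have "graded_decomposition T V b"
  proof
    show "complex_vector.subspace (V i)" for i by (simp add: V_def subspace_weight)
    show "cinner x y = 0" if "x \<in> V i" "y \<in> V j" "i \<noteq> j" for x y i j
      using weight_orthogonal[of x "int i - M" y "int j - M"] that by (simp add: V_def)
    show "x = 0" if x: "\<And>i y. y \<in> V i \<Longrightarrow> cinner y x = 0" for x
    proof (rule weight_total)
      fix n y assume y: "y \<in> weight n"
      show "cinner y x = 0"
      proof (cases "n \<le> - M")
        case True
        then show ?thesis using low[OF y] by simp
      next
        case False
        then have "y \<in> V (nat (n + M))" using y by (simp add: V_def)
        then show ?thesis using x by blast
      qed
    qed
    show "\<Delta> x \<in> V i" if "x \<in> V i" for x i
      using that \<Delta>_weight by (simp add: V_def)
    show "\<Delta> x = 0" if "x \<in> V i" "b \<le> i" for x i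
      using that \<Delta>_weight[of x "int i - M"] by (intro range0[of _ "int i - M"]) (auto simp: V_def b_def)
  qed (use VS VA VA0 fd finite_cdim_range_\<Delta> in auto)
  then show ?thesis by blast
qed

end

section \<open>The Dirac operator\<close>

lemma bounded_clinear_vec_nth: "bounded_clinear (\<lambda>\<xi>. \<xi> $ X)"
  for X :: "'n::finite"
  by (rule bounded_clinearI[where K = 1])
    (auto simp: scaleC_vec_def Finite_Cartesian_Product.norm_nth_le)

lemma bounded_clinear_vecI:
  fixes f :: "'a::complex_hilbert_space \<Rightarrow> 'b::complex_hilbert_space^'n"
  assumes "\<And>X. bounded_clinear (\<lambda>x. f x $ X)"
  shows "bounded_clinear f"
proof -
  have "\<forall>X. \<exists>K. \<forall>x. norm (f x $ X) \<le> K * norm x"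
    using assms bounded_clinear_bound by metis
  then obtain K where K: "\<And>X x. norm (f x $ X) \<le> K X * norm x"
    by metis
  show ?thesis
  proof (rule bounded_clinearI)
    show "f (x + y) = f x + f y" for x y
      using bounded_clinear_add[OF assms] by (simp add: vec_eq_iff)
    show "f (c *\<^sub>C x) = c *\<^sub>C f x" for c x
      using bounded_clinear_scaleC[OF assms] by (simp add: vec_eq_iff scaleC_vec_def)
    show "norm (f x) \<le> (\<Sum>X\<in>UNIV. K X) * norm x" for x
    proof -
      have "norm (f x) \<le> (\<Sum>X\<in>UNIV. norm (f x $ X))"
        by (simp add: norm_vec_def L2_set_le_sum)
      also have "\<dots> \<le> (\<Sum>X\<in>UNIV. K X * norm x)"
        by (intro sum_mono K)
      finally show ?thesis by (simp add: sum_distrib_right)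
    qed
  qed
qed

lemma cinner_axis_axis: "cinner (axis X x) (axis Y y) = (if X = Y then cinner x y else 0)"
  for X Y :: "'n::finite"
proof -
  have "cinner (axis X x) (axis Y y) = (\<Sum>i\<in>UNIV. if i = X then if X = Y then cinner x y else 0 else 0)"
    unfolding cinner_vec_def by (intro sum.cong) (auto simp: axis_def)
  then show ?thesis by simp
qed

lemma cinner_axis_right: "cinner \<xi> (axis X y) = cinner (\<xi> $ X) y"
  for X :: "'n::finite"
proof -
  have "cinner \<xi> (axis X y) = (\<Sum>i\<in>UNIV. if i = X then cinner (\<xi> $ X) y else 0)"
    unfolding cinner_vec_def by (intro sum.cong) (auto simp: axis_def)
  then show ?thesis by simp
qed

lemma orthonormal_basis_product:
  fixes Y :: "'n::finite \<Rightarrow> 'h::complex_hilbert_space set"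
  assumes F: "\<And>X. orthonormal_basis (Y X) (F X)"
  shows "orthonormal_basis {\<xi>. \<forall>X. \<xi> $ X \<in> Y X} (\<Union>X. axis X ` F X)"
    and "cdim {\<xi>. \<forall>X. \<xi> $ X \<in> Y X} = (\<Sum>X\<in>UNIV. cdim (Y X))"
proof -
  note F' = orthonormal_basisD[OF F]
  show ob: "orthonormal_basis {\<xi>. \<forall>X. \<xi> $ X \<in> Y X} (\<Union>X. axis X ` F X)"
  proof (rule orthonormal_basisI)
    show "complex_vector.subspace {\<xi>. \<forall>X. \<xi> $ X \<in> Y X}"
      using F'(3) by (auto simp: complex_vector.subspace_def scaleC_vec_def)
    show "finite (\<Union>X. axis X ` F X)" using F'(1) by auto
    show "(\<Union>X. axis X ` F X) \<subseteq> {\<xi>. \<forall>X. \<xi> $ X \<in> Y X}"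
      using complex_vector.subspace_0[OF F'(3)] by (auto simp: axis_def intro: subsetD[OF F'(2)])
    show "cinner e e' = (if e = e' then 1 else 0)"
      if ee: "e \<in> (\<Union>X. axis X ` F X)" "e' \<in> (\<Union>X. axis X ` F X)" for e e'
    proof -
      obtain X f X' f' where e: "e = axis X f" "f \<in> F X" "e' = axis X' f'" "f' \<in> F X'"
        using ee by blast
      have "f \<noteq> 0" using F'(6)[OF e(2)] by auto
      then have "axis X f = axis X' f' \<longleftrightarrow> X = X' \<and> f = f'"
        by (auto simp: axis_eq_axis)
      then show ?thesis
        using e F'(5) by (auto simp: cinner_axis_axis)
    qed
    fix \<xi> assume \<xi>: "\<xi> \<in> {\<xi>. \<forall>X. \<xi> $ X \<in> Y X}" and 0: "\<And>e. e \<in> (\<Union>X. axis X ` F X) \<Longrightarrow> cinner \<xi> e = 0"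
    have "\<xi> $ X = 0" for X
    proof -
      have "cinner (\<xi> $ X) f = 0" if "f \<in> F X" for f
        using 0[of "axis X f"] that by (auto simp: cinner_axis_right)
      then have "(norm (\<xi> $ X))\<^sup>2 = 0"
        using orthonormal_parseval[OF F[of X], of "\<xi> $ X"] \<xi> by simp
      then show ?thesis by simp
    qed
    then show "\<xi> = 0" by (simp add: vec_eq_iff)
  qed
  have inj: "inj_on (axis X) (F X)" for X
    by (auto simp: inj_on_def axis_eq_axis)
  have "axis X f \<noteq> axis X' f'" if "X \<noteq> X'" "f \<in> F X" for X X' f f'
    using F'(6)[OF that(2)] that(1) by (auto simp: axis_eq_axis)
  then have "card (\<Union>X. axis X ` F X) = (\<Sum>X\<in>UNIV. card (axis X ` F X))"
    using F'(1) by (intro card_UN_disjoint) auto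
  also have "\<dots> = (\<Sum>X\<in>UNIV. cdim (Y X))"
    by (simp add: card_image[OF inj] cdim_orthonormal_basis[OF F])
  finally show "cdim {\<xi>. \<forall>X. \<xi> $ X \<in> Y X} = (\<Sum>X\<in>UNIV. cdim (Y X))"
    using cdim_orthonormal_basis[OF ob] by simp
qed

lemma wedge_sign_singleton: "wedge_sign {k} (U - {k}) = koszul_sign k U"
proof -
  have "{(i, j). i \<in> {k} \<and> j \<in> U - {k} \<and> j < i} = Pair k ` {j\<in>U. j < k}"
    by auto
  then have "card {(i, j). i \<in> {k} \<and> j \<in> U - {k} \<and> j < i} = card {j\<in>U. j < k}"
    by (simp only:) (simp add: card_image inj_on_def)
  then show ?thesis
    by (simp only: wedge_sign_def koszul_sign_def)
qed

lemma creation_axis: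
  "creation (axis k 1) (axis J 1) $ U = (if k \<in> U \<and> J = U - {k} then koszul_sign k U else 0)"
proof -
  have vf: "vector_form (axis k 1) = axis {k} 1"
  proof -
    have "vector_form (axis k 1) = (\<Sum>i\<in>UNIV. if i = k then axis {k} 1 else 0)"
      unfolding vector_form_def by (intro sum.cong) (auto simp: axis_def)
    then show ?thesis by simp
  qed
  have "creation (axis k 1) (axis J 1) $ U =
      (\<Sum>S\<in>Pow U. if S = {k} then wedge_sign {k} (U - {k}) * (axis J 1 $ (U - {k})) else 0)"
    unfolding creation_def vf wedge_def vec_lambda_beta
    by (intro sum.cong) (auto simp: axis_def)
  also have "\<dots> = (if k \<in> U then wedge_sign {k} (U - {k}) * (axis J 1 $ (U - {k})) else 0)"
    by (subst sum.delta) (auto intro: finite_subset)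
  finally show ?thesis
    by (simp add: wedge_sign_singleton axis_def eq_commute)
qed

text \<open>In the basis of sorted products \<open>B\<close> is the Koszul differential. Through
  this equation the theory of graded modules applies to the Dirac operator.\<close>

lemma B_op_koszul: "B_op T \<xi> $ U = koszul T (\<lambda>X. \<xi> $ X) U"
proof -
  have "B_op T \<xi> $ U = (\<Sum>k\<in>UNIV. \<Sum>J\<in>UNIV. (creation (axis k 1) (axis J 1) $ U) *\<^sub>C T k (\<xi> $ J))"
    by (simp add: B_op_def tensor_op_def)
  also have "\<dots> = (\<Sum>k\<in>UNIV. if k \<in> U then koszul_sign k U *\<^sub>C T k (\<xi> $ (U - {k})) else 0)"
  proof (rule sum.cong)
    fix k
    have "(\<Sum>J\<in>UNIV. (creation (axis k 1) (axis J 1) $ U) *\<^sub>C T k (\<xi> $ J)) =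
        (\<Sum>J\<in>UNIV. if J = U - {k} then if k \<in> U then koszul_sign k U *\<^sub>C T k (\<xi> $ (U - {k})) else 0 else 0)"
      by (intro sum.cong) (auto simp: creation_axis)
    then show "(\<Sum>J\<in>UNIV. (creation (axis k 1) (axis J 1) $ U) *\<^sub>C T k (\<xi> $ J)) =
        (if k \<in> U then koszul_sign k U *\<^sub>C T k (\<xi> $ (U - {k})) else 0)"
      by simp
  qed simp
  also have "\<dots> = koszul T (\<lambda>X. \<xi> $ X) U"
    unfolding koszul_def by (subst sum.inter_restrict[symmetric]) (auto intro: sum.cong)
  finally show ?thesis .
qed

section \<open>Homogeneous components and truncation\<close>

context graded_decomposition
begin

definition proj :: "nat \<Rightarrow> 'h \<Rightarrow> 'h"
  where "proj i x = (SOME w. w \<in> V i \<and> (\<forall>z\<in>V i. cinner (x - w) z = 0))"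

lemma proj_in: "proj i x \<in> V i" and proj_orth: "z \<in> V i \<Longrightarrow> cinner (x - proj i x) z = 0"
proof -
  have "\<exists>w. w \<in> V i \<and> (\<forall>z\<in>V i. cinner (x - w) z = 0)"
    using ex_orthogonal_remainder[OF subspace_V finite_cdim_V] by metis
  from someI_ex[OF this] show "proj i x \<in> V i" "z \<in> V i \<Longrightarrow> cinner (x - proj i x) z = 0"
    unfolding proj_def by auto
qed

lemma proj_eqI:
  assumes "w \<in> V i" "\<And>z. z \<in> V i \<Longrightarrow> cinner (x - w) z = 0"
  shows "proj i x = w"
proof -
  have "proj i x - w \<in> V i"
    using assms(1) proj_in subspace_V complex_vector.subspace_diff by blast
  then have "cinner (x - w) (proj i x - w) - cinner (x - proj i x) (proj i x - w) = 0"
    using assms(2) proj_orth by simp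
  then have "cinner ((x - w) - (x - proj i x)) (proj i x - w) = 0"
    by (simp only: cinner_diff_left[of "x - w"])
  moreover have "(x - w) - (x - proj i x) = proj i x - w" by simp
  ultimately show ?thesis by simp
qed

lemma proj_add: "proj i (x + y) = proj i x + proj i y"
  by (rule proj_eqI)
    (auto simp: proj_in complex_vector.subspace_add[OF subspace_V] add_diff_add cinner_add_left proj_orth)

lemma proj_scale: "proj i (c *\<^sub>C x) = c *\<^sub>C proj i x"
  by (rule proj_eqI)
    (auto simp: proj_in complex_vector.subspace_scale[OF subspace_V] cinner_scaleC_left proj_orth
      simp flip: complex_vector.scale_right_diff_distrib)

lemma proj_0: "proj i 0 = 0"
  by (rule proj_eqI) (auto simp: complex_vector.subspace_0[OF subspace_V])

lemma proj_sum: "proj i (\<Sum>j\<in>J. f j) = (\<Sum>j\<in>J. proj i (f j))"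
  by (induction J rule: infinite_finite_induct) (auto simp: proj_0 proj_add)

lemma proj_selfadjoint: "cinner (proj i x) y = cinner x (proj i y)"
proof -
  have "cinner (proj i x) (y - proj i y) = 0"
    using proj_orth[OF proj_in] cinner_eq_0_commute by metis
  moreover have "cinner (x - proj i x) (proj i y) = 0"
    using proj_orth[OF proj_in] by simp
  ultimately show ?thesis by (simp add: cinner_simps)
qed

lemma proj_T: "proj (Suc i) (T k x) = T k (proj i x)"
  by (rule proj_eqI)
    (auto simp: proj_in T_V T_lin(3)[symmetric] cinner_T proj_orth T_adj_V)

lemma proj_V_neq: "x \<in> V i \<Longrightarrow> i \<noteq> j \<Longrightarrow> proj j x = 0"
  by (rule proj_eqI) (auto simp: complex_vector.subspace_0[OF subspace_V] V_orthogonal)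

lemma proj_eq_0_imp: "(\<And>i. proj i x = 0) \<Longrightarrow> x = 0"
  using V_total[of x] proj_orth by (metis cinner_eq_0_commute diff_zero)

text \<open>Described by vanishing components, which makes invariance of the truncated complex under
  \<open>D\<close> immediate; \<open>orthonormal_basis_V_below\<close> identifies it with the sum of
  \<open>V 0, \<dots>, V (n - 1)\<close>.\<close>

definition V_below :: "nat \<Rightarrow> 'h set"
  where "V_below n = {x. \<forall>i\<ge>n. proj i x = 0}"

lemma V_subset_V_below: "i < n \<Longrightarrow> V i \<subseteq> V_below n"
  by (auto simp: V_below_def proj_V_neq)

lemma subspace_V_below: "complex_vector.subspace (V_below n)"
  by (auto simp: V_below_def complex_vector.subspace_def proj_0 proj_add proj_scale)

lemma orthonormal_basis_V_below:
  assumes E: "\<And>i. orthonormal_basis (V i) (E i)"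
  shows "orthonormal_basis (V_below n) (\<Union>i<n. E i)"
proof (rule orthonormal_basisI[OF subspace_V_below])
  note E' = orthonormal_basisD[OF E]
  show "finite (\<Union>i<n. E i)" using E' by auto
  show "(\<Union>i<n. E i) \<subseteq> V_below n" using E'(2) V_subset_V_below by fastforce
  show "cinner e e' = (if e = e' then 1 else 0)" if ee: "e \<in> (\<Union>i<n. E i)" "e' \<in> (\<Union>i<n. E i)" for e e'
  proof -
    obtain i j where ij: "e \<in> E i" "e' \<in> E j" using ee by auto
    show ?thesis
    proof (cases "i = j")
      case False
      then have 0: "cinner e e' = 0"
        using ij E'(2) V_orthogonal by blast
      moreover have "e \<noteq> e'"
        using 0 E'(6)[OF ij(1)] by auto
      ultimately show ?thesis by simp
    qed (use ij E'(5) in auto)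
  qed
  fix x assume x: "x \<in> V_below n" and 0: "\<And>e. e \<in> (\<Union>i<n. E i) \<Longrightarrow> cinner x e = 0"
  show "x = 0"
  proof (rule proj_eq_0_imp)
    fix i
    show "proj i x = 0"
    proof (cases "i < n")
      case True
      show ?thesis
      proof (rule proj_eqI)
        have e: "cinner x e = 0" if "e \<in> E i" for e
          using 0 True that by blast
        show "cinner (x - 0) z = 0" if "z \<in> V i" for z
          unfolding diff_zero
          by (subst orthonormal_expansion[OF E that]) (simp add: cinner_sum_right cinner_scaleC_right e)
      qed (rule complex_vector.subspace_0[OF subspace_V])
    qed (use x in \<open>auto simp: V_below_def\<close>)
  qed
qed

lemma ex_orthonormal_basis_V: "\<exists>E. \<forall>i. orthonormal_basis (V i) (E i)"
proof -
  have "\<forall>i. \<exists>E. orthonormal_basis (V i) E"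
    using ex_orthonormal_basis[OF subspace_V finite_cdim_V] by blast
  then show ?thesis by metis
qed

lemma commuting_family: "commuting_family T"
  by unfold_locales (auto simp: T_lin T_commute)

end

section \<open>Harmonic elements and the index\<close>

locale dirac_graded_decomposition = graded_decomposition T V b
  for T :: "'d::{finite,linorder} \<Rightarrow> 'h::complex_hilbert_space \<Rightarrow> 'h" and V b
begin

sublocale ordered_commuting_family T
  by (simp add: ordered_commuting_family_def commuting_family)

text \<open>From degree \<open>b\<close> on \<open>\<Delta>\<close> vanishes. The part of
  \<open>x\<close> orthogonal to all \<open>T k\<close> images of \<open>V n\<close> is killed by
  the adjoints, so it equals its image under \<open>\<Delta> \<circ> \<Delta>\<close>, which is
  zero.\<close>

lemma fin_gen_V: "fin_gen UNIV V (\<lambda>_. {0})"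
  unfolding fin_gen_def
proof (intro exI[of _ b] allI impI ballI)
  fix n x assume n: "b \<le> n" and x: "x \<in> V (Suc n)"
  define W where "W = {\<Sum>k\<in>UNIV. T k (a k) |a. \<forall>k. a k \<in> V n}"
  have TW: "T k z \<in> W" if "z \<in> V n" for k z
  proof -
    have "T k z = (\<Sum>i\<in>UNIV. T i (if i = k then z else 0))"
      by (simp add: if_distrib[of "T _"] T_lin cong: if_cong)
    then show ?thesis
      unfolding W_def mem_Collect_eq using that complex_vector.subspace_0[OF subspace_V]
      by (intro exI[of _ "\<lambda>i. if i = k then z else 0"]) auto
  qed
  have WV: "W \<subseteq> V (Suc n)"
    unfolding W_def using T_V by (auto intro!: complex_vector.subspace_sum[OF subspace_V])
  have "complex_vector.subspace W"
  proof (rule complex_vector.subspaceI)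
    show "0 \<in> W" using TW[of 0] complex_vector.subspace_0[OF subspace_V] T_lin(4) by metis
    show "u + v \<in> W" if uv: "u \<in> W" "v \<in> W" for u v
    proof -
      obtain a a' where "u = (\<Sum>k\<in>UNIV. T k (a k))" "v = (\<Sum>k\<in>UNIV. T k (a' k))"
        "\<forall>k. a k \<in> V n" "\<forall>k. a' k \<in> V n"
        using uv unfolding W_def by blast
      then have "u + v = (\<Sum>k\<in>UNIV. T k (a k + a' k))" "\<forall>k. a k + a' k \<in> V n"
        by (auto simp: T_lin sum.distrib complex_vector.subspace_add[OF subspace_V])
      then show ?thesis unfolding W_def mem_Collect_eq by (intro exI[of _ "\<lambda>k. a k + a' k"]) simp
    qed
    show "c *\<^sub>C u \<in> W" if u: "u \<in> W" for c u
    proof -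
      obtain a where "u = (\<Sum>k\<in>UNIV. T k (a k))" "\<forall>k. a k \<in> V n"
        using u unfolding W_def by blast
      then have "c *\<^sub>C u = (\<Sum>k\<in>UNIV. T k (c *\<^sub>C a k))" "\<forall>k. c *\<^sub>C a k \<in> V n"
        by (auto simp: T_lin complex_vector.scale_sum_right complex_vector.subspace_scale[OF subspace_V])
      then show ?thesis unfolding W_def mem_Collect_eq by (intro exI[of _ "\<lambda>k. c *\<^sub>C a k"]) simp
    qed
  qed
  then obtain w where w: "w \<in> W" "\<And>z. z \<in> W \<Longrightarrow> cinner (x - w) z = 0"
    using ex_orthogonal_remainder finite_cdim_subset[OF finite_cdim_V WV] by metis
  define y where "y = x - w"
  have y: "y \<in> V (Suc n)"
    unfolding y_def using x w(1) WV complex_vector.subspace_diff[OF subspace_V] by blast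
  have "T_adj k y = 0" for k
    using w(2)[OF TW[OF T_adj_V[OF y, of k], of k]] by (simp add: y_def[symmetric] cinner_T_adj[symmetric])
  then have "y = \<Delta> (\<Delta> y)"
    by (simp add: \<Delta>_\<Delta> row_sq_def T_lin)
  also have "\<dots> = 0"
    using \<Delta>_V_eq_0[OF y] n by (simp add: \<Delta>_lin)
  finally have "x = w" by (simp add: y_def)
  then obtain a where "x = (\<Sum>k\<in>UNIV. T k (a k))" "\<forall>k. a k \<in> V n"
    using w(1) unfolding W_def by blast
  then show "\<exists>a. (\<forall>k\<in>UNIV. a k \<in> V n) \<and> x - (\<Sum>k\<in>UNIV. T k (a k)) \<in> {0}"
    by (intro exI[of _ a]) simp
qed

lemma koszul_exact:
  "\<exists>m0. \<forall>m\<ge>m0. \<forall>\<xi>. (\<forall>X. \<xi> X \<in> V (m + card X)) \<longrightarrow> (\<forall>X. koszul T \<xi> X = 0) \<longrightarrow> (\<exists>\<eta>. \<forall>X. \<xi> X = koszul T \<eta> X)"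
proof -
  have "graded_mod UNIV V" "graded_mod UNIV (\<lambda>_. {0})"
    by (auto simp: graded_mod_def subspace_V T_V T_lin)
  from koszul_exact_large_degree[OF finite_class.finite_UNIV this _ finite_cdim_V fin_gen_V]
  show ?thesis
    using complex_vector.subspace_0[OF subspace_V] by (simp; metis)
qed

lemma B_op_bounded_clinear: "bounded_clinear (B_op T)"
  unfolding B_op_koszul[abs_def]
proof (rule bounded_clinear_vecI)
  fix U
  show "bounded_clinear (\<lambda>\<xi>. B_op T \<xi> $ U)"
    unfolding B_op_koszul koszul_def
  proof (rule bounded_clinear_lincomb)
    fix k
    show "bounded_clinear (\<lambda>\<xi>. T k (\<xi> $ (U - {k})))"
      using bounded_clinear_compose[OF T_bounded_clinear bounded_clinear_vec_nth] by (simp add: o_def)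
  qed
qed

lemma B_op_B_op: "B_op T (B_op T \<xi>) = 0"
proof -
  have "koszul T (\<lambda>X. B_op T \<xi> $ X) U = 0" for U
    using koszul_koszul[of U "\<lambda>X. \<xi> $ X"] by (simp add: B_op_koszul)
  then show ?thesis
    by (simp add: vec_eq_iff B_op_koszul[of T "B_op T \<xi>"])
qed

definition B_adj :: "'h^('d set) \<Rightarrow> 'h^('d set)"
  where "B_adj = cadjoint (B_op T)"

lemma cinner_B: "cinner (B_op T \<xi>) \<eta> = cinner \<xi> (B_adj \<eta>)"
  by (simp add: B_adj_def cinner_cadjoint B_op_bounded_clinear)

lemma cinner_B_adj: "cinner (B_adj \<xi>) \<eta> = cinner \<xi> (B_op T \<eta>)"
  by (simp add: B_adj_def cinner_cadjoint_left B_op_bounded_clinear)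

lemma B_adj_bounded_clinear: "bounded_clinear B_adj"
  by (simp add: B_adj_def bounded_clinear_cadjoint B_op_bounded_clinear)

lemma dirac_D_eq: "dirac_D T \<xi> = B_op T \<xi> + B_adj \<xi>"
  by (simp add: dirac_D_def B_adj_def)

lemma dirac_D_bounded_clinear: "bounded_clinear (dirac_D T)"
  unfolding dirac_D_eq[abs_def]
  by (intro bounded_clinear_add_fun B_op_bounded_clinear B_adj_bounded_clinear)

lemma dirac_D_selfadjoint: "cinner (dirac_D T \<xi>) \<eta> = cinner \<xi> (dirac_D T \<eta>)"
  by (simp add: dirac_D_eq cinner_add_left cinner_add_right cinner_B cinner_B_adj)

text \<open>Because \<open>B\<close> squares to zero, the ranges of \<open>B\<close> and
  \<open>B_adj\<close> are orthogonal, so a sum of vectors from the two vanishes only if both do.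
  Kernel elements are therefore harmonic.\<close>

lemma dirac_D_eq_0:
  assumes "dirac_D T \<xi> = 0"
  shows "B_op T \<xi> = 0" "B_adj \<xi> = 0"
proof -
  have "cinner (B_op T \<xi>) (B_adj \<xi>) = 0"
    by (simp add: cinner_B[symmetric] B_op_B_op)
  then have "(norm (B_op T \<xi>))\<^sup>2 + (norm (B_adj \<xi>))\<^sup>2 = 0"
    using norm_add_orthogonal assms by (metis dirac_D_eq norm_zero power_zero_numeral)
  then show "B_op T \<xi> = 0" "B_adj \<xi> = 0"
    by (auto simp: add_nonneg_eq_0_iff)
qed

text \<open>The projection onto the subcomplex of total degree \<open>m\<close>.\<close>

definition proj_vec :: "nat \<Rightarrow> 'h^('d set) \<Rightarrow> 'h^('d set)"
  where "proj_vec m \<xi> = (\<chi> X. proj (m + card X) (\<xi> $ X))"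

text \<open>\<open>T k\<close> raises the degree in \<open>V\<close> and \<open>e_k\<close> the
  cardinality of the index set, each by one; this keeps the offset \<open>m\<close> in
  \<open>m + card X\<close> fixed.\<close>

lemma proj_vec_B: "proj_vec m (B_op T \<xi>) = B_op T (proj_vec m \<xi>)"
proof -
  have "proj (m + card U) (koszul T (\<lambda>X. \<xi> $ X) U) = koszul T (\<lambda>X. proj (m + card X) (\<xi> $ X)) U" for U :: "'d set"
    unfolding koszul_def proj_sum
  proof (rule sum.cong)
    fix k assume "k \<in> U"
    then have "m + card U = Suc (m + card (U - {k}))"
      using card_Suc_Diff1[of U k] by simp
    then show "proj (m + card U) (koszul_sign k U *\<^sub>C T k (\<xi> $ (U - {k}))) =
        koszul_sign k U *\<^sub>C T k (proj (m + card (U - {k})) (\<xi> $ (U - {k})))"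
      by (simp add: proj_scale proj_T)
  qed simp
  then show ?thesis
    by (simp add: vec_eq_iff B_op_koszul proj_vec_def)
qed

lemma proj_vec_selfadjoint: "cinner (proj_vec m \<xi>) \<eta> = cinner \<xi> (proj_vec m \<eta>)"
  by (simp add: cinner_vec_def proj_vec_def proj_selfadjoint)

lemma proj_vec_B_adj: "proj_vec m (B_adj \<xi>) = B_adj (proj_vec m \<xi>)"
  by (rule cinner_ext_left)
    (simp add: cinner_B_adj proj_vec_selfadjoint proj_vec_B[symmetric])

lemma proj_vec_add: "proj_vec m (\<xi> + \<eta>) = proj_vec m \<xi> + proj_vec m \<eta>"
  by (simp add: vec_eq_iff proj_vec_def proj_add)

lemma proj_vec_0: "proj_vec m 0 = 0"
  by (simp add: vec_eq_iff proj_vec_def proj_0)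

lemma proj_vec_D: "proj_vec m (dirac_D T \<xi>) = dirac_D T (proj_vec m \<xi>)"
  by (simp add: dirac_D_eq proj_vec_add proj_vec_B proj_vec_B_adj)

text \<open>Where the complex is exact, a harmonic element is a boundary and at the same time killed
  by \<open>B_adj\<close>, hence orthogonal to itself.\<close>

lemma ker_D_large_degree:
  "\<exists>m0. \<forall>m\<ge>m0. \<forall>\<xi>. dirac_D T \<xi> = 0 \<longrightarrow> proj_vec m \<xi> = 0"
proof -
  obtain m0 where m0: "\<And>m \<xi>. m \<ge> m0 \<Longrightarrow> (\<And>X. \<xi> X \<in> V (m + card X)) \<Longrightarrow>
      (\<And>X. koszul T \<xi> X = 0) \<Longrightarrow> \<exists>\<eta>. \<forall>X. \<xi> X = koszul T \<eta> X"
    using koszul_exact by metis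
  have "proj_vec m \<xi> = 0" if m: "m \<ge> m0" and D: "dirac_D T \<xi> = 0" for m \<xi>
  proof -
    define \<zeta> where "\<zeta> = proj_vec m \<xi>"
    have "dirac_D T \<zeta> = 0"
      by (simp add: \<zeta>_def proj_vec_D[symmetric] D proj_vec_0)
    note \<zeta> = dirac_D_eq_0[OF this]
    have "\<exists>\<eta>. \<forall>X. \<zeta> $ X = koszul T \<eta> X"
    proof (rule m0[OF m])
      show "\<zeta> $ X \<in> V (m + card X)" for X
        by (simp add: \<zeta>_def proj_vec_def proj_in)
      show "koszul T (($) \<zeta>) X = 0" for X
        using \<zeta>(1) by (simp add: B_op_koszul[symmetric])
    qed
    then obtain \<eta> where \<eta>: "\<And>X. \<zeta> $ X = koszul T \<eta> X" by blast
    have "\<zeta> = B_op T (\<chi> X. \<eta> X)"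
      by (simp add: vec_eq_iff B_op_koszul \<eta>)
    then have "cinner \<zeta> \<zeta> = 0"
      using cinner_B[of "\<chi> X. \<eta> X" \<zeta>] \<zeta>(2) by simp
    then show ?thesis by (simp add: \<zeta>_def)
  qed
  then show ?thesis by blast
qed

lemma B_even_odd:
  shows "\<xi> \<in> even_part \<Longrightarrow> B_op T \<xi> \<in> odd_part" "\<xi> \<in> odd_part \<Longrightarrow> B_op T \<xi> \<in> even_part"
proof -
  have *: "B_op T \<xi> $ U = 0" if "\<And>k. k \<in> U \<Longrightarrow> \<xi> $ (U - {k}) = 0" for \<xi> U
    using that by (simp add: B_op_koszul koszul_def T_lin)
  have card: "even (card (U - {k})) \<longleftrightarrow> odd (card U)" if "k \<in> U" for k :: 'd and U
    using card_Suc_Diff1[of U k] that by (metis even_Suc finite)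
  show "B_op T \<xi> \<in> odd_part" if "\<xi> \<in> even_part"
    unfolding odd_part_def mem_Collect_eq
  proof (intro allI impI *)
    fix U and k :: 'd assume "even (card U)" "k \<in> U"
    then show "\<xi> $ (U - {k}) = 0"
      using card[of k U] that unfolding even_part_def by blast
  qed
  show "B_op T \<xi> \<in> even_part" if "\<xi> \<in> odd_part"
    unfolding even_part_def mem_Collect_eq
  proof (intro allI impI *)
    fix U and k :: 'd assume "odd (card U)" "k \<in> U"
    then show "\<xi> $ (U - {k}) = 0"
      using card[of k U] that unfolding odd_part_def by blast
  qed
qed

lemma cinner_even_odd: "\<xi> \<in> even_part \<Longrightarrow> \<eta> \<in> odd_part \<Longrightarrow> cinner \<xi> \<eta> = 0"
  unfolding cinner_vec_def
proof (rule sum.neutral, rule ballI)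
  fix S assume "\<xi> \<in> even_part" "\<eta> \<in> odd_part"
  then show "cinner (\<xi> $ S) (\<eta> $ S) = 0"
    by (cases "even (card S)") (auto simp: even_part_def odd_part_def)
qed

lemma axis_even_odd: "even (card X) \<Longrightarrow> axis X y \<in> even_part" "odd (card X) \<Longrightarrow> axis X y \<in> odd_part"
  by (auto simp: even_part_def odd_part_def axis_def)

lemma B_adj_even_odd:
  shows "\<xi> \<in> even_part \<Longrightarrow> B_adj \<xi> \<in> odd_part" "\<xi> \<in> odd_part \<Longrightarrow> B_adj \<xi> \<in> even_part"
proof -
  have *: "B_adj \<xi> $ X = 0" if "\<And>y. cinner \<xi> (B_op T (axis X y)) = 0" for \<xi> X
  proof -
    have "cinner (B_adj \<xi> $ X) (B_adj \<xi> $ X) = cinner \<xi> (B_op T (axis X (B_adj \<xi> $ X)))"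
      by (simp add: cinner_B_adj[symmetric] cinner_axis_right)
    then show ?thesis using that by simp
  qed
  show "B_adj \<xi> \<in> odd_part" if "\<xi> \<in> even_part"
    using that by (auto simp: odd_part_def intro!: * cinner_even_odd B_even_odd axis_even_odd)
  show "B_adj \<xi> \<in> even_part" if \<xi>: "\<xi> \<in> odd_part"
  proof -
    have "cinner \<xi> (B_op T (axis X y)) = 0" if "odd (card X)" for X y
      using cinner_even_odd[OF B_even_odd(2)[OF axis_even_odd(2)[OF that]] \<xi>] cinner_eq_0_commute by blast
    then show ?thesis by (auto simp: even_part_def intro!: *)
  qed
qed

lemma dirac_D_even_odd:
  shows "\<xi> \<in> even_part \<Longrightarrow> dirac_D T \<xi> \<in> odd_part" "\<xi> \<in> odd_part \<Longrightarrow> dirac_D T \<xi> \<in> even_part"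
proof -
  have "\<xi> + \<eta> \<in> even_part" if "\<xi> \<in> even_part" "\<eta> \<in> even_part" for \<xi> \<eta> :: "'h^('d set)"
    using that by (auto simp: even_part_def)
  moreover have "\<xi> + \<eta> \<in> odd_part" if "\<xi> \<in> odd_part" "\<eta> \<in> odd_part" for \<xi> \<eta> :: "'h^('d set)"
    using that by (auto simp: odd_part_def)
  ultimately show "\<xi> \<in> even_part \<Longrightarrow> dirac_D T \<xi> \<in> odd_part" "\<xi> \<in> odd_part \<Longrightarrow> dirac_D T \<xi> \<in> even_part"
    by (simp_all add: dirac_D_eq B_even_odd B_adj_even_odd)
qed

text \<open>For large \<open>m\<close> the finite-dimensional, \<open>D\<close>-invariant truncation
  \<open>W m\<close> contains both kernels. On it the index is just the difference of the dimensions
  of the even and odd parts, and these are sums over the index sets \<open>X\<close>.\<close>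

theorem dirac_index:
  "finite_cdim (ker_on even_part (dirac_D T)) \<and> finite_cdim (ker_on odd_part (dirac_D T)) \<and>
    (\<exists>m0. \<forall>m\<ge>m0. (\<Sum>X\<in>Pow (UNIV :: 'd set). (-1) ^ card X * real (cdim (V_below (m + card X)))) =
      real (cdim (ker_on even_part (dirac_D T))) - real (cdim (ker_on odd_part (dirac_D T))))"
proof -
  obtain m0 where m0: "\<And>m \<xi>. m \<ge> m0 \<Longrightarrow> dirac_D T \<xi> = 0 \<Longrightarrow> proj_vec m \<xi> = 0"
    using ker_D_large_degree by blast
  define W where "W m = {\<xi> :: 'h^('d set). \<forall>X. \<xi> $ X \<in> V_below (m + card X)}" for m
  have W: "\<xi> \<in> W m \<longleftrightarrow> (\<forall>n\<ge>m. proj_vec n \<xi> = 0)" for \<xi> m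
  proof -
    have "(\<forall>n\<ge>m. proj_vec n \<xi> = 0) \<longleftrightarrow> (\<forall>X. \<forall>n\<ge>m. proj (n + card X) (\<xi> $ X) = 0)"
      by (auto simp: proj_vec_def vec_eq_iff)
    also have "\<dots> \<longleftrightarrow> (\<forall>X. \<forall>i\<ge>m + card X. proj i (\<xi> $ X) = 0)"
      by (metis add_le_cancel_right add_leE le_add_diff_inverse2)
    finally show ?thesis by (simp add: W_def V_below_def)
  qed
  have DW: "dirac_D T \<xi> \<in> W m" if "\<xi> \<in> W m" for \<xi> m
    using that bounded_clinear_0[OF dirac_D_bounded_clinear] by (simp add: W proj_vec_D)
  obtain E where E: "\<And>i. orthonormal_basis (V i) (E i)"
    using ex_orthonormal_basis_V by blast
  note Vb = orthonormal_basis_V_below[OF E]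
  have triv: "orthonormal_basis {0::'h} {}"
    by (simp add: orthonormal_basis_def)
  \<comment> \<open>\<open>Y True\<close> and \<open>Y False\<close> present the even and the odd
    part of \<open>W m\<close> as products over all \<open>X\<close>, with zero factors for the
    wrong parity.\<close>
  define Y where "Y p m X = (if even (card X) = p then V_below (m + card X) else {0})" for p m and X :: "'d set"
  define G where "G p m X = (if even (card X) = p then (\<Union>i<m + card X. E i) else {})" for p m and X :: "'d set"
  have YG: "orthonormal_basis (Y p m X) (G p m X)" for p m X
    using Vb triv by (simp add: Y_def G_def)
  have "(0::'h) \<in> V_below n" for n
    by (rule complex_vector.subspace_0[OF subspace_V_below])
  then have WY: "W m \<inter> even_part = {\<xi>. \<forall>X. \<xi> $ X \<in> Y True m X}" "W m \<inter> odd_part = {\<xi>. \<forall>X. \<xi> $ X \<in> Y False m X}" for m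
    by (auto simp: W_def Y_def even_part_def odd_part_def) (metis)+
  have ob: "orthonormal_basis {\<xi>. \<forall>X. \<xi> $ X \<in> Y p m X} (\<Union>X. axis X ` G p m X)" for p m
    by (rule orthonormal_basis_product(1)[OF YG])
  have cd: "cdim {\<xi>. \<forall>X. \<xi> $ X \<in> Y p m X} = (\<Sum>X\<in>UNIV. cdim (Y p m X))" for p m
    by (rule orthonormal_basis_product(2)[OF YG])
  have fd: "finite_cdim (W m \<inter> even_part)" "finite_cdim (W m \<inter> odd_part)"
    and sub: "complex_vector.subspace (W m \<inter> even_part)" "complex_vector.subspace (W m \<inter> odd_part)" for m
    unfolding WY by (rule orthonormal_basisD(3,4)[OF ob])+
  have ker: "ker_on even_part (dirac_D T) = ker_on (W m \<inter> even_part) (dirac_D T)"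
    "ker_on odd_part (dirac_D T) = ker_on (W m \<inter> odd_part) (dirac_D T)" if "m \<ge> m0" for m
    using m0 that by (auto simp: ker_on_def W)
  have "(\<Sum>X\<in>Pow (UNIV :: 'd set). (-1) ^ card X * real (cdim (V_below (m + card X)))) =
      real (cdim (ker_on even_part (dirac_D T))) - real (cdim (ker_on odd_part (dirac_D T)))"
    if m: "m \<ge> m0" for m
  proof -
    have "int (cdim (ker_on (W m \<inter> even_part) (dirac_D T))) - int (cdim (ker_on (W m \<inter> odd_part) (dirac_D T))) =
        int (cdim (W m \<inter> even_part)) - int (cdim (W m \<inter> odd_part))"
      by (rule index_selfadjoint_pair[OF fd sub])
        (auto simp: bounded_clinear_add[OF dirac_D_bounded_clinear] bounded_clinear_scaleC[OF dirac_D_bounded_clinear]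
          dirac_D_selfadjoint DW dirac_D_even_odd)
    then have "int (cdim (ker_on even_part (dirac_D T))) - int (cdim (ker_on odd_part (dirac_D T))) =
        (\<Sum>X\<in>UNIV. int (cdim (Y True m X)) - int (cdim (Y False m X)))"
      using ker[OF m] by (simp add: WY cd sum_subtractf)
    also have "\<dots> = (\<Sum>X\<in>(UNIV :: 'd set set). (-1) ^ card X * int (cdim (V_below (m + card X))))"
    proof (rule sum.cong)
      fix X :: "'d set"
      have "cdim {0::'h} = 0" using cdim_orthonormal_basis[OF triv] by simp
      then show "int (cdim (Y True m X)) - int (cdim (Y False m X)) = (-1) ^ card X * int (cdim (V_below (m + card X)))"
        by (cases "even (card X)") (simp_all add: Y_def)
    qed simp
    finally have "real_of_int (int (cdim (ker_on even_part (dirac_D T))) - int (cdim (ker_on odd_part (dirac_D T)))) =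
        real_of_int (\<Sum>X\<in>(UNIV :: 'd set set). (-1) ^ card X * int (cdim (V_below (m + card X))))"
      by (rule arg_cong)
    then show ?thesis by (simp add: Pow_UNIV)
  qed
  moreover have "finite_cdim (ker_on even_part (dirac_D T))" "finite_cdim (ker_on odd_part (dirac_D T))"
    using finite_cdim_subset[OF fd(1)[of m0]] finite_cdim_subset[OF fd(2)[of m0]] ker[of m0]
    by (auto simp: ker_on_def)
  ultimately show ?thesis by blast
qed

end

section \<open>Asymptotics of polynomial growth\<close>

text \<open>The Stolz-Cesaro theorem in terms of increments: from some index on \<open>a n\<close>
  differs from \<open>L * b n\<close> by at most \<open>e / 2 * b n\<close>, and the finitely many
  earlier terms disappear against the diverging denominator.\<close>

lemma stolz_cesaro_sum:
  fixes a b :: "nat \<Rightarrow> real"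
  assumes b: "\<And>n. 0 \<le> b n" and div: "filterlim (\<lambda>n. \<Sum>i<n. b i) at_top sequentially"
    and lim: "(\<lambda>n. a n / b n) \<longlonglongrightarrow> L" and pos: "eventually (\<lambda>n. 0 < b n) sequentially"
  shows "(\<lambda>n. (\<Sum>i<n. a i) / (\<Sum>i<n. b i)) \<longlonglongrightarrow> L"
proof (rule LIMSEQ_I)
  fix e :: real assume e: "0 < e"
  have "eventually (\<lambda>n. \<bar>a n / b n - L\<bar> < e / 2) sequentially"
    using tendstoD[OF lim, of "e / 2"] e by (simp add: dist_real_def)
  with pos have "eventually (\<lambda>n. \<bar>a n - L * b n\<bar> \<le> e / 2 * b n) sequentially"
  proof eventually_elim
    case (elim n)
    have "a n - L * b n = (a n / b n - L) * b n"
      using elim(1) by (simp add: field_simps)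
    then show ?case
      using elim by (simp add: abs_mult mult_right_mono)
  qed
  then obtain N where N: "\<And>n. n \<ge> N \<Longrightarrow> \<bar>a n - L * b n\<bar> \<le> e / 2 * b n"
    by (auto simp: eventually_sequentially)
  define C where "C = \<bar>\<Sum>i<N. a i - L * b i\<bar>"
  define B where "B n = (\<Sum>i<n. b i)" for n
  have est: "\<bar>\<Sum>i<n. a i - L * b i\<bar> \<le> C + e / 2 * B n" if n: "n \<ge> N" for n
    using n
  proof (induction n rule: dec_induct)
    case base
    then show ?case using e b by (simp add: C_def B_def sum_nonneg)
  next
    case (step n)
    have "\<bar>\<Sum>i<Suc n. a i - L * b i\<bar> \<le> \<bar>\<Sum>i<n. a i - L * b i\<bar> + \<bar>a n - L * b n\<bar>"
      by simp
    also have "\<dots> \<le> (C + e / 2 * B n) + e / 2 * b n"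
      using step.IH N[OF step.hyps(1)] by (rule add_mono)
    also have "\<dots> = C + e / 2 * B (Suc n)"
      by (simp add: B_def algebra_simps)
    finally show ?case .
  qed
  \<comment> \<open>\<open>4 * C / e \<le> B n\<close> makes \<open>C / B n\<close> at most
    \<open>e / 4\<close>, and \<open>1 \<le> B n\<close> permits the division.\<close>
  have "eventually (\<lambda>n. max 1 (4 * C / e) \<le> B n) sequentially"
    using div unfolding B_def filterlim_at_top by blast
  then obtain M where M: "\<And>n. n \<ge> M \<Longrightarrow> max 1 (4 * C / e) \<le> B n"
    by (auto simp: eventually_sequentially)
  show "\<exists>no. \<forall>n\<ge>no. norm ((\<Sum>i<n. a i) / (\<Sum>i<n. b i) - L) < e"
  proof (intro exI allI impI)
    fix n assume n: "max M N \<le> n"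
    have Bn: "1 \<le> B n" "4 * C / e \<le> B n" using M[of n] n by auto
    have "(\<Sum>i<n. a i) / B n - L = (\<Sum>i<n. a i - L * b i) / B n"
      using Bn(1) by (simp add: B_def sum_subtractf sum_distrib_left[symmetric] field_simps)
    then have "\<bar>(\<Sum>i<n. a i) / B n - L\<bar> \<le> (C + e / 2 * B n) / B n"
      using est[of n] n Bn(1) by (simp add: divide_right_mono)
    also have "\<dots> = C / B n + e / 2"
      using Bn(1) by (simp add: field_simps)
    also have "C / B n \<le> e / 4"
      using Bn e by (simp add: field_simps)
    finally show "norm ((\<Sum>i<n. a i) / (\<Sum>i<n. b i) - L) < e"
      using e by (simp add: B_def)
  qed
qed

lemma sum_choose_lessThan: "(\<Sum>i<n. i choose d) = n choose Suc d"
  by (induction n) auto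

lemma filterlim_choose_at_top: "filterlim (\<lambda>n. real (n choose Suc d)) at_top sequentially"
proof (rule filterlim_at_top_mono)
  show "filterlim (\<lambda>n. real n - real d) at_top sequentially"
    by real_asymp
  have "real n - real d \<le> real (n choose Suc d)" for n
  proof (cases "Suc d \<le> n")
    case True
    have "n - d \<le> n choose Suc d"
      using True
    proof (induction n rule: dec_induct)
      case (step n)
      have "1 \<le> n choose d" using step.hyps by (simp add: Suc_leI)
      then show ?case using step by simp
    qed simp
    then show ?thesis using True by linarith
  qed auto
  then show "eventually (\<lambda>n. real n - real d \<le> real (n choose Suc d)) sequentially"
    by simp
qed

text \<open>The left-hand side of the assumption is, up to the sign \<open>(-1) ^ card S\<close>, the iterated
  difference of order \<open>card S\<close> of \<open>f\<close>.\<close>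

lemma alternating_sum_asymptotics:
  fixes f :: "nat \<Rightarrow> real"
  assumes "finite S" "\<And>m. m \<ge> m0 \<Longrightarrow> (\<Sum>X\<in>Pow S. (-1) ^ card X * f (m + card X)) = c"
  shows "(\<lambda>n. f n / real (n choose card S)) \<longlonglongrightarrow> (-1) ^ card S * c"
  using assms
proof (induction S arbitrary: f c rule: finite_induct)
  case empty
  then have "eventually (\<lambda>n. f n = c) sequentially"
    by (auto simp: eventually_sequentially)
  then show ?case
    by (simp add: tendsto_eventually)
next
  case (insert s S)
  define g where "g m = f (Suc m) - f m" for m
  \<comment> \<open>Splitting the subsets of \<open>insert s S\<close> by membership of
    \<open>s\<close> gives the sum over \<open>Pow S\<close> for the negated forward difference of
    \<open>f\<close>.\<close>
  have "(\<Sum>X\<in>Pow S. (-1) ^ card X * g (m + card X)) = - c" if "m \<ge> m0" for m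
  proof -
    have "c = (\<Sum>X\<in>Pow (insert s S). (-1) ^ card X * f (m + card X))"
      using insert.prems that by simp
    also have "\<dots> = (\<Sum>X\<in>Pow S. (-1) ^ card X * f (m + card X)) +
        (\<Sum>X\<in>insert s ` Pow S. (-1) ^ card X * f (m + card X))"
      unfolding Pow_insert using insert.hyps by (intro sum.union_disjoint) auto
    also have "(\<Sum>X\<in>insert s ` Pow S. (-1) ^ card X * f (m + card X)) =
        (\<Sum>X\<in>Pow S. - ((-1) ^ card X * f (Suc (m + card X))))"
    proof (subst sum.reindex)
      show "inj_on (insert s) (Pow S)"
        using insert.hyps by (auto simp: inj_on_def)
      show "sum ((\<lambda>X. (-1) ^ card X * f (m + card X)) \<circ> insert s) (Pow S) =
          (\<Sum>X\<in>Pow S. - ((-1) ^ card X * f (Suc (m + card X))))"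
      proof (rule sum.cong)
        fix X assume "X \<in> Pow S"
        then have "card (insert s X) = Suc (card X)"
          using insert.hyps by (intro card_insert_disjoint) (auto intro: finite_subset)
        then show "((\<lambda>X. (-1) ^ card X * f (m + card X)) \<circ> insert s) X = - ((-1) ^ card X * f (Suc (m + card X)))"
          by simp
      qed simp
    qed
    finally show ?thesis
      by (simp add: g_def sum_negf sum_subtractf right_diff_distrib)
  qed
  from insert.IH[OF this] have lim: "(\<lambda>n. g n / real (n choose card S)) \<longlonglongrightarrow> (-1) ^ card S * - c"
    by simp
  have sumb: "(\<Sum>i<n. real (i choose card S)) = real (n choose Suc (card S))" for n
    by (simp only: of_nat_sum[symmetric] sum_choose_lessThan)
  have suma: "(\<Sum>i<n. g i) = f n - f 0" for n
    by (induction n) (auto simp: g_def)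
  have ev: "eventually (\<lambda>n. 0 < real (n choose card S)) sequentially"
    unfolding eventually_sequentially by (intro exI[of _ "card S"]) simp
  have "(\<lambda>n. (f n - f 0) / real (n choose Suc (card S))) \<longlonglongrightarrow> (-1) ^ card S * - c"
    using stolz_cesaro_sum[OF _ _ lim ev] filterlim_choose_at_top by (simp add: sumb suma)
  moreover have "(\<lambda>n. f 0 / real (n choose Suc (card S))) \<longlonglongrightarrow> 0"
    by (intro tendsto_divide_0[OF tendsto_const] filterlim_at_top_imp_at_infinity filterlim_choose_at_top)
  ultimately have "(\<lambda>n. (f n - f 0) / real (n choose Suc (card S)) + f 0 / real (n choose Suc (card S)))
      \<longlonglongrightarrow> (-1) ^ card S * - c + 0"
    by (rule tendsto_add)
  then show ?case
    using insert.hyps by (simp add: diff_divide_distrib)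
qed

text \<open>One step multiplies by \<open>(n + 1) / (n + 1 - d)\<close>. Finite shifts of
  \<open>n\<close> may thus be ignored in the asymptotics.\<close>

lemma choose_ratio_tendsto_1: "(\<lambda>n. real ((n + k) choose d) / real (n choose d)) \<longlonglongrightarrow> 1"
proof (induction k)
  case 0
  have "eventually (\<lambda>n. real (n choose d) / real (n choose d) = 1) sequentially"
    unfolding eventually_sequentially by (intro exI[of _ d]) auto
  then show ?case by (simp add: tendsto_eventually)
next
  case (Suc k)
  have step: "(\<lambda>n. real (Suc n choose d) / real (n choose d)) \<longlonglongrightarrow> 1"
  proof -
    have "(\<lambda>n. real (n + 1) / (real n + 1 - real d)) \<longlonglongrightarrow> 1"
      by real_asymp
    moreover have "eventually (\<lambda>n. real (n + 1) / (real n + 1 - real d) = real (Suc n choose d) / real (n choose d)) sequentially"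
      unfolding eventually_sequentially
    proof (intro exI[of _ d] allI impI)
      fix n assume n: "d \<le> n"
      have "(Suc n - d) * (Suc n choose d) = Suc n * (n choose d)"
        using binomial_absorb_comp[of "Suc n" d] by simp
      then have "real (Suc n - d) * real (Suc n choose d) = real (Suc n) * real (n choose d)"
        by (simp only: of_nat_mult[symmetric])
      moreover have "real (Suc n - d) = real n + 1 - real d"
        using n by simp
      ultimately show "real (n + 1) / (real n + 1 - real d) = real (Suc n choose d) / real (n choose d)"
        using n by (simp add: field_simps)
    qed
    ultimately show ?thesis
      by (rule Lim_transform_eventually)
  qed
  have "(\<lambda>n. real (Suc (n + k) choose d) / real ((n + k) choose d)) \<longlonglongrightarrow> 1"
    using LIMSEQ_ignore_initial_segment[OF step, of k] by simp
  from tendsto_mult[OF this Suc] have "(\<lambda>n. real (Suc (n + k) choose d) / real ((n + k) choose d) *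
      (real ((n + k) choose d) / real (n choose d))) \<longlonglongrightarrow> 1" by simp
  moreover have "eventually (\<lambda>n. real (Suc (n + k) choose d) / real ((n + k) choose d) *
      (real ((n + k) choose d) / real (n choose d)) = real ((n + Suc k) choose d) / real (n choose d)) sequentially"
    unfolding eventually_sequentially by (intro exI[of _ d]) auto
  ultimately show ?case
    by (rule Lim_transform_eventually)
qed

text \<open>With \<open>q = r\<^sup>2\<close> the weights \<open>(1 - q) * q ^ n\<close> add up to
  \<open>1\<close>. The first \<open>N\<close> terms contribute at most \<open>(1 - q) * C\<close>,
  which tends to \<open>0\<close>, the others at most \<open>e / 2\<close>.\<close>

lemma abel_limit_means:
  fixes a :: "nat \<Rightarrow> real"
  assumes a: "a \<longlonglongrightarrow> L" and bd: "\<And>n. \<bar>a n\<bar> \<le> K"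
  shows "((\<lambda>r. (1 - r\<^sup>2) * (\<Sum>n. r ^ (2 * n) * a n)) \<longlongrightarrow> L) (at_left 1)"
proof (rule tendstoI)
  fix e :: real assume e: "0 < e"
  have "eventually (\<lambda>n. \<bar>a n - L\<bar> < e / 2) sequentially"
    using tendstoD[OF a, of "e / 2"] e by (simp add: dist_real_def)
  then obtain N where N: "\<And>n. n \<ge> N \<Longrightarrow> \<bar>a n - L\<bar> \<le> e / 2"
    by (force simp: eventually_sequentially)
  define C where "C = (\<Sum>n<N. \<bar>a n - L\<bar>)"
  have C: "0 \<le> C" by (simp add: C_def sum_nonneg)
  have est: "\<bar>(1 - r\<^sup>2) * (\<Sum>n. r ^ (2 * n) * a n) - L\<bar> \<le> (1 - r\<^sup>2) * C + e / 2"
    if r: "0 < r" "r < 1" for r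
  proof -
    define q where "q = r\<^sup>2"
    have q: "0 < q" "q < 1" using r by (auto simp: q_def power_less_one_iff)
    have qn: "r ^ (2 * n) = q ^ n" for n by (simp add: q_def power_mult)
    have sq: "summable (\<lambda>n. q ^ n)" and gs: "(\<Sum>n. q ^ n) = 1 / (1 - q)"
      using q by (auto intro: summable_geometric suminf_geometric)
    have sa: "summable (\<lambda>n. q ^ n * a n)"
    proof (rule summable_comparison_test'[of "\<lambda>n. q ^ n * K"])
      show "summable (\<lambda>n. q ^ n * K)" using sq by (rule summable_mult2)
      show "norm (q ^ n * a n) \<le> q ^ n * K" for n
        using bd[of n] q by (simp add: abs_mult)
    qed
    have s1: "summable (\<lambda>n. q ^ n * \<bar>a n - L\<bar>)"
    proof (rule summable_comparison_test'[of "\<lambda>n. q ^ n * (K + \<bar>L\<bar>)"])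
      show "summable (\<lambda>n. q ^ n * (K + \<bar>L\<bar>))" using sq by (rule summable_mult2)
      show "norm (q ^ n * \<bar>a n - L\<bar>) \<le> q ^ n * (K + \<bar>L\<bar>)" for n
        using bd[of n] q by (simp add: abs_mult)
    qed
    define h where "h n = (if n < N then \<bar>a n - L\<bar> else 0)" for n
    have h: "h sums C"
      unfolding h_def C_def using sums_If_finite_set[of "{..<N}" "\<lambda>n. \<bar>a n - L\<bar>"] by simp
    have "(1 - q) * (\<Sum>n. q ^ n * a n) - L = (1 - q) * ((\<Sum>n. q ^ n * a n) - (\<Sum>n. q ^ n * L))"
      using q by (simp add: suminf_mult2[OF sq, symmetric] gs right_diff_distrib)
    also have "(\<Sum>n. q ^ n * a n) - (\<Sum>n. q ^ n * L) = (\<Sum>n. q ^ n * (a n - L))"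
      using sa summable_mult2[OF sq] by (simp add: suminf_diff right_diff_distrib)
    finally have "\<bar>(1 - q) * (\<Sum>n. q ^ n * a n) - L\<bar> = (1 - q) * \<bar>\<Sum>n. q ^ n * (a n - L)\<bar>"
      using q by (simp add: abs_mult)
    also have "\<bar>\<Sum>n. q ^ n * (a n - L)\<bar> \<le> (\<Sum>n. q ^ n * \<bar>a n - L\<bar>)"
      using summable_rabs[of "\<lambda>n. q ^ n * (a n - L)"] s1 q by (simp add: abs_mult)
    also have "\<dots> \<le> (\<Sum>n. h n + q ^ n * (e / 2))"
    proof (rule suminf_le[OF _ s1])
      show "summable (\<lambda>n. h n + q ^ n * (e / 2))"
        using h sq by (intro summable_add summable_mult2) (auto simp: sums_iff)
      show "q ^ n * \<bar>a n - L\<bar> \<le> h n + q ^ n * (e / 2)" for n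
      proof (cases "n < N")
        case True
        have "q ^ n * \<bar>a n - L\<bar> \<le> \<bar>a n - L\<bar>"
          using q by (intro mult_left_le_one_le) (auto simp: power_le_one)
        then show ?thesis using True q e by (simp add: h_def add_increasing2)
      next
        case False
        then show ?thesis using N[of n] q by (simp add: h_def)
      qed
    qed
    also have "\<dots> = C + e / 2 / (1 - q)"
    proof -
      have "(\<lambda>n. q ^ n * (e / 2)) sums (1 / (1 - q) * (e / 2))"
        using sq gs by (intro sums_mult2) (auto simp: sums_iff)
      from sums_add[OF h this] show ?thesis
        by (simp add: sums_iff)
    qed
    finally have "\<bar>(1 - q) * (\<Sum>n. q ^ n * a n) - L\<bar> \<le> (1 - q) * (C + e / 2 / (1 - q))"
      using q by simp
    also have "\<dots> = (1 - q) * C + e / 2"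
      using q by (simp add: field_simps)
    finally show ?thesis by (simp only: qn q_def)
  qed
  have "((\<lambda>r. (1 - r\<^sup>2) * C + e / 2) \<longlongrightarrow> (1 - 1\<^sup>2) * C + e / 2) (at_left (1::real))"
    by (intro tendsto_intros)
  then have "eventually (\<lambda>r. (1 - r\<^sup>2) * C + e / 2 < e) (at_left (1::real))"
    using e order_tendstoD(2)[of _ "e / 2" _ e] by auto
  moreover have "eventually (\<lambda>r::real. 0 < r \<and> r < 1) (at_left 1)"
    using eventually_at_left_real[of 0 "1::real"] by (simp add: eventually_mono)
  ultimately show "eventually (\<lambda>r. dist ((1 - r\<^sup>2) * (\<Sum>n. r ^ (2 * n) * a n)) L < e) (at_left 1)"
  proof eventually_elim
    case (elim r)
    then show ?case using est[of r] by (simp add: dist_real_def)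
  qed
qed

section \<open>The curvature invariant\<close>

lemma cadjoint_norm_le:
  assumes A: "bounded_clinear A" and "0 \<le> K" and K: "\<And>x. norm (A x) \<le> K * norm x"
  shows "norm (cadjoint A y) \<le> K * norm y"
proof (cases "cadjoint A y = 0")
  case True
  then show ?thesis using assms(2) by simp
next
  case False
  have "(norm (cadjoint A y))\<^sup>2 = norm (cinner y (A (cadjoint A y)))"
    by (simp add: cinner_cadjoint_left[OF A, symmetric] cinner_same norm_power)
  also have "\<dots> \<le> norm y * (K * norm (cadjoint A y))"
    using norm_cinner_le K by (meson mult_left_mono norm_ge_zero order.trans)
  finally show ?thesis
    using False by (simp add: power2_eq_square algebra_simps)
qed

lemma neumann_series:
  fixes A :: "'a::complex_hilbert_space \<Rightarrow> 'a"
  assumes A: "bounded_clinear A" and r: "0 \<le> r" "r < 1" and K: "\<And>x. norm (A x) \<le> r * norm x"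
  shows "bij (\<lambda>x. x - A x)" "(\<lambda>n. (A ^^ n) y) sums inv (\<lambda>x. x - A x) y"
proof -
  have pw: "norm ((A ^^ n) y) \<le> r ^ n * norm y" for n y
  proof (induction n)
    case (Suc n)
    have "norm ((A ^^ Suc n) y) \<le> r * norm ((A ^^ n) y)" using K by simp
    also have "\<dots> \<le> r * (r ^ n * norm y)" using Suc r(1) by (rule mult_left_mono)
    finally show ?case by simp
  qed simp
  have sm: "summable (\<lambda>n. (A ^^ n) y)" for y
    using r by (intro summable_comparison_test'[OF summable_mult2[OF summable_geometric] pw]) auto
  define s where "s y = (\<Sum>n. (A ^^ n) y)" for y
  have s: "(\<lambda>n. (A ^^ n) y) sums s y" for y
    unfolding s_def using sm by (rule summable_sums)
  have inv1: "s y - A (s y) = y" for y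
  proof -
    have bl: "bounded_linear A" using A by (simp add: bounded_clinear_def)
    have "(\<lambda>n. (A ^^ Suc n) y) sums A (s y)"
      using bounded_linear.sums[OF bl s[of y]] by simp
    moreover have "(\<lambda>n. (A ^^ Suc n) y) sums (s y - y)"
      using s[of y] by (subst sums_Suc_iff) simp
    ultimately have "A (s y) = s y - y"
      by (rule sums_unique2)
    then show ?thesis by simp
  qed
  have inj: "inj (\<lambda>x. x - A x)"
  proof (rule injI)
    fix x z assume "x - A x = z - A z"
    then have "x - z = A (x - z)"
      by (simp add: bounded_clinear_diff[OF A] algebra_simps)
    then have "norm (x - z) \<le> r * norm (x - z)"
      using K[of "x - z"] by simp
    then have "(1 - r) * norm (x - z) \<le> 0"
      by (simp add: algebra_simps)
    then show "x = z"
      using r by (simp add: mult_le_0_iff)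
  qed
  moreover have "surj (\<lambda>x. x - A x)"
    using inv1 by (rule surjI)
  ultimately show "bij (\<lambda>x. x - A x)" by (rule bijI)
  have "inv (\<lambda>x. x - A x) y = s y"
    using inv_f_f[OF inj, of "s y"] inv1 by simp
  then show "(\<lambda>n. (A ^^ n) y) sums inv (\<lambda>x. x - A x) y"
    using s by simp
qed

lemma sums_norm_orthogonal:
  fixes f :: "nat \<Rightarrow> 'a::complex_hilbert_space"
  assumes "f sums s" "\<And>m n. m \<noteq> n \<Longrightarrow> cinner (f m) (f n) = 0"
  shows "(\<lambda>n. (norm (f n))\<^sup>2) sums (norm s)\<^sup>2"
proof -
  have "(\<lambda>n. (norm (\<Sum>i<n. f i))\<^sup>2) \<longlonglongrightarrow> (norm s)\<^sup>2"
    using assms(1) unfolding sums_def by (intro tendsto_power tendsto_norm)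
  moreover have "(norm (\<Sum>i<n. f i))\<^sup>2 = (\<Sum>i<n. (norm (f i))\<^sup>2)" for n
    using assms(2) by (intro norm_sum_orthogonal) auto
  ultimately show ?thesis by (simp add: sums_def)
qed

text \<open>Each side expands into the same double sum over pairs from both bases. The point is that
  \<open>trace_on\<close> uses an unspecified basis whereas the estimates require a homogeneous
  one.\<close>

lemma hilbert_schmidt_basis_independent:
  fixes C :: "'a::complex_hilbert_space \<Rightarrow> 'b::complex_hilbert_space"
  assumes E: "orthonormal_basis Z E" and E': "orthonormal_basis Z E'"
    and C: "\<And>x y. C (x + y) = C x + C y" "\<And>c x. C (c *\<^sub>C x) = c *\<^sub>C C x"
  shows "(\<Sum>e\<in>E. (norm (C e))\<^sup>2) = (\<Sum>f\<in>E'. (norm (C f))\<^sup>2)"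
proof -
  have C0: "C 0 = 0" using C(1)[of 0 0] by simp
  have Csum: "C (\<Sum>i\<in>I. g i) = (\<Sum>i\<in>I. C (g i))" for I :: "'a set" and g
    by (induction I rule: infinite_finite_induct) (auto simp: C C0)
  have expand: "C x = (\<Sum>e\<in>E. cinner x e *\<^sub>C C e)" if "orthonormal_basis Z E" "x \<in> Z" for x E
    by (subst orthonormal_expansion[OF that]) (simp add: Csum C)
  have "complex_of_real (\<Sum>e\<in>E. (norm (C e))\<^sup>2) = (\<Sum>e\<in>E. cinner (C e) (C e))"
    by (simp add: cinner_same)
  also have "\<dots> = (\<Sum>e\<in>E. \<Sum>f\<in>E'. cinner e f * cinner (C f) (C e))"
  proof (rule sum.cong)
    fix e assume "e \<in> E"
    then have "e \<in> Z" using orthonormal_basisD(2)[OF E] by blast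
    have "cinner (C e) (C e) = cinner (\<Sum>f\<in>E'. cinner e f *\<^sub>C C f) (C e)"
      using expand[OF E' \<open>e \<in> Z\<close>] by (rule arg_cong)
    then show "cinner (C e) (C e) = (\<Sum>f\<in>E'. cinner e f * cinner (C f) (C e))"
      by (simp add: cinner_sum_left cinner_scaleC_left)
  qed simp
  also have "\<dots> = (\<Sum>f\<in>E'. \<Sum>e\<in>E. cinner e f * cinner (C f) (C e))"
    by (rule sum.swap)
  also have "\<dots> = (\<Sum>f\<in>E'. cinner (C f) (C f))"
  proof (rule sum.cong)
    fix f assume "f \<in> E'"
    then have "f \<in> Z" using orthonormal_basisD(2)[OF E'] by blast
    have "cinner (C f) (C f) = cinner (C f) (\<Sum>e\<in>E. cinner f e *\<^sub>C C e)"
      using expand[OF E \<open>f \<in> Z\<close>] by (rule arg_cong)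
    then show "(\<Sum>e\<in>E. cinner e f * cinner (C f) (C e)) = cinner (C f) (C f)"
      by (simp add: cinner_sum_right cinner_scaleC_right cinner_commute[symmetric])
  qed simp
  also have "\<dots> = complex_of_real (\<Sum>f\<in>E'. (norm (C f))\<^sup>2)"
    by (simp add: cinner_same)
  finally show ?thesis by (simp only: of_real_eq_iff)
qed

section \<open>The trace of the curvature operator\<close>

context row_contraction
begin

lemma T_lin_bounded_clinear: "bounded_clinear (T_lin T z)"
  unfolding T_lin_def by (intro bounded_clinear_lincomb T_bounded_clinear)

text \<open>\<open>T_lin T z x\<close> is the row operator applied to the column of vectors
  \<open>cnj (z $ k) *\<^sub>C x\<close>, whose norm is \<open>norm z * norm x\<close>.\<close>

lemma norm_T_lin: "norm (T_lin T z x) \<le> norm z * norm x"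
proof -
  have "T_lin T z x = (\<Sum>k\<in>UNIV. T k (cnj (z $ k) *\<^sub>C x))"
    by (simp add: T_lin_def T_lin)
  then have "(norm (T_lin T z x))\<^sup>2 \<le> (\<Sum>k\<in>UNIV. (norm (cnj (z $ k) *\<^sub>C x))\<^sup>2)"
    using row_le[of "\<lambda>k. cnj (z $ k) *\<^sub>C x"] by simp
  also have "\<dots> = (norm z * norm x)\<^sup>2"
    by (simp add: power_mult_distrib sum_distrib_right[symmetric] norm_vec_def L2_set_def sum_nonneg)
  finally show ?thesis
    by (rule power2_le_imp_le) simp
qed

lemma T_lin_scale_pow: "(T_lin T (r *\<^sub>R z) ^^ n) x = (r ^ n) *\<^sub>R (T_lin T z ^^ n) x"
proof (induction n)
  case (Suc n)
  have 1: "T_lin T (r *\<^sub>R z) y = r *\<^sub>R T_lin T z y" for y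
    by (simp add: T_lin_def scaleR_scaleC complex_vector.scale_sum_right scaleC_scaleC
        scaleC_vec_def scaleC_complex_def)
  have 2: "T_lin T z (c *\<^sub>R y) = c *\<^sub>R T_lin T z y" for c y
    by (simp add: scaleR_scaleC bounded_clinear_scaleC[OF T_lin_bounded_clinear])
  have "(T_lin T (r *\<^sub>R z) ^^ Suc n) x = T_lin T (r *\<^sub>R z) ((r ^ n) *\<^sub>R (T_lin T z ^^ n) x)"
    by (simp add: Suc)
  then show ?case
    by (simp add: 1[of "(r ^ n) *\<^sub>R (T_lin T z ^^ n) x"] 2)
qed simp

text \<open>The moment formula requires coefficients depending on the multiset of a word alone;
  commutativity provides them.\<close>

definition T_mset :: "'d multiset \<Rightarrow> 'h \<Rightarrow> 'h"
  where "T_mset A x = fold_mset T x A"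

lemma T_word_mset: "T_word w x = T_mset (mset w) x"
proof (induction w)
  case (Cons k w)
  interpret comp_fun_commute T
    by unfold_locales (auto simp: T_commute)
  show ?case
    using Cons by (simp add: T_mset_def fold_mset_add_mset)
qed (simp add: T_mset_def)

lemma T_lin_pow: "(T_lin T \<zeta> ^^ n) x = (\<Sum>w\<in>words n. cnj (monom_at \<zeta> (mset w)) *\<^sub>C T_mset (mset w) x)"
proof -
  have "(T_lin T \<zeta> ^^ n) x = (\<Sum>w\<in>words n. cnj (monom_at \<zeta> (mset w)) *\<^sub>C T_word w x)"
  proof (induction n)
    case (Suc n)
    then show ?case
      by (simp add: T_lin_def sum_words_Suc T_lin complex_vector.scale_sum_right scaleC_scaleC)
  qed (simp add: words_0)
  then show ?thesis by (simp only: T_word_mset)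
qed

text \<open>With \<open>G\<close> the inverse of \<open>1 - T(z)\<close>, the operator
  \<open>F\<close> is \<open>G \<circ> \<Delta>\<close> followed by its adjoint, so its trace is a
  squared Hilbert-Schmidt norm and may be computed in any orthonormal basis.\<close>

lemma trace_F_op:
  assumes z: "norm z < 1" and E: "orthonormal_basis (range \<Delta>) E"
  shows "trace_on (range (defect_op T)) (F_op T z) =
    of_real (\<Sum>e\<in>E. (norm (inv (\<lambda>x. x - T_lin T z x) (\<Delta> e)))\<^sup>2)"
proof -
  define A where "A = T_lin T z"
  have A: "bounded_clinear A" and nA: "\<And>x. norm (A x) \<le> norm z * norm x"
    by (auto simp: A_def T_lin_bounded_clinear norm_T_lin)
  have bij: "bij (\<lambda>x. x - A x)"
    using neumann_series(1)[OF A norm_ge_zero z nA] .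
  have bij': "bij (\<lambda>x. x - cadjoint A x)"
    using neumann_series(1)[OF bounded_clinear_cadjoint[OF A] norm_ge_zero z cadjoint_norm_le[OF A norm_ge_zero nA]] .
  define G where "G = inv (\<lambda>x. x - A x)"
  have G: "G y - A (G y) = y" for y
    unfolding G_def using surj_f_inv_f[OF bij_is_surj[OF bij], of y] .
  have G_eq: "G y = x" if "x - A x = y" for x y
    unfolding G_def that[symmetric] by (rule inv_f_f[OF bij_is_inj[OF bij]])
  have G_lin: "G (x + y) = G x + G y" "G (c *\<^sub>C x) = c *\<^sub>C G x" for x y c
  proof -
    have "(G x + G y) - A (G x + G y) = (G x - A (G x)) + (G y - A (G y))"
      by (simp only: bounded_clinear_add[OF A] add_diff_add)
    then show "G (x + y) = G x + G y"
      by (intro G_eq) (simp only: G)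
    have "c *\<^sub>C G x - A (c *\<^sub>C G x) = c *\<^sub>C (G x - A (G x))"
      by (simp only: bounded_clinear_scaleC[OF A] complex_vector.scale_right_diff_distrib)
    then show "G (c *\<^sub>C x) = c *\<^sub>C G x"
      by (intro G_eq) (simp only: G)
  qed
  define G' where "G' = inv (\<lambda>x. x - cadjoint A x)"
  have G': "G' y - cadjoint A (G' y) = y" for y
    unfolding G'_def using surj_f_inv_f[OF bij_is_surj[OF bij'], of y] .
  have F: "cinner (F_op T z e) e = of_real ((norm (G (\<Delta> e)))\<^sup>2)" for e
  proof -
    have "cinner (F_op T z e) e = cinner (G' (G (\<Delta> e))) (\<Delta> e)"
      by (simp add: F_op_def G_def G'_def A_def \<Delta>_def[symmetric] cinner_\<Delta>)
    also have "\<dots> = cinner (G' (G (\<Delta> e))) (G (\<Delta> e) - A (G (\<Delta> e)))"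
      by (simp only: G)
    also have "\<dots> = cinner (G' (G (\<Delta> e)) - cadjoint A (G' (G (\<Delta> e)))) (G (\<Delta> e))"
      by (simp add: cinner_diff_left cinner_diff_right cinner_cadjoint_left[OF A])
    also have "\<dots> = of_real ((norm (G (\<Delta> e)))\<^sup>2)"
      by (simp only: G' cinner_same)
    finally show ?thesis .
  qed
  define E0 where "E0 = (SOME E. orthonormal_basis (range \<Delta>) E)"
  have E0: "orthonormal_basis (range \<Delta>) E0"
    unfolding E0_def using E by (rule someI)
  have "trace_on (range (defect_op T)) (F_op T z) = of_real (\<Sum>e\<in>E0. (norm (G (\<Delta> e)))\<^sup>2)"
    by (simp add: trace_on_def \<Delta>_def[symmetric] E0_def[symmetric] F)
  also have "(\<Sum>e\<in>E0. (norm (G (\<Delta> e)))\<^sup>2) = (\<Sum>e\<in>E. (norm (G (\<Delta> e)))\<^sup>2)"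
    by (rule hilbert_schmidt_basis_independent[OF E0 E, of "\<lambda>e. G (\<Delta> e)"]) (simp_all add: \<Delta>_lin G_lin)
  finally show ?thesis by (simp add: G_def A_def)
qed

end

section \<open>Boundary limits and the growth of dimensions\<close>

context graded_decomposition
begin

lemma T_word_V: "x \<in> V i \<Longrightarrow> T_word w x \<in> V (length w + i)"
  by (induction w) (auto simp: T_V)

lemma T_adj_word_V: "x \<in> V i \<Longrightarrow> i < length w \<Longrightarrow> T_adj_word w x = 0"
proof (induction w arbitrary: x i)
  case (Cons k w)
  have z: "T_adj_word w 0 = 0" for w by (induction w) (auto simp: T_adj_lin)
  show ?case
  proof (cases i)
    case 0
    then show ?thesis using Cons.prems T_adj_V_0 z by simp
  next
    case (Suc j)
    then show ?thesis using Cons.IH[of "T_adj k x" j] Cons.prems T_adj_V by simp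
  qed
qed simp

text \<open>Completeness is the point: if \<open>x = \<Delta> y\<close> is orthogonal to all
  homogeneous parts of the range, then \<open>\<Delta> x\<close> is orthogonal to every
  \<open>V i\<close>, so \<open>\<Delta> x = 0\<close> and
  \<open>cinner x x = cinner y (\<Delta> x) = 0\<close>.\<close>

lemma ex_homogeneous_basis:
  obtains E where "orthonormal_basis (range \<Delta>) E" "\<And>e. e \<in> E \<Longrightarrow> \<exists>i<b. e \<in> V i"
proof -
  have sub: "complex_vector.subspace (range \<Delta> \<inter> V i)" for i
    by (intro complex_vector.subspace_inter subspace_range_\<Delta> subspace_V)
  have "finite_cdim (range \<Delta> \<inter> V i)" for i
    using finite_cdim_subset[OF finite_cdim_V] by blast
  then have "\<forall>i. \<exists>F. orthonormal_basis (range \<Delta> \<inter> V i) F"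
    using ex_orthonormal_basis[OF sub] by blast
  then obtain F where F: "\<And>i. orthonormal_basis (range \<Delta> \<inter> V i) (F i)" by metis
  note F' = orthonormal_basisD[OF F]
  have "orthonormal_basis (range \<Delta>) (\<Union>i<b. F i)"
  proof (rule orthonormal_basisI[OF subspace_range_\<Delta>])
    show "finite (\<Union>i<b. F i)" using F'(1) by auto
    show "(\<Union>i<b. F i) \<subseteq> range \<Delta>" using F'(2) by blast
    show "cinner e e' = (if e = e' then 1 else 0)" if ee: "e \<in> (\<Union>i<b. F i)" "e' \<in> (\<Union>i<b. F i)" for e e'
    proof -
      obtain i j where ij: "e \<in> F i" "e' \<in> F j" using ee by auto
      show ?thesis
      proof (cases "i = j")
        case False
        then have 0: "cinner e e' = 0"
          using ij F'(2) V_orthogonal by blast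
        moreover have "e \<noteq> e'"
          using 0 F'(6)[OF ij(1)] by auto
        ultimately show ?thesis by simp
      qed (use ij F'(5) in auto)
    qed
    fix x assume x: "x \<in> range \<Delta>" and 0: "\<And>e. e \<in> (\<Union>i<b. F i) \<Longrightarrow> cinner x e = 0"
    obtain y where y: "x = \<Delta> y" using x by blast
    have "\<Delta> x = 0"
    proof (rule V_total)
      fix i v assume v: "v \<in> V i"
      have "cinner (\<Delta> v) x = 0"
      proof (cases "i < b")
        case True
        have e: "cinner e x = 0" if "e \<in> F i" for e
          using 0[of e] True that cinner_eq_0_commute by blast
        have "\<Delta> v \<in> range \<Delta> \<inter> V i" using \<Delta>_V[OF v] by blast
        then show ?thesis
          by (subst orthonormal_expansion[OF F])
            (auto simp: cinner_sum_left cinner_scaleC_left e intro!: sum.neutral)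
      next
        case False
        then show ?thesis using \<Delta>_V_eq_0[OF v] by simp
      qed
      then show "cinner v (\<Delta> x) = 0" by (simp add: cinner_\<Delta>)
    qed
    then have "cinner x x = 0"
      using cinner_\<Delta>[of y x] by (simp add: y)
    then show "x = 0" by simp
  qed
  then show ?thesis
    using F'(2) by (intro that) auto
qed

text \<open>In the homogeneous basis \<open>(1 - r\<^sup>2) * trace (F (r * \<zeta>))\<close> is the Abel mean of the decreasing
  sequence \<open>boundary_seq E \<zeta>\<close>, so the limit exists at every point of the sphere.\<close>

definition boundary_seq :: "'h set \<Rightarrow> complex^'d \<Rightarrow> nat \<Rightarrow> real"
  where "boundary_seq E \<zeta> n = (\<Sum>e\<in>E. (norm ((T_lin T \<zeta> ^^ n) (\<Delta> e)))\<^sup>2)"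

text \<open>For a basis \<open>E\<close> of \<open>range \<Delta>\<close> this is the trace of
  \<open>\<phi>^n\<close> at \<open>\<Delta> \<circ> \<Delta>\<close>, written as squared
  Hilbert-Schmidt norms; divided by the number of monomials of degree \<open>n\<close> it is the
  mean of \<open>boundary_seq E \<zeta> n\<close> over the sphere.\<close>

definition word_trace :: "'h set \<Rightarrow> nat \<Rightarrow> real"
  where "word_trace E n = (\<Sum>e\<in>E. \<Sum>w\<in>words n. (norm (T_word w (\<Delta> e)))\<^sup>2)"

lemma boundary_seq_nonneg: "0 \<le> boundary_seq E \<zeta> n"
  by (simp add: boundary_seq_def sum_nonneg)

lemma boundary_seq_decseq:
  assumes "norm \<zeta> = 1"
  shows "boundary_seq E \<zeta> (Suc n) \<le> boundary_seq E \<zeta> n"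
  unfolding boundary_seq_def using norm_T_lin[of \<zeta>] assms
  by (intro sum_mono power_mono) auto

lemma boundary_seq_tendsto:
  assumes "norm \<zeta> = 1"
  shows "boundary_seq E \<zeta> \<longlonglongrightarrow> lim (boundary_seq E \<zeta>)" "boundary_seq E \<zeta> n \<le> (\<Sum>e\<in>E. (norm (\<Delta> e))\<^sup>2)"
proof -
  have dec: "decseq (boundary_seq E \<zeta>)"
    using boundary_seq_decseq[OF assms] by (rule decseq_SucI)
  then show bd: "boundary_seq E \<zeta> n \<le> (\<Sum>e\<in>E. (norm (\<Delta> e))\<^sup>2)" for n
    using decseqD[OF dec, of 0 n] by (simp add: boundary_seq_def)
  have "convergent (boundary_seq E \<zeta>)"
    using decseq_convergent[OF dec, of 0] boundary_seq_nonneg by (metis convergent_def)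
  then show "boundary_seq E \<zeta> \<longlonglongrightarrow> lim (boundary_seq E \<zeta>)"
    by (simp add: convergent_LIMSEQ_iff)
qed

lemma K0_eq:
  assumes E: "orthonormal_basis (range \<Delta>) E" "\<And>e. e \<in> E \<Longrightarrow> \<exists>i<b. e \<in> V i" and \<zeta>: "norm \<zeta> = 1"
  shows "K0 T \<zeta> = of_real (lim (boundary_seq E \<zeta>))"
proof -
  note E' = orthonormal_basisD[OF E(1)]
  have tr: "trace_on (range (defect_op T)) (F_op T (r *\<^sub>R \<zeta>)) = of_real (\<Sum>n. r ^ (2 * n) * boundary_seq E \<zeta> n)"
    if r: "0 < r" "r < 1" for r
  proof -
    have nz: "norm (r *\<^sub>R \<zeta>) < 1" using \<zeta> r by simp
    have s: "(\<lambda>n. r ^ (2 * n) * (norm ((T_lin T \<zeta> ^^ n) (\<Delta> e)))\<^sup>2) sums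
        (norm (inv (\<lambda>x. x - T_lin T (r *\<^sub>R \<zeta>) x) (\<Delta> e)))\<^sup>2" if e: "e \<in> E" for e
    proof -
      obtain i where i: "e \<in> V i" using E(2)[OF e] by blast
      \<comment> \<open>Powers of \<open>T_lin\<close> raise the degree, so the terms of the Neumann
        series are orthogonal and the squared norm of its sum is the sum of the squared
        norms.\<close>
      have V: "(T_lin T \<zeta> ^^ n) (\<Delta> e) \<in> V (n + i)" for n
        by (induction n)
          (auto simp: T_lin_def \<Delta>_V[OF i] T_V intro!: complex_vector.subspace_sum[OF subspace_V]
            complex_vector.subspace_scale[OF subspace_V])
      have "(\<lambda>n. (norm ((T_lin T (r *\<^sub>R \<zeta>) ^^ n) (\<Delta> e)))\<^sup>2) sums
          (norm (inv (\<lambda>x. x - T_lin T (r *\<^sub>R \<zeta>) x) (\<Delta> e)))\<^sup>2"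
      proof (rule sums_norm_orthogonal)
        show "(\<lambda>n. (T_lin T (r *\<^sub>R \<zeta>) ^^ n) (\<Delta> e)) sums inv (\<lambda>x. x - T_lin T (r *\<^sub>R \<zeta>) x) (\<Delta> e)"
          by (rule neumann_series(2)[OF T_lin_bounded_clinear norm_ge_zero nz norm_T_lin])
        show "cinner ((T_lin T (r *\<^sub>R \<zeta>) ^^ m) (\<Delta> e)) ((T_lin T (r *\<^sub>R \<zeta>) ^^ n) (\<Delta> e)) = 0" if "m \<noteq> n" for m n
          unfolding T_lin_scale_pow using V_orthogonal[OF V V, of m n] that
          by (simp add: scaleR_scaleC cinner_scaleC_left cinner_scaleC_right)
      qed
      then show ?thesis
        by (simp add: T_lin_scale_pow power_mult_distrib power_mult[symmetric] mult.commute[of 2])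
    qed
    have "(\<lambda>n. \<Sum>e\<in>E. r ^ (2 * n) * (norm ((T_lin T \<zeta> ^^ n) (\<Delta> e)))\<^sup>2) sums
        (\<Sum>e\<in>E. (norm (inv (\<lambda>x. x - T_lin T (r *\<^sub>R \<zeta>) x) (\<Delta> e)))\<^sup>2)"
      by (intro sums_sum s)
    then have "(\<Sum>n. r ^ (2 * n) * boundary_seq E \<zeta> n) = (\<Sum>e\<in>E. (norm (inv (\<lambda>x. x - T_lin T (r *\<^sub>R \<zeta>) x) (\<Delta> e)))\<^sup>2)"
      by (simp add: boundary_seq_def sum_distrib_left sums_iff)
    then show ?thesis
      using trace_F_op[OF nz E(1)] by simp
  qed
  have "((\<lambda>r. (1 - r\<^sup>2) * (\<Sum>n. r ^ (2 * n) * boundary_seq E \<zeta> n)) \<longlongrightarrow> lim (boundary_seq E \<zeta>)) (at_left 1)"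
    using boundary_seq_tendsto[OF \<zeta>] boundary_seq_nonneg
    by (intro abel_limit_means[where K = "\<Sum>e\<in>E. (norm (\<Delta> e))\<^sup>2"]) auto
  then have "((\<lambda>r. complex_of_real ((1 - r\<^sup>2) * (\<Sum>n. r ^ (2 * n) * boundary_seq E \<zeta> n))) \<longlongrightarrow>
      of_real (lim (boundary_seq E \<zeta>))) (at_left 1)"
    by (rule tendsto_of_real)
  moreover have "eventually (\<lambda>r. complex_of_real ((1 - r\<^sup>2) * (\<Sum>n. r ^ (2 * n) * boundary_seq E \<zeta> n)) =
      complex_of_real (1 - r\<^sup>2) * trace_on (range (defect_op T)) (F_op T (r *\<^sub>R \<zeta>))) (at_left (1::real))"
  proof -
    have "eventually (\<lambda>r::real. 0 < r \<and> r < 1) (at_left 1)"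
      using eventually_at_left_real[of 0 "1::real"] by (simp add: eventually_mono)
    then show ?thesis
      by eventually_elim (simp add: tr)
  qed
  ultimately have "((\<lambda>r. complex_of_real (1 - r\<^sup>2) * trace_on (range (defect_op T)) (F_op T (r *\<^sub>R \<zeta>))) \<longlongrightarrow>
      of_real (lim (boundary_seq E \<zeta>))) (at_left (1::real))"
    by (rule Lim_transform_eventually)
  then show ?thesis
    unfolding K0_def by (intro tendsto_Lim) auto
qed

text \<open>On the sphere \<open>boundary_seq\<close> is dominated by its value at \<open>0\<close>,
  so integral and limit may be interchanged; each integrand is homogeneous in \<open>\<zeta>\<close>
  and its integral follows from the moments.\<close>

lemma curvature_limit:
  assumes E: "orthonormal_basis (range \<Delta>) E" "\<And>e. e \<in> E \<Longrightarrow> \<exists>i<b. e \<in> V i"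
  obtains \<kappa> where "curvature T = of_real \<kappa>"
    "(\<lambda>n. word_trace E n / real ((CARD('d) + n - 1) choose n)) \<longlonglongrightarrow> \<kappa>"
proof
  interpret finite_measure "sphere_prob :: (complex^'d) measure"
    by (rule finite_measure_sphere_prob)
  note E' = orthonormal_basisD[OF E(1)]
  define \<kappa> where "\<kappa> = (LINT \<zeta>|sphere_prob. lim (boundary_seq E \<zeta>))"
  have "curvature T = (LINT \<zeta>|sphere_prob. complex_of_real (lim (boundary_seq E \<zeta>)))"
    unfolding curvature_def using K0_eq[OF E]
    by (intro Bochner_Integration.integral_cong) (auto simp: space_sphere_prob)
  then show "curvature T = of_real \<kappa>" by (simp add: \<kappa>_def)
  have cont: "continuous_on UNIV (\<lambda>\<zeta>. boundary_seq E \<zeta> n)" for n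
    unfolding boundary_seq_def T_lin_pow
    by (intro continuous_on_sum integral_norm_homogeneous(2))
  have int: "(LINT \<zeta>|sphere_prob. boundary_seq E \<zeta> n) = word_trace E n / real ((CARD('d) + n - 1) choose n)" for n
  proof -
    have "(LINT \<zeta>|sphere_prob. boundary_seq E \<zeta> n) = (\<Sum>e\<in>E. LINT \<zeta>|sphere_prob. (norm ((T_lin T \<zeta> ^^ n) (\<Delta> e)))\<^sup>2)"
      unfolding boundary_seq_def T_lin_pow
      by (intro Bochner_Integration.integral_sum integrable_sphere_prob integral_norm_homogeneous(2))
    also have "\<dots> = (\<Sum>e\<in>E. (\<Sum>w\<in>words n. (norm (T_mset (mset w) (\<Delta> e)))\<^sup>2) / real ((CARD('d) + n - 1) choose n))"
      unfolding T_lin_pow by (intro sum.cong refl integral_norm_homogeneous(1))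
    also have "\<dots> = word_trace E n / real ((CARD('d) + n - 1) choose n)"
      by (simp only: word_trace_def T_word_mset sum_divide_distrib)
    finally show ?thesis .
  qed
  have "(\<lambda>n. LINT \<zeta>|sphere_prob. boundary_seq E \<zeta> n) \<longlonglongrightarrow> \<kappa>"
    unfolding \<kappa>_def
  proof (rule integral_dominated_convergence)
    show m: "(\<lambda>\<zeta>. boundary_seq E \<zeta> n) \<in> borel_measurable sphere_prob" for n
      by (rule borel_measurable_sphere_prob[OF cont])
    show "(\<lambda>\<zeta>. lim (boundary_seq E \<zeta>)) \<in> borel_measurable sphere_prob"
    proof (rule borel_measurable_LIMSEQ_real[OF _ m])
      show "(\<lambda>n. boundary_seq E \<zeta> n) \<longlonglongrightarrow> lim (boundary_seq E \<zeta>)" if "\<zeta> \<in> space sphere_prob" for \<zeta>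
        using that boundary_seq_tendsto(1) by (simp add: space_sphere_prob)
    qed
    show "integrable sphere_prob (\<lambda>\<zeta> :: complex^'d. \<Sum>e\<in>E. (norm (\<Delta> e))\<^sup>2)"
      by (rule integrable_const)
    show "AE \<zeta> in sphere_prob. (\<lambda>n. boundary_seq E \<zeta> n) \<longlonglongrightarrow> lim (boundary_seq E \<zeta>)"
      using boundary_seq_tendsto(1) by (intro AE_I2) (simp add: space_sphere_prob)
    show "AE \<zeta> in sphere_prob. norm (boundary_seq E \<zeta> n) \<le> (\<Sum>e\<in>E. (norm (\<Delta> e))\<^sup>2)" for n
      using boundary_seq_tendsto(2) boundary_seq_nonneg by (intro AE_I2) (simp add: space_sphere_prob)
  qed
  then show "(\<lambda>n. word_trace E n / real ((CARD('d) + n - 1) choose n)) \<longlonglongrightarrow> \<kappa>"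
    by (simp only: int)
qed

text \<open>Both bounds compare the trace of \<open>1 - \<phi>\<^sup>n(1)\<close> with the rank of a projection: this operator is
  the identity on degrees below \<open>n\<close> and vanishes from degree \<open>n + b\<close> on.\<close>

lemma sum_word_trace_bounds:
  assumes E: "orthonormal_basis (range \<Delta>) E" "\<And>e. e \<in> E \<Longrightarrow> \<exists>i<b. e \<in> V i"
  shows "real (cdim (V_below n)) \<le> (\<Sum>j<n. word_trace E j)"
    and "(\<Sum>j<n. word_trace E j) \<le> real (cdim (V_below (n + b)))"
proof -
  obtain B where B: "\<And>i. orthonormal_basis (V i) (B i)"
    using ex_orthonormal_basis_V by blast
  note B' = orthonormal_basisD[OF B]
  define F where "F m = (\<Union>i<m. B i)" for m
  have F: "orthonormal_basis (V_below m) (F m)" for m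
    unfolding F_def by (rule orthonormal_basis_V_below[OF B])
  note F' = orthonormal_basisD[OF F]
  have wt: "word_trace E j = (\<Sum>f\<in>F (n + b). defect_form j f)" if j: "j < n" for j
  proof -
    have "word_trace E j = (\<Sum>e\<in>E. \<Sum>w\<in>words j. \<Sum>f\<in>F (n + b). (norm (cinner e (\<Delta> (T_adj_word w f))))\<^sup>2)"
      unfolding word_trace_def
    proof (intro sum.cong refl)
      fix e w assume e: "e \<in> E" and w: "w \<in> (words j :: 'd list set)"
      \<comment> \<open>\<open>e\<close> has degree below \<open>b\<close>, so words of length below
        \<open>n\<close> keep it inside \<open>V_below (n + b)\<close>; this is the origin of the
        \<open>b\<close> in the upper bound.\<close>
      obtain i where i: "i < b" "e \<in> V i" using E(2)[OF e] by blast
      have "T_word w (\<Delta> e) \<in> V (length w + i)"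
        using T_word_V \<Delta>_V i(2) by blast
      moreover have "length w + i < n + b"
        using w j i by (simp add: words_def)
      ultimately have "T_word w (\<Delta> e) \<in> V_below (n + b)"
        using V_subset_V_below by blast
      then show "(norm (T_word w (\<Delta> e)))\<^sup>2 = (\<Sum>f\<in>F (n + b). (norm (cinner e (\<Delta> (T_adj_word w f))))\<^sup>2)"
        using orthonormal_parseval[OF F] by (simp add: cinner_T_word cinner_\<Delta>)
    qed
    also have "\<dots> = (\<Sum>w\<in>words j. \<Sum>f\<in>F (n + b). \<Sum>e\<in>E. (norm (cinner e (\<Delta> (T_adj_word w f))))\<^sup>2)"
      by (subst sum.swap) (intro sum.cong refl sum.swap)
    also have "\<dots> = (\<Sum>w\<in>words j. \<Sum>f\<in>F (n + b). (norm (\<Delta> (T_adj_word w f)))\<^sup>2)"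
    proof (intro sum.cong refl)
      fix w f
      have "norm (cinner e y) = norm (cinner y e)" for e y :: 'h
        by (metis cinner_commute complex_mod_cnj)
      then show "(\<Sum>e\<in>E. (norm (cinner e (\<Delta> (T_adj_word w f))))\<^sup>2) = (norm (\<Delta> (T_adj_word w f)))\<^sup>2"
        using orthonormal_parseval[OF E(1), of "\<Delta> (T_adj_word w f)"] by simp
    qed
    also have "\<dots> = (\<Sum>f\<in>F (n + b). defect_form j f)"
      unfolding defect_form_def by (rule sum.swap)
    finally show ?thesis .
  qed
  have "(\<Sum>j<n. word_trace E j) = (\<Sum>j<n. \<Sum>f\<in>F (n + b). defect_form j f)"
    by (intro sum.cong) (auto simp: wt)
  also have "\<dots> = (\<Sum>f\<in>F (n + b). \<Sum>j<n. defect_form j f)"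
    by (rule sum.swap)
  also have "\<dots> = (\<Sum>f\<in>F (n + b). 1 - length_form n f)"
    using F'(6) by (intro sum.cong) (auto simp: sum_defect_form)
  finally have eq: "(\<Sum>j<n. word_trace E j) = (\<Sum>f\<in>F (n + b). 1 - length_form n f)" .
  have "(\<Sum>f\<in>F (n + b). 1 - length_form n f) \<le> (\<Sum>f\<in>F (n + b). 1)"
    using length_form_nonneg by (intro sum_mono) auto
  then show "(\<Sum>j<n. word_trace E j) \<le> real (cdim (V_below (n + b)))"
    by (simp add: eq cdim_orthonormal_basis[OF F])
  have "real (card (F n)) = (\<Sum>f\<in>F n. 1 - length_form n f)"
  proof -
    \<comment> \<open>Adjoint words of length \<open>n\<close> annihilate all degrees below
      \<open>n\<close>, so each such basis vector contributes exactly \<open>1\<close>.\<close>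
    have "length_form n f = 0" if "f \<in> F n" for f
    proof -
      obtain i where "i < n" "f \<in> V i" using \<open>f \<in> F n\<close> B'(2) by (auto simp: F_def)
      then show ?thesis
        using T_adj_word_V[of f i] by (auto simp: length_form_def words_def intro!: sum.neutral)
    qed
    then show ?thesis by simp
  qed
  also have "\<dots> \<le> (\<Sum>f\<in>F (n + b). 1 - length_form n f)"
  proof (rule sum_mono2)
    show "F n \<subseteq> F (n + b)" unfolding F_def by (intro UN_mono) auto
    show "0 \<le> 1 - length_form n f" if "f \<in> F (n + b) - F n" for f
    proof -
      have "0 \<le> (\<Sum>j<n. defect_form j f)"
        by (simp add: defect_form_def sum_nonneg)
      then show ?thesis
        using F'(6)[of f "n + b"] that by (simp add: sum_defect_form)
    qed
  qed (rule F'(1))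
  finally show "real (cdim (V_below n)) \<le> (\<Sum>j<n. word_trace E j)"
    by (simp add: eq cdim_orthonormal_basis[OF F])
qed

text \<open>Stolz-Cesaro turns the limit for single terms into one for partial sums; these are
  squeezed between the dimension functions at \<open>n\<close> and \<open>n + b\<close>, which have
  the same leading growth.\<close>

theorem curvature_eq:
  assumes lim: "(\<lambda>n. real (cdim (V_below n)) / real (n choose CARD('d))) \<longlonglongrightarrow> c"
  shows "curvature T = of_real c"
proof -
  obtain E where E: "orthonormal_basis (range \<Delta>) E" "\<And>e. e \<in> E \<Longrightarrow> \<exists>i<b. e \<in> V i"
    using ex_homogeneous_basis by blast
  obtain \<kappa> where \<kappa>: "curvature T = of_real \<kappa>"
    "(\<lambda>n. word_trace E n / real ((CARD('d) + n - 1) choose n)) \<longlonglongrightarrow> \<kappa>"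
    using curvature_limit[OF E] by blast
  define d where "d = CARD('d)"
  obtain d' where d: "d = Suc d'"
    using not0_implies_Suc[of "CARD('d)"] by (auto simp: d_def)
  \<comment> \<open>With \<open>d' = d - 1\<close> this is the number of monomials of degree
    \<open>n\<close> in \<open>d\<close> variables, in the form to which the hockey-stick identity
    applies.\<close>
  have bin: "(d + n - 1) choose n = (n + d') choose d'" for n
    using binomial_symmetric[of n "d' + n"] by (simp add: d add.commute)
  have sumbin: "(\<Sum>j<n. (j + d') choose d') = (n + d') choose d" for n
    by (induction n) (auto simp: d)
  define S where "S n = (\<Sum>j<n. word_trace E j)" for n
  have sb: "(\<Sum>j<n. real ((d + j - 1) choose j)) = real ((n + d') choose d)" for n
    by (simp only: bin of_nat_sum[symmetric] sumbin)
  have "(\<lambda>n. S n / real ((n + d') choose d)) \<longlonglongrightarrow> \<kappa>"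
    unfolding S_def sb[symmetric]
  proof (rule stolz_cesaro_sum)
    show "filterlim (\<lambda>n. \<Sum>i<n. real ((d + i - 1) choose i)) at_top sequentially"
      unfolding sb
    proof (rule filterlim_at_top_mono[OF filterlim_choose_at_top])
      show "eventually (\<lambda>n. real (n choose Suc d') \<le> real ((n + d') choose d)) sequentially"
        unfolding d by (intro always_eventually allI) (simp add: binomial_right_mono del: binomial_Suc_Suc)
    qed
    show "(\<lambda>n. word_trace E n / real ((d + n - 1) choose n)) \<longlonglongrightarrow> \<kappa>"
      using \<kappa>(2) by (simp add: d_def)
    show "eventually (\<lambda>n. 0 < real ((d + n - 1) choose n)) sequentially"
      by (intro always_eventually allI) (simp add: d)
  qed simp
  from tendsto_mult[OF this choose_ratio_tendsto_1[of d' d]]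
  have "(\<lambda>n. S n / real ((n + d') choose d) * (real ((n + d') choose d) / real (n choose d))) \<longlonglongrightarrow> \<kappa>"
    by simp
  moreover have "eventually (\<lambda>n. S n / real ((n + d') choose d) * (real ((n + d') choose d) / real (n choose d)) =
      S n / real (n choose d)) sequentially"
    unfolding eventually_sequentially by (intro exI[of _ d]) auto
  ultimately have limS: "(\<lambda>n. S n / real (n choose d)) \<longlonglongrightarrow> \<kappa>"
    by (rule Lim_transform_eventually)
  have up: "(\<lambda>n. real (cdim (V_below (n + b))) / real (n choose d)) \<longlonglongrightarrow> c"
  proof -
    have "(\<lambda>n. real (cdim (V_below (n + b))) / real ((n + b) choose d) * (real ((n + b) choose d) / real (n choose d))) \<longlonglongrightarrow> c * 1"
      using LIMSEQ_ignore_initial_segment[OF lim, of b]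
      by (intro tendsto_mult choose_ratio_tendsto_1) (simp add: d_def)
    moreover have "eventually (\<lambda>n. real (cdim (V_below (n + b))) / real ((n + b) choose d) * (real ((n + b) choose d) / real (n choose d)) =
        real (cdim (V_below (n + b))) / real (n choose d)) sequentially"
      unfolding eventually_sequentially by (intro exI[of _ d]) auto
    ultimately show ?thesis
      using Lim_transform_eventually by fastforce
  qed
  have "c \<le> \<kappa>"
    using sum_word_trace_bounds(1)[OF E]
    by (intro LIMSEQ_le[OF lim[folded d_def] limS]) (auto simp: S_def intro!: divide_right_mono)
  moreover have "\<kappa> \<le> c"
    using sum_word_trace_bounds(2)[OF E]
    by (intro LIMSEQ_le[OF limS up]) (auto simp: S_def intro!: divide_right_mono)
  ultimately show ?thesis using \<kappa>(1) by simp
qed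

end

theorem theoremB:
  fixes T :: "'d::{finite,linorder} \<Rightarrow> 'h::complex_hilbert_space \<Rightarrow> 'h"
    and D :: "'h^('d set) \<Rightarrow> 'h^('d set)"
    and R :: "complex^('d::{finite,linorder}) \<Rightarrow> 'h^('d set) \<Rightarrow> 'h^('d set)"
  assumes "d_contraction T" and "pure T" and "finite_rank T" and "graded T"
    and "(D, R) = dirac_operator T"
  shows "finite_cdim (ker_on even_part D) \<and> finite_cdim (ker_on odd_part D) \<and>
    (-1) ^ CARD('d) * curvature T
      = of_int (int (cdim (ker_on even_part D)) - int (cdim (ker_on odd_part D)))"
proof -
  have D: "D = dirac_D T"
    using assms(5) by (simp add: dirac_operator_def)
  obtain U where "circle_rep U"
    "\<And>k a. a \<in> sphere 0 1 \<Longrightarrow> U a \<circ> T k \<circ> cadjoint (U a) = (\<lambda>x. a *\<^sub>C T k x)"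
    using assms(4) by (auto simp: graded_def)
  then have "graded_row_contraction T U"
    using assms(1-3) by unfold_locales auto
  then obtain V b where "graded_decomposition T V b"
    using graded_row_contraction.ex_graded_decomposition by blast
  then interpret dirac_graded_decomposition T V b
    by (rule dirac_graded_decomposition.intro)
  define ind where "ind = real (cdim (ker_on even_part D)) - real (cdim (ker_on odd_part D))"
  have fin: "finite_cdim (ker_on even_part D)" "finite_cdim (ker_on odd_part D)"
    using dirac_index by (auto simp: D)
  obtain m0 where "\<And>m. m \<ge> m0 \<Longrightarrow>
      (\<Sum>X\<in>Pow (UNIV :: 'd set). (-1) ^ card X * real (cdim (V_below (m + card X)))) = ind"
    using dirac_index by (auto simp: D ind_def)
  \<comment> \<open>With all \<open>d\<close> variables in \<open>S\<close> this gives the growth of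
    \<open>cdim (V_below n)\<close> relative to \<open>n choose d\<close>, the limit that
    \<open>curvature_eq\<close> identifies with the curvature.\<close>
  from alternating_sum_asymptotics[OF finite_class.finite_UNIV this]
  have "curvature T = of_real ((-1) ^ CARD('d) * ind)"
    by (intro curvature_eq) simp
  then have "(-1) ^ CARD('d) * curvature T = of_real ind"
    by (simp add: power_mult_distrib[symmetric] flip: mult.assoc)
  then show ?thesis
    using fin by (simp add: ind_def)
qed

end
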